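(* Let $E=(E^0,E^1,r,s)$ be a second-countable topological graph and $\beta\in\mathbb{R}$. The pushforward $r_*:\mathcal{M}^\beta_{\text{quasi}}(E)\to\mathcal{M}^\beta_{\text{sub}}(E)$, $\nu\mapsto r_*\nu$, induced by the range map $r:\partial E\to E^0$, is an affine bijection.
   Context: Measures. A Borel measure (with values in $[0,\infty]$) is regular if it is inner regular, outer regular and finite on compact sets. For a space $X$, $\mathcal{M}(X)$ and $\mathcal{M}_{\text{reg}}(X)$ denote the sets of Borel measures and of regular Borel measures on $X$. If $f:X\to Y$ is a local homeomorphism between second-countable locally compact Hausdorff spaces and $\mu\in\mathcal{M}_{\text{reg}}(Y)$, the pullback $f^*\mu$ is the unique regular Borel measure on $X$ with $f^*\mu(U)=\mu(f(U))$ for every open $U\subset X$ such that $f|_U$ is injective. If $f:X\to Y$ is continuous and $\mu$ is a Borel measure on $X$, the pushforward is $f_*\mu(B)=\mu(f^{-1}(B))$ for Borel $B\subset Y$. Topological graphs. A topological graph is $E=(E^0,E^1,r,s)$ with $E^0,E^1$ locally compact Hausdorff spaces, $s:E^1\to E^0$ a local homeomorphism and $r:E^1\to E^0$ continuous; it is second-countable if $E^0$ and $E^1$ are. For $n\ge1$, a path of length $n$ is $a=a_1a_2\cdots a_n$ with $a_k\in E^1$ and $s(a_k)=r(a_{k+1})$; $|a|=n$. $E^n$ is the set of paths of length $n$ with the subspace topology from $\prod_{k=1}^nE^1$; $E^\infty$ is the set of infinite paths $a_1a_2\cdots$ ($|a|=\infty$). $E^*=\bigsqcup_{n\ge0}E^n$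 has the disjoint union topology. Put $r(a)=r(a_1)$ for paths of positive or infinite length, $s(a)=s(a_{|a|})$ for finite paths of positive length, and $r(v)=v=s(v)$ for $v\in E^0$. Write $a(n)=a_1\cdots a_n$ for $1\le n\le|a|$ ($n$ finite), and $a(0)=r(a)$. A vertex $v\in E^0$ is regular if it has a relatively compact open neighborhood $U\subset E^0$ with $r^{-1}(\overline U)\subset E^1$ compact and $r(r^{-1}(U))=U$; $E^0_{\text{reg}}$ is the set of regular vertices, $E^0_{\text{sng}}=E^0\setminus E^0_{\text{reg}}$, and $E^*_{\text{sng}}=\{a\in E^*: s(a)\in E^0_{\text{sng}}\}$. Boundary path space. $\partial E=E^*_{\text{sng}}\sqcup E^\infty$. For $S\subset E^*$ let $Z(S)=\{a\in\partial E: a(n)\in S\text{ for some }0\le n\le|a|\}$. The sets $Z(U)\setminus Z(K)$, with $U\subset E^*$ open and $K\subset E^*$ compact, form a base of a locally compact Hausdorff topology on $\partial E$ (second-countable if $E$ is). The range map extends to $r:\partial E\to E^0$, $a\mapsto r(a)$. The backwards shift $\sigma:\partial E\setminus E^0\to\partial E$ removes the first edge: $\sigma(a)=a_2a_3\cdots$ if $|a|\ge2$ and $\sigma(a)=s(a)$ if $|a|=1$ (here $\partial E\setminus E^0$ is the set of boundary paths of length $\ge 1$); it is a local homeomorphism. Invariant measures. $\mathcal{M}^\beta_{\text{quasi}}(E)$ is the set of regular Borel measures $\nu$ on $\partial E$ with $\sigma^*\nu=e^\beta\nu$ on $\partial E\setminus E^0$. Let $T=r_*s^*:\mathcal{M}_{\text{reg}}(E^0)\to\mathcal{M}(E^0)$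 with $r,s:E^1\to E^0$, i.e. $T\mu(B)=(s^*\mu)(r^{-1}(B))$. $\mathcal{M}^\beta_{\text{sub}}(E)$ is the set of regular Borel measures $\mu$ on $E^0$ with $T\mu\le e^\beta\mu$ on $E^0$ and equality on (Borel subsets of) $E^0_{\text{reg}}$. *)

theory Defs
  imports "HOL-Analysis.Analysis"
begin

section \<open>Borel measures on abstract topological spaces\<close>

definition borel_algebra :: "'a topology \<Rightarrow> 'a measure" where
  "borel_algebra X = sigma (topspace X) {U. openin X U}"

definition borel_measures :: "'a topology \<Rightarrow> 'a measure set" where
  "borel_measures X = {\<mu>. sets \<mu> = sets (borel_algebra X)}"

definition regular_measures :: "'a topology \<Rightarrow> 'a measure set" where
  "regular_measures X = {\<mu> \<in> borel_measures X.
     (\<forall>B\<in>sets \<mu>. emeasure \<mu> B = (SUP K\<in>{K. compactin X K \<and> K \<subseteq> B}. emeasure \<mu> K)) \<and>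
     (\<forall>B\<in>sets \<mu>. emeasure \<mu> B = (INF U\<in>{U. openin X U \<and> B \<subseteq> U}. emeasure \<mu> U)) \<and>
     (\<forall>K. compactin X K \<longrightarrow> emeasure \<mu> K < \<infinity>)}"

definition local_homeomorphism :: "'a topology \<Rightarrow> 'b topology \<Rightarrow> ('a \<Rightarrow> 'b) \<Rightarrow> bool" where
  "local_homeomorphism X Y f \<longleftrightarrow>
     (\<forall>x\<in>topspace X. \<exists>U. openin X U \<and> x \<in> U \<and> openin Y (f ` U) \<and>
        homeomorphic_map (subtopology X U) (subtopology Y (f ` U)) f)"

text \<open>Meaningful for a local homeomorphism \<open>f\<close> between second-countable locally compact
  Hausdorff spaces and a regular \<open>\<mu>\<close>; the described measure then exists and is unique.\<close>

definition pullback_measure ::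
    "'a topology \<Rightarrow> 'b topology \<Rightarrow> ('a \<Rightarrow> 'b) \<Rightarrow> 'b measure \<Rightarrow> 'a measure" where
  "pullback_measure X Y f \<mu> =
     (THE \<nu>. \<nu> \<in> regular_measures X \<and>
        (\<forall>U. openin X U \<and> inj_on f U \<longrightarrow> emeasure \<nu> U = emeasure \<mu> (f ` U)))"

definition pushforward :: "'b topology \<Rightarrow> ('a \<Rightarrow> 'b) \<Rightarrow> 'a measure \<Rightarrow> 'b measure" where
  "pushforward Y f \<mu> = distr \<mu> (borel_algebra Y) f"

definition convex_comb :: "real \<Rightarrow> 'a measure \<Rightarrow> 'a measure \<Rightarrow> 'a measure" where
  "convex_comb t \<mu> \<nu> = measure_of (space \<mu>) (sets \<mu>)
     (\<lambda>B. ennreal t * emeasure \<mu> B + ennreal (1 - t) * emeasure \<nu> B)"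

lemma sets_convex_comb [simp]: "sets (convex_comb t \<mu> \<nu>) = sets \<mu>"
  by (simp add: convex_comb_def)

lemma emeasure_convex_comb:
  assumes "sets \<nu> = sets \<mu>" "B \<in> sets \<mu>"
  shows "emeasure (convex_comb t \<mu> \<nu>) B =
           ennreal t * emeasure \<mu> B + ennreal (1 - t) * emeasure \<nu> B"
  unfolding convex_comb_def
proof (rule emeasure_measure_of_sigma)
  show "countably_additive (sets \<mu>)
          (\<lambda>B. ennreal t * emeasure \<mu> B + ennreal (1 - t) * emeasure \<nu> B)"
  proof (rule countably_additiveI)
    fix A :: "nat \<Rightarrow> 'a set"
    assume A: "range A \<subseteq> sets \<mu>" "disjoint_family A"
    then have "(\<Sum>i. emeasure \<mu> (A i)) = emeasure \<mu> (\<Union>i. A i)"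
      "(\<Sum>i. emeasure \<nu> (A i)) = emeasure \<nu> (\<Union>i. A i)"
      using assms(1) by (auto intro!: suminf_emeasure)
    then show "(\<Sum>i. ennreal t * emeasure \<mu> (A i) + ennreal (1 - t) * emeasure \<nu> (A i)) =
        ennreal t * emeasure \<mu> (\<Union>i. A i) + ennreal (1 - t) * emeasure \<nu> (\<Union>i. A i)"
      by (simp add: suminf_add [symmetric] ennreal_suminf_cmult)
  qed
qed (use assms in \<open>auto simp: positive_def sets.sigma_algebra_axioms\<close>)

definition convex_measures :: "'a measure set \<Rightarrow> bool" where
  "convex_measures A \<longleftrightarrow>
     (\<forall>\<mu>\<in>A. \<forall>\<nu>\<in>A. \<forall>t\<in>{0..1}. convex_comb t \<mu> \<nu> \<in> A)"

definition affine_map ::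
    "'a measure set \<Rightarrow> 'b measure set \<Rightarrow> ('a measure \<Rightarrow> 'b measure) \<Rightarrow> bool" where
  "affine_map A B F \<longleftrightarrow>
     convex_measures A \<and> convex_measures B \<and> F \<in> A \<rightarrow> B \<and>
     (\<forall>\<mu>\<in>A. \<forall>\<nu>\<in>A. \<forall>t\<in>{0..1}. F (convex_comb t \<mu> \<nu>) = convex_comb t (F \<mu>) (F \<nu>))"


section \<open>Topological graphs\<close>

text \<open>Vertices and edges form abstract topologies rather than types, so that the edge space
  (or the vertex space) may be empty.\<close>

record ('v, 'e) graph =
  vertex_space :: "'v topology"
  edge_space :: "'e topology"
  rng :: "'e \<Rightarrow> 'v"
  src :: "'e \<Rightarrow> 'v"

definition topological_graph :: "('v, 'e) graph \<Rightarrow> bool" where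
  "topological_graph E \<longleftrightarrow>
     locally_compact_space (vertex_space E) \<and> Hausdorff_space (vertex_space E) \<and>
     locally_compact_space (edge_space E) \<and> Hausdorff_space (edge_space E) \<and>
     local_homeomorphism (edge_space E) (vertex_space E) (src E) \<and>
     continuous_map (edge_space E) (vertex_space E) (rng E)"

definition second_countable_graph :: "('v, 'e) graph \<Rightarrow> bool" where
  "second_countable_graph E \<longleftrightarrow>
     second_countable (vertex_space E) \<and> second_countable (edge_space E)"

definition regular_vertices :: "('v, 'e) graph \<Rightarrow> 'v set" where
  "regular_vertices E = {v \<in> topspace (vertex_space E).
     \<exists>U. openin (vertex_space E) U \<and> v \<in> U \<and>
       compactin (vertex_space E) (vertex_space E closure_of U) \<and>
       compactin (edge_space E)
         {e \<in> topspace (edge_space E). rng E e \<in> vertex_space E closure_of U} \<and>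
       rng E ` {e \<in> topspace (edge_space E). rng E e \<in> U} = U}"

definition singular_vertices :: "('v, 'e) graph \<Rightarrow> 'v set" where
  "singular_vertices E = topspace (vertex_space E) - regular_vertices E"


section \<open>Paths\<close>

text \<open>The constructors stand for paths of length \<open>0\<close>, of finite positive length, and of
  infinite length. Edges are numbered from \<open>0\<close>, and \<open>Finite_Path []\<close> is not a path.\<close>

datatype ('v, 'e) path =
  Vertex (the_vertex: 'v) | Finite_Path (the_edges: "'e list") | Infinite_Path "nat \<Rightarrow> 'e"

fun path_length :: "('v, 'e) path \<Rightarrow> enat" where
  "path_length (Vertex v) = 0"
| "path_length (Finite_Path es) = enat (length es)"
| "path_length (Infinite_Path f) = \<infinity>"

fun path_range :: "('v, 'e) graph \<Rightarrow> ('v, 'e) path \<Rightarrow> 'v" where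
  "path_range E (Vertex v) = v"
| "path_range E (Finite_Path es) = rng E (hd es)"
| "path_range E (Infinite_Path f) = rng E (f 0)"

text \<open>The source of an infinite path is left unspecified.\<close>

fun path_source :: "('v, 'e) graph \<Rightarrow> ('v, 'e) path \<Rightarrow> 'v" where
  "path_source E (Vertex v) = v"
| "path_source E (Finite_Path es) = src E (last es)"

definition paths_of_length :: "('v, 'e) graph \<Rightarrow> nat \<Rightarrow> ('v, 'e) path set" where
  "paths_of_length E n =
     (if n = 0 then Vertex ` topspace (vertex_space E)
      else {Finite_Path es |es. length es = n \<and> set es \<subseteq> topspace (edge_space E) \<and>
              (\<forall>k. Suc k < n \<longrightarrow> src E (es ! k) = rng E (es ! Suc k))})"

definition infinite_paths :: "('v, 'e) graph \<Rightarrow> ('v, 'e) path set" where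
  "infinite_paths E =
     {Infinite_Path f |f. \<forall>k. f k \<in> topspace (edge_space E) \<and> src E (f k) = rng E (f (Suc k))}"

definition finite_paths :: "('v, 'e) graph \<Rightarrow> ('v, 'e) path set" where
  "finite_paths E = (\<Union>n. paths_of_length E n)"

text \<open>Topologies are transported along injections: a path of length \<open>n \<ge> 1\<close> corresponds to the
  tuple of its edges, and a finite path to its copy in the tagged disjoint union.\<close>

definition paths_topology :: "('v, 'e) graph \<Rightarrow> nat \<Rightarrow> ('v, 'e) path topology" where
  "paths_topology E n =
     (if n = 0 then pullback_topology (paths_of_length E 0) the_vertex (vertex_space E)
      else pullback_topology (paths_of_length E n)
             (\<lambda>a. \<lambda>k\<in>{..<n}. the_edges a ! k)
             (product_topology (\<lambda>_. edge_space E) {..<n}))"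

definition finite_paths_topology :: "('v, 'e) graph \<Rightarrow> ('v, 'e) path topology" where
  "finite_paths_topology E =
     pullback_topology (finite_paths E) (\<lambda>a. (the_enat (path_length a), a))
       (sum_topology (paths_topology E) UNIV)"

text \<open>The initial segment \<open>a(n)\<close>, only used for \<open>n\<close> at most the length of \<open>a\<close>.\<close>

fun initial :: "('v, 'e) graph \<Rightarrow> ('v, 'e) path \<Rightarrow> nat \<Rightarrow> ('v, 'e) path" where
  "initial E a 0 = Vertex (path_range E a)"
| "initial E (Finite_Path es) (Suc n) = Finite_Path (take (Suc n) es)"
| "initial E (Infinite_Path f) (Suc n) = Finite_Path (map f [0..<Suc n])"


section \<open>The boundary path space\<close>

definition boundary_paths :: "('v, 'e) graph \<Rightarrow> ('v, 'e) path set" where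
  "boundary_paths E =
     {a \<in> finite_paths E. path_source E a \<in> singular_vertices E} \<union> infinite_paths E"

definition cylinder :: "('v, 'e) graph \<Rightarrow> ('v, 'e) path set \<Rightarrow> ('v, 'e) path set" where
  "cylinder E S = {a \<in> boundary_paths E. \<exists>n. enat n \<le> path_length a \<and> initial E a n \<in> S}"

definition boundary_topology :: "('v, 'e) graph \<Rightarrow> ('v, 'e) path topology" where
  "boundary_topology E = topology_generated_by
     {cylinder E U - cylinder E K |U K.
        openin (finite_paths_topology E) U \<and> compactin (finite_paths_topology E) K}"

definition positive_boundary_paths :: "('v, 'e) graph \<Rightarrow> ('v, 'e) path set" where
  "positive_boundary_paths E = {a \<in> boundary_paths E. 1 \<le> path_length a}"

definition positive_boundary_topology :: "('v, 'e) graph \<Rightarrow> ('v, 'e) path topology" where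
  "positive_boundary_topology E =
     subtopology (boundary_topology E) (positive_boundary_paths E)"

text \<open>The backwards shift, unspecified on vertices.\<close>

fun shift :: "('v, 'e) graph \<Rightarrow> ('v, 'e) path \<Rightarrow> ('v, 'e) path" where
  "shift E (Finite_Path es) =
     (if length es \<ge> 2 then Finite_Path (tl es) else Vertex (path_source E (Finite_Path es)))"
| "shift E (Infinite_Path f) = Infinite_Path (\<lambda>k. f (Suc k))"


section \<open>Quasi-invariant and sub-invariant measures\<close>

definition quasi_invariant_measures ::
    "('v, 'e) graph \<Rightarrow> real \<Rightarrow> ('v, 'e) path measure set" where
  "quasi_invariant_measures E \<beta> = {\<nu> \<in> regular_measures (boundary_topology E).
     pullback_measure (positive_boundary_topology E) (boundary_topology E) (shift E) \<nu> =
     scale_measure (ennreal (exp \<beta>)) (restrict_space \<nu> (positive_boundary_paths E))}"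

definition transfer :: "('v, 'e) graph \<Rightarrow> 'v measure \<Rightarrow> 'v measure" where
  "transfer E \<mu> = pushforward (vertex_space E) (rng E)
     (pullback_measure (edge_space E) (vertex_space E) (src E) \<mu>)"

definition sub_invariant_measures :: "('v, 'e) graph \<Rightarrow> real \<Rightarrow> 'v measure set" where
  "sub_invariant_measures E \<beta> = {\<mu> \<in> regular_measures (vertex_space E).
     (\<forall>B\<in>sets (borel_algebra (vertex_space E)).
        emeasure (transfer E \<mu>) B \<le> ennreal (exp \<beta>) * emeasure \<mu> B) \<and>
     (\<forall>B\<in>sets (borel_algebra (vertex_space E)). B \<subseteq> regular_vertices E \<longrightarrow>
        emeasure (transfer E \<mu>) B = ennreal (exp \<beta>) * emeasure \<mu> B)}"

end

theory Submission
  imports Defs "HOL-Probability.Projective_Limit"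
begin

text \<open>A boundary path is recorded by the sequence of its initial segments, the \<open>n\<close>-th of them in the
  one-point compactification of the space of paths of length \<open>n\<close>, with the point at infinity for
  segments beyond the end of the path. The boundary topology is the one induced by this embedding
  into a countable product, and the range map turns out to be proper. Hence on the boundary, as on
  the vertex space, a Borel measure is regular as soon as it is finite on compact sets.

  Cut the edge space into countably many Borel pieces on which the source map is injective. Both
  pullbacks become countable sums of image measures, and quasi-invariance of \<open>\<nu>\<close> expresses the
  value of \<open>\<nu>\<close> on a cylinder over paths of length \<open>n + 1\<close> through its values on cylinders over paths
  of length \<open>n\<close>. So \<open>\<nu>\<close> is determined by its image under the range map.

  Conversely, given \<open>\<mu>\<close>, let \<open>\<eta>\<close> be \<open>\<mu> - exp (-\<beta>) T \<mu>\<close>, which is carried by the singular vertices.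
  Starting from \<open>\<mu>\<close> on vertices, iterate the map \<open>\<Lambda> \<mapsto> \<eta> + exp (-\<beta>) F \<Lambda>\<close>, where \<open>F\<close> prepends an edge.
  The iterates agree on longer and longer initial segments, so Kolmogorov's extension theorem yields
  a measure on sequences. It is carried by the boundary paths and fixed by the map, which is
  quasi-invariance.\<close>

section \<open>Borel sets and regular measures\<close>

text \<open>Properness of the range map is where regular vertices enter. A limit of boundary paths
  could fail to be a boundary path only by stopping at a regular vertex; but the edges with range
  near such a vertex lie in a compact set, so the next edges of the approximating paths cannot
  escape to infinity. Singular vertices permit this escape, and boundary paths may end exactly
  there.

  The obstacle to surjectivity is that the measures of the iteration live on all finite paths and
  may be infinite. Paths that end at a regular vertex are the only ones off the boundary; step by
  step their mass is traced back to \<eta> on regular vertices, which is zero because T \<mu> equals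
  exp \<beta> times \<mu> there. Infinite mass is tamed by a density in the first coordinate: every
  stage has image \<mu> under the range map, so one density normalises all stages and can be divided
  out of the limit.

  The constant exp (-\<beta>) is forced: quasi-invariance says that putting a fixed choice of edges
  in front of the paths in a set multiplies its mass by exp (-\<beta>).\<close>

lemma space_borel_algebra [simp]: "space (borel_algebra X) = topspace X"
  unfolding borel_algebra_def by (rule space_measure_of) (auto dest: openin_subset)

lemma sets_borel_algebra:
  "sets (borel_algebra X) = sigma_sets (topspace X) {U. openin X U}"
  unfolding borel_algebra_def by (rule sets_measure_of) (auto dest: openin_subset)

lemma openin_borel_algebra: "openin X U \<Longrightarrow> U \<in> sets (borel_algebra X)"
  by (simp add: sets_borel_algebra)

lemma continuous_map_measurable:
  assumes "continuous_map X Y f"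
  shows "f \<in> borel_algebra X \<rightarrow>\<^sub>M borel_algebra Y"
  unfolding borel_algebra_def[of Y]
proof (rule measurable_measure_of)
  show "f \<in> space (borel_algebra X) \<rightarrow> topspace Y"
    using assms by (auto simp: continuous_map_def)
  fix U assume "U \<in> {U. openin Y U}"
  then show "f -` U \<inter> space (borel_algebra X) \<in> sets (borel_algebra X)"
    using openin_continuous_map_preimage[OF assms, of U]
    by (auto simp: vimage_def Int_def conj_commute intro!: openin_borel_algebra)
qed (auto dest: openin_subset)

lemma sets_borel_subtopology:
  assumes "S \<in> sets (borel_algebra X)"
  shows "sets (borel_algebra (subtopology X S)) = sets (restrict_space (borel_algebra X) S)"
proof -
  have S: "S \<subseteq> topspace X"
    using sets.sets_into_space[OF assms] by simp
  have "sigma_sets S {U. openin (subtopology X S) U} = sigma_sets S ((\<inter>) S ` {U. openin X U})"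
    by (rule arg_cong[where f = "sigma_sets S"]) (auto simp: openin_subtopology image_iff)
  also have "\<dots> = (\<inter>) S ` sigma_sets (topspace X) {U. openin X U}"
    using assms S by (subst sigma_sets_Int) (auto simp: sets_borel_algebra)
  finally show ?thesis
    using S by (simp add: sets_borel_algebra sets_restrict_space Int_absorb1)
qed

lemma sets_restrict_space_measurable:
  "S \<in> sets M \<Longrightarrow> A \<in> sets (restrict_space M S) \<longleftrightarrow> A \<subseteq> S \<and> A \<in> sets M"
  by (rule sets_restrict_space_iff) (simp add: sets.Int_space_eq2)

lemma borel_subtopology_sets:
  "S \<in> sets (borel_algebra X) \<Longrightarrow>
    A \<in> sets (borel_algebra (subtopology X S)) \<longleftrightarrow> A \<subseteq> S \<and> A \<in> sets (borel_algebra X)"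
  by (simp add: sets_borel_subtopology sets_restrict_space_measurable)

text \<open>A homeomorphism onto a Borel subset of a Polish type. The regularity theorems for finite
  Borel measures concern Polish types, while the spaces here are abstract topologies; this notion
  carries measures, Borel sets and compact sets across.\<close>

definition std_embedding :: "'a topology \<Rightarrow> ('a \<Rightarrow> 'p::polish_space) \<Rightarrow> bool" where
  "std_embedding X \<theta> \<longleftrightarrow> inj_on \<theta> (topspace X) \<and>
     (\<forall>U. openin X U \<longleftrightarrow> (\<exists>W. open W \<and> U = \<theta> -` W \<inter> topspace X)) \<and>
     \<theta> ` topspace X \<in> sets borel"

context
  fixes X :: "'a topology" and \<theta> :: "'a \<Rightarrow> 'p::polish_space"
  assumes emb: "std_embedding X \<theta>"
begin

lemma std_embedding_inj: "inj_on \<theta> (topspace X)"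
  using emb by (simp add: std_embedding_def)

lemma std_embedding_openin:
  "openin X U \<longleftrightarrow> (\<exists>W. open W \<and> U = \<theta> -` W \<inter> topspace X)"
  using emb by (simp add: std_embedding_def)

lemma std_embedding_range: "\<theta> ` topspace X \<in> sets borel"
  using emb by (simp add: std_embedding_def)

lemma std_embedding_continuous: "continuous_map X euclidean \<theta>"
proof -
  have "{x \<in> topspace X. \<theta> x \<in> W} = \<theta> -` W \<inter> topspace X" for W
    by auto
  then show ?thesis
    using std_embedding_openin by (auto simp: continuous_map_def)
qed

lemma std_embedding_measurable: "\<theta> \<in> borel_algebra X \<rightarrow>\<^sub>M borel"
proof (rule borel_measurableI)
  fix W :: "'p set" assume "open W"
  then show "\<theta> -` W \<inter> space (borel_algebra X) \<in> sets (borel_algebra X)"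
    using std_embedding_openin by (auto intro!: openin_borel_algebra)
qed

text \<open>Borel sets of \<open>X\<close> are preimages of Borel sets of the Polish type. Because
  the range is Borel, their images are Borel as well, so that Borel sets can be moved in both
  directions.\<close>

lemma std_embedding_sets:
  "B \<in> sets (borel_algebra X) \<longleftrightarrow> B \<subseteq> topspace X \<and> \<theta> ` B \<in> sets borel"
proof
  assume B: "B \<in> sets (borel_algebra X)"
  have "B \<in> sets (vimage_algebra (topspace X) \<theta> borel)"
  proof -
    have "sigma_sets (topspace X) {U. openin X U} \<subseteq> sets (vimage_algebra (topspace X) \<theta> borel)"
    proof (rule sets.sigma_sets_subset[where M = "vimage_algebra (topspace X) \<theta> borel", simplified])
      show "{U. openin X U} \<subseteq> sets (vimage_algebra (topspace X) \<theta> borel)"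
        using std_embedding_openin by (auto intro!: in_vimage_algebra)
    qed
    with B show ?thesis by (auto simp: sets_borel_algebra)
  qed
  then obtain W where W: "W \<in> sets borel" "B = \<theta> -` W \<inter> topspace X"
    by (auto simp: sets_vimage_algebra2)
  then have "\<theta> ` B = W \<inter> \<theta> ` topspace X"
    by auto
  with W std_embedding_range show "B \<subseteq> topspace X \<and> \<theta> ` B \<in> sets borel"
    by auto
next
  assume B: "B \<subseteq> topspace X \<and> \<theta> ` B \<in> sets borel"
  then have "\<theta> -` (\<theta> ` B) \<inter> topspace X = B"
    using std_embedding_inj by (auto simp: inj_on_def)
  with measurable_sets[OF std_embedding_measurable, of "\<theta> ` B"] B
  show "B \<in> sets (borel_algebra X)" by simp
qed

lemma std_embedding_compactin: "compactin X K \<longleftrightarrow> K \<subseteq> topspace X \<and> compact (\<theta> ` K)"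
proof
  assume "compactin X K"
  then show "K \<subseteq> topspace X \<and> compact (\<theta> ` K)"
    using image_compactin[OF _ std_embedding_continuous] compactin_subset_topspace by fastforce
next
  assume K: "K \<subseteq> topspace X \<and> compact (\<theta> ` K)"
  show "compactin X K"
    unfolding compactin_def
  proof (intro conjI allI impI)
    fix \<U> assume \<U>: "Ball \<U> (openin X) \<and> K \<subseteq> \<Union>\<U>"
    have "\<forall>U\<in>\<U>. \<exists>W. open W \<and> U = \<theta> -` W \<inter> topspace X"
      using \<U> std_embedding_openin by auto
    then obtain w where w: "\<And>U. U \<in> \<U> \<Longrightarrow> open (w U) \<and> U = \<theta> -` w U \<inter> topspace X"
      by metis
    have cov: "\<theta> ` K \<subseteq> \<Union>(w ` \<U>)"
    proof safe
      fix x assume "x \<in> K"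
      then obtain U where "U \<in> \<U>" "x \<in> U" using \<U> by auto
      then show "\<theta> x \<in> \<Union>(w ` \<U>)" using w by blast
    qed
    have "\<forall>c\<in>w ` \<U>. open c"
      using w by auto
    then obtain D where "D \<subseteq> w ` \<U>" "finite D" "\<theta> ` K \<subseteq> \<Union>D"
      using K cov by (meson compactE)
    moreover from this obtain F where "F \<subseteq> \<U>" "finite F" "D = w ` F"
      by (meson finite_subset_image)
    moreover have "K \<subseteq> \<Union>F"
    proof
      fix x assume "x \<in> K"
      then obtain U where "U \<in> F" "\<theta> x \<in> w U"
        using \<open>\<theta> ` K \<subseteq> \<Union>D\<close> \<open>D = w ` F\<close> by auto
      then show "x \<in> \<Union>F"
        using w \<open>x \<in> K\<close> K \<open>F \<subseteq> \<U>\<close> by blast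
    qed
    ultimately show "\<exists>\<F>. finite \<F> \<and> \<F> \<subseteq> \<U> \<and> K \<subseteq> \<Union>\<F>"
      by blast
  qed (use K in auto)
qed

lemma std_embedding_compact_sets: "compactin X K \<Longrightarrow> K \<in> sets (borel_algebra X)"
  by (simp add: std_embedding_compactin std_embedding_sets borel_compact)

lemma std_embedding_subtopology:
  assumes "openin X S"
  shows "std_embedding (subtopology X S) \<theta>"
proof -
  have S: "S \<subseteq> topspace X" using assms openin_subset by auto
  have "openin (subtopology X S) U \<longleftrightarrow> (\<exists>W. open W \<and> U = \<theta> -` W \<inter> S)" for U
    unfolding openin_subtopology std_embedding_openin using S by blast
  moreover have "\<theta> ` S \<in> sets borel"
    using assms openin_borel_algebra std_embedding_sets by blast
  ultimately show ?thesis
    using S std_embedding_inj by (auto simp: std_embedding_def Int_absorb1 intro: inj_on_subset)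
qed

end

text \<open>Reads a measurable function on \<open>X\<close> in the coordinates given by the
  embedding. The constant \<open>c\<close> off the range does no harm since the range is
  Borel.\<close>

lemma std_embedding_extend_measurable:
  fixes \<theta> :: "'a \<Rightarrow> 'p::polish_space" and g :: "'a \<Rightarrow> 'q::topological_space"
  assumes emb: "std_embedding X \<theta>" and g: "g \<in> borel_algebra X \<rightarrow>\<^sub>M borel"
  shows "(\<lambda>y. if y \<in> \<theta> ` topspace X then g (inv_into (topspace X) \<theta> y) else c) \<in> borel_measurable borel"
    (is "?f \<in> _")
proof (rule measurableI)
  fix W :: "'q set" assume W: "W \<in> sets borel"
  have m: "g -` W \<inter> topspace X \<in> sets (borel_algebra X)" using measurable_sets[OF g W] by simp
  have "?f -` W \<inter> space borel = \<theta> ` (g -` W \<inter> topspace X) \<union> (if c \<in> W then - \<theta> ` topspace X else {})"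
    using inv_into_f_f[OF std_embedding_inj[OF emb]] by (auto split: if_splits)
  also have "\<dots> \<in> sets borel"
    using m std_embedding_sets[OF emb] std_embedding_range[OF emb] by (auto simp: borel_comp)
  finally show "?f -` W \<inter> space borel \<in> sets borel" .
qed simp

text \<open>Sigma-compactness in the form that makes a measure finite on compact sets sigma-finite
  by means of open sets.\<close>

definition relatively_compact_cover :: "'a topology \<Rightarrow> bool" where
  "relatively_compact_cover X \<longleftrightarrow> (\<exists>W::nat \<Rightarrow> 'a set. (\<forall>n. openin X (W n) \<and> (\<exists>K. compactin X K \<and> W n \<subseteq> K)) \<and>
     (\<Union>n. W n) = topspace X)"

lemma relatively_compact_coverE:
  assumes "relatively_compact_cover X"
  obtains W K where "\<And>n::nat. openin X (W n)" "\<And>n. compactin X (K n)" "\<And>n. W n \<subseteq> K n"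
    "(\<Union>n. W n) = topspace X"
  using assms unfolding relatively_compact_cover_def by metis

text \<open>The space is exhausted by open sets of finite measure, and on each of them the image
  measure in the Polish type is finite, hence regular. Inner regularity follows in the limit; outer
  regularity by adding up errors that form a geometric series.\<close>

lemma regular_measuresI:
  fixes \<theta> :: "'a \<Rightarrow> 'p::polish_space"
  assumes emb: "std_embedding X \<theta>" and relatively_compact_cover: "relatively_compact_cover X"
    and \<mu>: "\<mu> \<in> borel_measures X"
    and fin: "\<And>K. compactin X K \<Longrightarrow> emeasure \<mu> K < \<infinity>"
  shows "\<mu> \<in> regular_measures X"
proof -
  have sets_\<mu>: "sets \<mu> = sets (borel_algebra X)"
    using \<mu> by (simp add: borel_measures_def)
  have space_\<mu>: "space \<mu> = topspace X"
    using sets_eq_imp_space_eq[OF sets_\<mu>] by simp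
  obtain V :: "nat \<Rightarrow> 'a set" where V: "\<And>n. openin X (V n)" "\<And>n. \<exists>K. compactin X K \<and> V n \<subseteq> K"
    "(\<Union>n. V n) = topspace X"
    using relatively_compact_cover unfolding relatively_compact_cover_def by metis
  have V_fin: "emeasure \<mu> (V n) < \<infinity>" for n
  proof -
    obtain K where K: "compactin X K" "V n \<subseteq> K" using V(2) by auto
    then have "emeasure \<mu> (V n) \<le> emeasure \<mu> K"
      by (intro emeasure_mono) (auto simp: sets_\<mu> std_embedding_compact_sets[OF emb])
    with fin[OF K(1)] show ?thesis by auto
  qed
  define W where "W n = (\<Union>i\<le>n. V i)" for n
  have W_open: "openin X (W n)" for n
    unfolding W_def using V(1) by auto
  have W_sets: "W n \<in> sets \<mu>" for n
    using W_open by (simp add: sets_\<mu> openin_borel_algebra)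
  have W_fin: "emeasure \<mu> (W n) < \<infinity>" for n
  proof -
    have "emeasure \<mu> (W n) \<le> (\<Sum>i\<le>n. emeasure \<mu> (V i))"
      unfolding W_def using V(1)
      by (intro emeasure_subadditive_finite) (auto simp: sets_\<mu> openin_borel_algebra)
    also have "\<dots> < \<infinity>" using V_fin by (auto simp: less_top)
    finally show ?thesis .
  qed
  have W_inc: "incseq W" unfolding W_def by (auto simp: incseq_def; force)
  have W_Un: "(\<Union>n. W n) = topspace X" unfolding W_def using V(3) by auto
  \<comment> \<open>The part of the measure inside \<open>W n\<close>, as a finite measure on the
    Polish type, where \<open>inner_regular\<close> and \<open>outer_regular\<close> apply.\<close>
  define Q where "Q n = distr (restrict_space \<mu> (W n)) borel \<theta>" for n
  have \<theta>W: "\<theta> \<in> restrict_space \<mu> (W n) \<rightarrow>\<^sub>M borel" for n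
    using std_embedding_measurable[OF emb] sets_\<mu>
    by (intro measurable_restrict_space1) (simp cong: measurable_cong_sets)
  have Q: "emeasure (Q n) (\<theta> ` B) = emeasure \<mu> (B \<inter> W n)" if "B \<in> sets \<mu>" for B n
  proof -
    have B: "B \<subseteq> topspace X" "\<theta> ` B \<in> sets borel"
      using that std_embedding_sets[OF emb] sets_\<mu> by auto
    have "\<theta> -` (\<theta> ` B) \<inter> W n = B \<inter> W n"
      using B openin_subset[OF W_open, of n] std_embedding_inj[OF emb] by (auto simp: inj_on_def)
    then show ?thesis
      unfolding Q_def using B W_sets \<theta>W sets.sets_into_space[OF W_sets, of n]
      by (subst emeasure_distr) (auto simp: space_restrict_space emeasure_restrict_space Int_absorb1
        Int_absorb2)
  qed
  have Qfin: "emeasure (Q n) (space (Q n)) \<noteq> \<infinity>" for n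
  proof -
    have "emeasure (Q n) (space (Q n)) = emeasure \<mu> (W n)"
      unfolding Q_def using W_sets \<theta>W sets.sets_into_space[OF W_sets, of n]
      by (subst emeasure_distr) (auto simp: space_restrict_space emeasure_restrict_space Int_absorb1
        Int_absorb2)
    with W_fin[of n] show ?thesis by simp
  qed
  have Qsets: "sets (Q n) = sets borel" for n by (simp add: Q_def)
  have inner: "emeasure \<mu> B = (SUP K\<in>{K. compactin X K \<and> K \<subseteq> B}. emeasure \<mu> K)"
    if B: "B \<in> sets \<mu>" for B
  proof (rule antisym)
    have "emeasure \<mu> (B \<inter> W n) \<le> (SUP K\<in>{K. compactin X K \<and> K \<subseteq> B}. emeasure \<mu> K)" for n
    proof -
      have BW: "B \<inter> W n \<in> sets \<mu>" using B W_sets by auto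
      then have BW': "\<theta> ` (B \<inter> W n) \<in> sets borel" "B \<inter> W n \<subseteq> topspace X"
        using std_embedding_sets[OF emb] sets_\<mu> by auto
      have "emeasure \<mu> (B \<inter> W n) = emeasure (Q n) (\<theta> ` (B \<inter> W n))"
        using Q[OF BW, of n] by (simp add: Int_assoc)
      also have "\<dots> = (SUP K\<in>{K. K \<subseteq> \<theta> ` (B \<inter> W n) \<and> compact K}. emeasure (Q n) K)"
        using inner_regular[OF Qsets Qfin BW'(1)] .
      also have "\<dots> \<le> (SUP K\<in>{K. compactin X K \<and> K \<subseteq> B}. emeasure \<mu> K)"
      proof (rule SUP_least)
        fix L assume "L \<in> {K. K \<subseteq> \<theta> ` (B \<inter> W n) \<and> compact K}"
        then obtain K where K: "K \<subseteq> B \<inter> W n" "L = \<theta> ` K" "compact L"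
          by (auto simp: subset_image_iff)
        then have cK: "compactin X K"
          using BW' by (auto simp: std_embedding_compactin[OF emb])
        have "emeasure (Q n) L = emeasure \<mu> K"
          using Q[of K n] K std_embedding_compact_sets[OF emb cK] by (simp add: sets_\<mu> Int_absorb2)
        also have "\<dots> \<le> (SUP K\<in>{K. compactin X K \<and> K \<subseteq> B}. emeasure \<mu> K)"
          using cK K by (intro SUP_upper) auto
        finally show "emeasure (Q n) L \<le> (SUP K\<in>{K. compactin X K \<and> K \<subseteq> B}. emeasure \<mu> K)" .
      qed
      finally show ?thesis .
    qed
    moreover have "(SUP n. emeasure \<mu> (B \<inter> W n)) = emeasure \<mu> (\<Union>n. B \<inter> W n)"
      using B W_sets W_inc by (intro SUP_emeasure_incseq) (auto simp: incseq_def; blast)+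
    moreover have "(\<Union>n. B \<inter> W n) = B"
      using W_Un sets.sets_into_space[OF B] space_\<mu> by auto
    ultimately show "emeasure \<mu> B \<le> (SUP K\<in>{K. compactin X K \<and> K \<subseteq> B}. emeasure \<mu> K)"
      using SUP_least[of UNIV "\<lambda>n. emeasure \<mu> (B \<inter> W n)"] by simp
    show "(SUP K\<in>{K. compactin X K \<and> K \<subseteq> B}. emeasure \<mu> K) \<le> emeasure \<mu> B"
      using B by (intro SUP_least emeasure_mono) auto
  qed
  have outer: "emeasure \<mu> B = (INF U\<in>{U. openin X U \<and> B \<subseteq> U}. emeasure \<mu> U)"
    if B: "B \<in> sets \<mu>" for B
  proof (rule antisym)
    show "emeasure \<mu> B \<le> (INF U\<in>{U. openin X U \<and> B \<subseteq> U}. emeasure \<mu> U)"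
      by (intro INF_greatest emeasure_mono) (auto simp: sets_\<mu> openin_borel_algebra)
    show "(INF U\<in>{U. openin X U \<and> B \<subseteq> U}. emeasure \<mu> U) \<le> emeasure \<mu> B"
    proof (rule ennreal_le_epsilon)
      fix e :: real assume e: "0 < e" and Bfin: "emeasure \<mu> B < top"
      \<comment> \<open>The errors add up to \<open>e\<close>. They bound the measure of the
        difference set, not a difference of measures, because the pieces increase and
        overlap.\<close>
      have "\<exists>U. openin X U \<and> B \<inter> W n \<subseteq> U \<and>
              emeasure \<mu> (U - B \<inter> W n) \<le> ennreal (e * (1/2)^Suc n)" for n
      proof -
        have BW: "B \<inter> W n \<in> sets \<mu>" using B W_sets by auto
        then have BW': "\<theta> ` (B \<inter> W n) \<in> sets borel" "B \<inter> W n \<subseteq> topspace X"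
          using std_embedding_sets[OF emb] sets_\<mu> by auto
        have eq: "emeasure \<mu> (B \<inter> W n) = emeasure (Q n) (\<theta> ` (B \<inter> W n))"
          using Q[OF BW, of n] by (simp add: Int_assoc)
        have BWfin: "emeasure \<mu> (B \<inter> W n) < \<infinity>"
          using W_fin[of n] emeasure_mono[of "B \<inter> W n" "W n" \<mu>] W_sets[of n] by (auto simp: less_top top_unique)
        have "(INF U\<in>{U. \<theta> ` (B \<inter> W n) \<subseteq> U \<and> open U}. emeasure (Q n) U)
              < emeasure \<mu> (B \<inter> W n) + ennreal (e * (1/2)^Suc n)"
          unfolding outer_regular[OF Qsets Qfin BW'(1), symmetric] eq[symmetric]
          using BWfin e ennreal_add_left_cancel_less[of "emeasure \<mu> (B \<inter> W n)" 0 "ennreal (e * (1/2)^Suc n)"]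
          by (simp add: less_top)
        then obtain O' where O': "\<theta> ` (B \<inter> W n) \<subseteq> O'" "open O'"
          "emeasure (Q n) O' < emeasure \<mu> (B \<inter> W n) + ennreal (e * (1/2)^Suc n)"
          by (auto simp: INF_less_iff)
        \<comment> \<open>\<open>Q n\<close> ignores everything outside \<open>W n\<close>, so
          cutting down to \<open>W n\<close> preserves the measure and keeps the set open.\<close>
        define U where "U = \<theta> -` O' \<inter> W n"
        have oU: "openin X U"
        proof -
          have "U = (\<theta> -` O' \<inter> topspace X) \<inter> W n"
            unfolding U_def using openin_subset[OF W_open, of n] by auto
          moreover have "openin X (\<theta> -` O' \<inter> topspace X)"
            using O' std_embedding_openin[OF emb] by auto
          ultimately show ?thesis using W_open by auto
        qed
        have "emeasure (Q n) O' = emeasure \<mu> U"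
          unfolding Q_def U_def using W_sets \<theta>W O' sets.sets_into_space[OF W_sets, of n]
          by (subst emeasure_distr) (auto simp: space_restrict_space emeasure_restrict_space Int_absorb1
            Int_absorb2)
        moreover have "emeasure \<mu> U = emeasure \<mu> (B \<inter> W n) + emeasure \<mu> (U - B \<inter> W n)"
        proof -
          have "B \<inter> W n \<subseteq> U" using O' by (auto simp: U_def)
          then have "U = (B \<inter> W n) \<union> (U - B \<inter> W n)" by auto
          then show ?thesis
            using BW oU plus_emeasure[of "B \<inter> W n" \<mu> "U - B \<inter> W n"]
            by (metis Diff_disjoint openin_borel_algebra sets.Diff sets_\<mu>)
        qed
        ultimately have "emeasure \<mu> (B \<inter> W n) + emeasure \<mu> (U - B \<inter> W n)
            \<le> emeasure \<mu> (B \<inter> W n) + ennreal (e * (1/2)^Suc n)"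
          using O' by auto
        then have "emeasure \<mu> (U - B \<inter> W n) \<le> ennreal (e * (1/2)^Suc n)"
          using BWfin by (auto simp: ennreal_add_left_cancel_le)
        moreover have "B \<inter> W n \<subseteq> U" using O' by (auto simp: U_def)
        ultimately show ?thesis using oU by auto
      qed
      then obtain U where U: "\<And>n. openin X (U n)" "\<And>n. B \<inter> W n \<subseteq> U n"
        "\<And>n. emeasure \<mu> (U n - B \<inter> W n) \<le> ennreal (e * (1/2)^Suc n)"
        by metis
      have Us: "U n \<in> sets \<mu>" for n using U(1) by (simp add: sets_\<mu> openin_borel_algebra)
      let ?U = "\<Union>n. U n"
      have BU: "B \<subseteq> ?U"
      proof
        fix x assume "x \<in> B"
        then have "x \<in> (\<Union>n. W n)"
          unfolding W_Un using sets.sets_into_space[OF B] space_\<mu> by blast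
        then obtain n where "x \<in> W n" by blast
        moreover note \<open>x \<in> B\<close>
        ultimately show "x \<in> ?U" using U(2)[of n] by auto
      qed
      have "emeasure \<mu> ?U \<le> emeasure \<mu> (B \<union> (\<Union>n. U n - B \<inter> W n))"
        using B Us W_sets by (intro emeasure_mono) auto
      also have "\<dots> \<le> emeasure \<mu> B + emeasure \<mu> (\<Union>n. U n - B \<inter> W n)"
        using B Us W_sets by (intro emeasure_subadditive) auto
      also have "emeasure \<mu> (\<Union>n. U n - B \<inter> W n) \<le> (\<Sum>n. emeasure \<mu> (U n - B \<inter> W n))"
        using B Us W_sets by (intro emeasure_subadditive_countably) auto
      also have "\<dots> \<le> (\<Sum>n. ennreal (e * (1/2)^Suc n))"
        using U(3) by (intro suminf_le) auto
      also have "\<dots> = ennreal e"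
      proof -
        have "(\<lambda>n. e * (1/2)^Suc n) sums (e * 1)"
          by (intro sums_mult power_half_series)
        then show ?thesis
          using e by (subst suminf_ennreal2) (auto simp: sums_iff)
      qed
      finally have "emeasure \<mu> ?U \<le> emeasure \<mu> B + ennreal e"
        by (simp add: add_mono)
      moreover have "(INF U\<in>{U. openin X U \<and> B \<subseteq> U}. emeasure \<mu> U) \<le> emeasure \<mu> ?U"
        using BU U(1) by (intro INF_lower) auto
      ultimately show "(INF U\<in>{U. openin X U \<and> B \<subseteq> U}. emeasure \<mu> U) \<le> emeasure \<mu> B + ennreal e"
        by (rule order_trans[rotated])
    qed
  qed
  show ?thesis
    unfolding regular_measures_def mem_Collect_eq
    by (intro conjI ballI allI impI \<mu> inner outer fin)
qed

section \<open>One-point compactifications in sequence space\<close>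

text \<open>The zero sequence plays the role of the point at infinity.\<close>

definition compactification :: "'a topology \<Rightarrow> ('a \<Rightarrow> nat \<Rightarrow> real) \<Rightarrow> bool" where
  "compactification X \<theta> \<longleftrightarrow> std_embedding X \<theta> \<and> (\<lambda>_. 0) \<notin> \<theta> ` topspace X \<and>
     compact (insert (\<lambda>_. 0) (\<theta> ` topspace X))"

text \<open>A countable family of nonnegative functions vanishing off compact sets that separates
  points from closed sets. The same functions serve as coordinates of the embedding and as source of
  the relatively compact cover, and products of them are again of this kind, which is how they pass
  from edges to paths.\<close>

definition bump_family :: "'a topology \<Rightarrow> (nat \<Rightarrow> 'a \<Rightarrow> real) \<Rightarrow> bool" where
  "bump_family X F \<longleftrightarrow>
     (\<forall>i. continuous_map X euclideanreal (F i)) \<and> (\<forall>i. \<forall>x\<in>topspace X. 0 \<le> F i x) \<and>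
     (\<forall>i. \<exists>K. compactin X K \<and> (\<forall>x\<in>topspace X - K. F i x = 0)) \<and>
     (\<forall>U x. openin X U \<and> x \<in> U \<longrightarrow>
        (\<exists>i. 0 < F i x \<and> (\<forall>y\<in>topspace X - U. F i y = 0)))"

lemma bump_family_relatively_compact_cover:
  assumes "bump_family X F"
  shows "relatively_compact_cover X"
  unfolding relatively_compact_cover_def
proof (rule exI[of _ "\<lambda>n. {x \<in> topspace X. F n x \<in> {0<..}}"], intro conjI allI)
  fix n
  show "openin X {x \<in> topspace X. F n x \<in> {0<..}}"
    using assms by (intro openin_continuous_map_preimage[where Y = euclideanreal])
      (auto simp: bump_family_def)
  show "\<exists>K. compactin X K \<and> {x \<in> topspace X. F n x \<in> {0<..}} \<subseteq> K"
  proof -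
  obtain K where K: "compactin X K" "\<And>x. x \<in> topspace X - K \<Longrightarrow> F n x = 0"
    using assms unfolding bump_family_def by meson
  have "{x \<in> topspace X. F n x \<in> {0<..}} \<subseteq> K"
  proof
    fix x assume x: "x \<in> {x \<in> topspace X. F n x \<in> {0<..}}"
    then show "x \<in> K" using K(2)[of x] by (cases "x \<in> K") auto
  qed
  with K(1) show ?thesis by blast
  qed
next
  show "(\<Union>n. {x \<in> topspace X. F n x \<in> {0<..}}) = topspace X"
  proof
    show "topspace X \<subseteq> (\<Union>n. {x \<in> topspace X. F n x \<in> {0<..}})"
    proof
      fix x assume "x \<in> topspace X"
      moreover from this obtain i where "0 < F i x"
        using assms unfolding bump_family_def by (meson openin_topspace)
      ultimately show "x \<in> (\<Union>n. {x \<in> topspace X. F n x \<in> {0<..}})" by auto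
    qed
  qed auto
qed

text \<open>A neighbourhood of the zero sequence restricts only finitely many coordinates, and each
  coordinate vanishes off a compact set. So the neighbourhood contains the image of everything
  outside a compact set, which is why adding the zero sequence makes the image compact.\<close>

lemma bump_family_compactification:
  assumes H: "Hausdorff_space X" and F: "bump_family X F"
  shows "compactification X (\<lambda>x i. F i x)"
proof -
  let ?\<theta> = "\<lambda>x i. F i x"
  have Fc: "continuous_map X euclideanreal (F i)" for i
    using F by (simp add: bump_family_def)
  have Fpos: "\<exists>i. 0 < F i x \<and> (\<forall>y\<in>topspace X - U. F i y = 0)" if "openin X U" "x \<in> U" for U x
    using F that by (simp add: bump_family_def)
  have cont: "continuous_map X euclidean ?\<theta>"
    unfolding euclidean_product_topology[symmetric] continuous_map_componentwise_UNIV
    using Fc by auto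
  have openW: "openin X (?\<theta> -` W \<inter> topspace X)" if "open W" for W
    using openin_continuous_map_preimage[OF cont, of W] that
    by (simp add: vimage_def Int_def conj_commute)
  have inj: "inj_on ?\<theta> (topspace X)"
  proof (rule inj_onI, rule ccontr)
    fix x y assume xy: "x \<in> topspace X" "y \<in> topspace X" "?\<theta> x = ?\<theta> y" "x \<noteq> y"
    then obtain U where "openin X U" "x \<in> U" "y \<notin> U"
      using H by (metis Hausdorff_space_def disjnt_iff)
    then obtain i where "0 < F i x" "F i y = 0"
      using Fpos xy by blast
    with fun_cong[OF xy(3), of i] show False by simp
  qed
  have nz: "(\<lambda>_. 0) \<notin> ?\<theta> ` topspace X"
  proof
    assume "(\<lambda>_. 0) \<in> ?\<theta> ` topspace X"
    then obtain x where x: "x \<in> topspace X" "(\<lambda>_. 0) = ?\<theta> x" by blast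
    then obtain i where "0 < F i x" using Fpos[OF openin_topspace] by blast
    with fun_cong[OF x(2), of i] show False by simp
  qed
  have op: "openin X U \<longleftrightarrow> (\<exists>W. open W \<and> U = ?\<theta> -` W \<inter> topspace X)" for U
  proof
    assume U: "openin X U"
    \<comment> \<open>Positivity of any of these coordinates already forces a point into
      \<open>U\<close>, and each point of \<open>U\<close> has one that is positive.\<close>
    define W where "W = (\<Union>i\<in>{i. \<forall>y\<in>topspace X - U. F i y = 0}. {z :: nat \<Rightarrow> real. 0 < z i})"
    have "open {z :: nat \<Rightarrow> real. 0 < z i}" for i
      by (intro open_Collect_less continuous_intros continuous_on_product_coordinates)
    then have "open W" unfolding W_def by auto
    moreover have "U = ?\<theta> -` W \<inter> topspace X"
    proof (intro set_eqI iffI)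
      fix x assume x: "x \<in> U"
      then have "?\<theta> x \<in> W" using Fpos[OF U, of x] by (auto simp: W_def)
      then show "x \<in> ?\<theta> -` W \<inter> topspace X" using x openin_subset[OF U] by auto
    next
      fix x assume "x \<in> ?\<theta> -` W \<inter> topspace X"
      then obtain i where "0 < F i x" "\<forall>y\<in>topspace X - U. F i y = 0" "x \<in> topspace X"
        by (auto simp: W_def)
      then show "x \<in> U" by (cases "x \<in> U") auto
    qed
    ultimately show "\<exists>W. open W \<and> U = ?\<theta> -` W \<inter> topspace X" by blast
  qed (use openW in auto)
  have comp: "compact (insert (\<lambda>_. 0) (?\<theta> ` topspace X))"
  proof (rule compactI)
    fix C assume C: "\<forall>t\<in>C. open t" "insert (\<lambda>_. 0) (?\<theta> ` topspace X) \<subseteq> \<Union>C"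
    then obtain V where V: "V \<in> C" "(\<lambda>_. 0) \<in> V" by auto
    then have oV: "open V" using C by auto
    obtain Y where Y: "(\<lambda>_. 0) \<in> PiE UNIV Y" "finite {i. Y i \<noteq> (UNIV :: real set)}" "PiE UNIV Y \<subseteq> V"
      using product_topology_open_contains_basis[of "\<lambda>_::nat. euclideanreal" UNIV V "\<lambda>_. 0"] oV V(2)
      unfolding euclidean_product_topology by auto
    obtain K where K: "\<And>i. compactin X (K i)" "\<And>i x. x \<in> topspace X - K i \<Longrightarrow> F i x = 0"
      using F unfolding bump_family_def by metis
    \<comment> \<open>What \<open>V\<close> leaves uncovered: a closed set inside a finite union of
      compact sets, to be covered by finitely many further members of \<open>C\<close>.\<close>
    define L where "L = topspace X - (?\<theta> -` V \<inter> topspace X)"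
    have "L \<subseteq> (\<Union>i\<in>{i. Y i \<noteq> UNIV}. K i)"
    proof (rule ccontr)
      assume "\<not> L \<subseteq> (\<Union>i\<in>{i. Y i \<noteq> UNIV}. K i)"
      then obtain x where x: "x \<in> L" "\<And>i. Y i \<noteq> UNIV \<Longrightarrow> x \<notin> K i" by blast
      then have "F i x \<in> Y i" for i
        using K(2)[of x i] Y(1) by (cases "Y i = UNIV") (auto simp: L_def PiE_iff)
      then have "?\<theta> x \<in> V" using Y(3) by auto
      with x show False by (auto simp: L_def)
    qed
    moreover have "compactin X (\<Union>i\<in>{i. Y i \<noteq> UNIV}. K i)"
      using K(1) Y(2) by (auto intro!: compactin_Union)
    moreover have "closedin X L"
      unfolding L_def using openW[OF oV] by blast
    ultimately have "compactin X L" using closed_compactin by blast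
    then have "compact (?\<theta> ` L)" using image_compactin[OF _ cont] by auto
    moreover have "?\<theta> ` L \<subseteq> \<Union>C" using C(2) by (auto simp: L_def)
    ultimately obtain D where D: "D \<subseteq> C" "finite D" "?\<theta> ` L \<subseteq> \<Union>D"
      using C(1) by (meson compactE)
    have "insert (\<lambda>_. 0) (?\<theta> ` topspace X) \<subseteq> \<Union>(insert V D)"
      using V D(3) by (auto simp: L_def)
    with D V show "\<exists>C'\<subseteq>C. finite C' \<and> insert (\<lambda>_. 0) (?\<theta> ` topspace X) \<subseteq> \<Union>C'"
      by (meson finite_insert insert_subset)
  qed
  have "?\<theta> ` topspace X = insert (\<lambda>_. 0) (?\<theta> ` topspace X) - {\<lambda>_. 0}"
    using nz by blast
  moreover have "insert (\<lambda>_. 0) (?\<theta> ` topspace X) - {\<lambda>_. 0} \<in> sets borel"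
    using comp by (intro sets.Diff) (auto intro!: borel_closed compact_imp_closed)
  ultimately have "?\<theta> ` topspace X \<in> sets borel" by simp
  then show ?thesis
    unfolding compactification_def std_embedding_def using inj op nz comp by blast
qed

text \<open>One Urysohn function for each pair of basic open sets that admits one; the base being
  countable, there are only countably many pairs.\<close>

lemma bump_family_exists:
  assumes sc: "second_countable X" and lc: "locally_compact_space X" and H: "Hausdorff_space X"
  shows "\<exists>F. bump_family X F"
proof -
  obtain \<B> where \<B>: "countable \<B>" "\<And>V. V \<in> \<B> \<Longrightarrow> openin X V"
    "\<And>U x. openin X U \<Longrightarrow> x \<in> U \<Longrightarrow> \<exists>V\<in>\<B>. x \<in> V \<and> V \<subseteq> U"
    using sc unfolding second_countable_def by metis
  define good where "good f A B \<longleftrightarrow> continuous_map X euclideanreal f \<and> (\<forall>x\<in>topspace X. 0 \<le> f x) \<and>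
     (\<exists>K. compactin X K \<and> (\<forall>x\<in>topspace X - K. f x = 0)) \<and> (\<forall>x\<in>A. 0 < f x) \<and>
     (\<forall>y\<in>topspace X - B. f y = 0)" for f :: "'a \<Rightarrow> real" and A B
  \<comment> \<open>Pairs without a suitable function get the zero function, which is continuous,
    nonnegative and vanishes off the empty set, so all indices can be kept.\<close>
  have "\<forall>p. \<exists>f. good f (fst p) (snd p) \<or> (\<nexists>f. good f (fst p) (snd p)) \<and> f = (\<lambda>_. 0)"
    by blast
  from choice[OF this] obtain f where f: "\<And>p. good (f p) (fst p) (snd p) \<or>
      (\<nexists>f. good f (fst p) (snd p)) \<and> f p = (\<lambda>_. 0)"
    by blast
  have f_good: "good (f p) (fst p) (snd p)" if "good g (fst p) (snd p)" for p g
    using f[of p] that by blast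
  have gen: "continuous_map X euclideanreal (f p) \<and> (\<forall>x\<in>topspace X. 0 \<le> f p x) \<and>
     (\<exists>K. compactin X K \<and> (\<forall>x\<in>topspace X - K. f p x = 0))" for p
    using f[of p]
  proof
    assume "good (f p) (fst p) (snd p)"
    then show ?thesis unfolding good_def by blast
  next
    assume "(\<nexists>f. good f (fst p) (snd p)) \<and> f p = (\<lambda>_. 0)"
    then show ?thesis using compactin_empty[of X] by (auto intro!: exI[of _ "{}"])
  qed
  have nb: "neighbourhood_base_of (compactin X) X"
    using locally_compact_space_neighbourhood_base[of X] H lc by auto
  have small: "\<exists>V. openin X V \<and> compactin X (X closure_of V) \<and> x \<in> V \<and> X closure_of V \<subseteq> U"
    if "openin X U" "x \<in> U" for U x
  proof -
    obtain V K where VK: "openin X V" "compactin X K" "x \<in> V" "V \<subseteq> K" "K \<subseteq> U"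
      using nb \<open>openin X U\<close> \<open>x \<in> U\<close> unfolding neighbourhood_base_of by meson
    have "X closure_of V \<subseteq> K"
      using VK compactin_imp_closedin[OF H] by (intro closure_of_minimal) auto
    moreover from this have "compactin X (X closure_of V)"
      using closed_compactin[OF VK(2)] by simp
    ultimately show ?thesis using VK by blast
  qed
  have key: "\<exists>A\<in>\<B>. \<exists>B\<in>\<B>. x \<in> A \<and> B \<subseteq> U \<and> (\<exists>f. good f A B)" if U: "openin X U" "x \<in> U" for U x
  proof -
    \<comment> \<open>Two nested neighbourhoods with compact closure: the outer one makes the
      function vanish off a compact set, the inner one is the compact set on which Urysohn's lemma
      prescribes the value 1.\<close>
    obtain V where V: "openin X V" "compactin X (X closure_of V)" "x \<in> V" "X closure_of V \<subseteq> U"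
      using small[OF U] by auto
    obtain B where B: "B \<in> \<B>" "x \<in> B" "B \<subseteq> V" using \<B>(3) V by meson
    obtain V2 where V2: "openin X V2" "compactin X (X closure_of V2)" "x \<in> V2" "X closure_of V2 \<subseteq> B"
      using small[OF \<B>(2)[OF B(1)] B(2)] by auto
    obtain A where A: "A \<in> \<B>" "x \<in> A" "A \<subseteq> V2" using \<B>(3) V2 by meson
    have cr: "completely_regular_space X"
      using locally_compact_regular_imp_completely_regular_space[of X] lc H by blast
    have "closedin X (topspace X - B)" using \<B>(2)[OF B(1)] by blast
    moreover have "disjnt (X closure_of V2) (topspace X - B)" using V2(4) by (auto simp: disjnt_def)
    ultimately obtain f where f: "continuous_map X (top_of_set {0..1}) f"
        "f ` (topspace X - B) \<subseteq> {0::real}" "f ` (X closure_of V2) \<subseteq> {1}"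
      using Urysohn_completely_regular_compact_closed[OF zero_le_one cr V2(2), of "topspace X - B"]
      by blast
    have fc: "continuous_map X euclideanreal f" and f01: "\<And>x. x \<in> topspace X \<Longrightarrow> 0 \<le> f x"
      using f(1) by (auto simp: continuous_map_in_subtopology)
    have "A \<subseteq> X closure_of V2"
      using A(3) closure_of_subset[OF openin_subset[OF V2(1)]] by auto
    then have fA: "\<forall>x\<in>A. 0 < f x" using f(3) by fastforce
    have f0: "\<forall>y\<in>topspace X - B. f y = 0" using f(2) by auto
    have "B \<subseteq> X closure_of V"
      using B(3) closure_of_subset[OF openin_subset[OF V(1)]] by auto
    then have "\<forall>x\<in>topspace X - X closure_of V. f x = 0" using f0 by auto
    then have "good f A B"
      unfolding good_def using V(2) fc f01 fA f0 by auto
    moreover have "B \<subseteq> U"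
      using B(3) V(4) closure_of_subset[OF openin_subset[OF V(1)]] by auto
    ultimately show ?thesis using A B by auto
  qed
  have "bump_family X (\<lambda>n. f (from_nat_into (\<B> \<times> \<B>) n))"
    unfolding bump_family_def
  proof (intro conjI allI impI)
    fix U x assume "openin X U \<and> x \<in> U"
    then obtain A B g where AB: "A \<in> \<B>" "B \<in> \<B>" "x \<in> A" "B \<subseteq> U" "good g A B"
      using key by meson
    then have g: "good (f (A, B)) A B"
      using f_good[of g "(A, B)"] by auto
    obtain n where n: "from_nat_into (\<B> \<times> \<B>) n = (A, B)"
      using AB(1,2) \<B>(1) from_nat_into_surj[of "\<B> \<times> \<B>" "(A, B)"] by auto
    show "\<exists>i. 0 < f (from_nat_into (\<B> \<times> \<B>) i) x \<and> (\<forall>y\<in>topspace X - U. f (from_nat_into (\<B> \<times> \<B>) i) y = 0)"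
      using g AB by (intro exI[of _ n]) (auto simp: n good_def)
  qed (use gen in blast)+
  then show ?thesis by blast
qed

section \<open>Pullbacks, differences and projective limits of measures\<close>

lemma ennreal_suminf_swap:
  "(\<Sum>i::nat. \<Sum>j::nat. f i j :: ennreal) = (\<Sum>j. \<Sum>i. f i j)"
proof -
  have "(\<Sum>j. \<Sum>i. f i j) = (\<integral>\<^sup>+j. (\<Sum>i. f i j) \<partial>count_space UNIV)"
    by (simp add: nn_integral_count_space_nat)
  also have "\<dots> = (\<Sum>i. \<integral>\<^sup>+j. f i j \<partial>count_space UNIV)"
    by (rule nn_integral_suminf) simp
  finally show ?thesis by (simp add: nn_integral_count_space_nat)
qed

section \<open>Set functions transported along injections and preimages\<close>

lemma countably_additive_suminf:
  fixes f :: "nat \<Rightarrow> 'a set \<Rightarrow> ennreal"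
  assumes "\<And>i. countably_additive M (f i)"
  shows "countably_additive M (\<lambda>B. \<Sum>i. f i B)"
proof (rule countably_additiveI)
  fix A :: "nat \<Rightarrow> 'a set"
  assume A: "range A \<subseteq> M" "disjoint_family A" "(\<Union>i. A i) \<in> M"
  have "(\<Sum>j. \<Sum>i. f i (A j)) = (\<Sum>i. \<Sum>j. f i (A j))"
    by (rule ennreal_suminf_swap)
  also have "\<dots> = (\<Sum>i. f i (\<Union>j. A j))"
    using assms A by (simp add: countably_additive_def)
  finally show "(\<Sum>j. \<Sum>i. f i (A j)) = (\<Sum>i. f i (\<Union>j. A j))" .
qed

lemma countably_additive_plus:
  fixes f g :: "'a set \<Rightarrow> ennreal"
  assumes "countably_additive M f" "countably_additive M g"
  shows "countably_additive M (\<lambda>B. f B + c * g B)"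
proof (rule countably_additiveI)
  fix A :: "nat \<Rightarrow> 'a set"
  assume A: "range A \<subseteq> M" "disjoint_family A" "(\<Union>i. A i) \<in> M"
  then show "(\<Sum>i. f (A i) + c * g (A i)) = f (\<Union>i. A i) + c * g (\<Union>i. A i)"
    using assms by (simp add: suminf_add[symmetric] ennreal_suminf_cmult countably_additive_def)
qed

lemma countably_additive_image:
  assumes "inj_on f D" "\<And>B. B \<in> sets M \<Longrightarrow> f ` (B \<inter> D) \<in> sets N"
  shows "countably_additive (sets M) (\<lambda>B. emeasure N (f ` (B \<inter> D)))"
proof (rule countably_additiveI)
  fix A :: "nat \<Rightarrow> 'a set"
  assume A: "range A \<subseteq> sets M" "disjoint_family A"
  have "disjoint_family (\<lambda>i. f ` (A i \<inter> D))"
    using A(2) assms(1) unfolding disjoint_family_on_def inj_on_def by blast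
  moreover have "range (\<lambda>i. f ` (A i \<inter> D)) \<subseteq> sets N"
    using A(1) assms(2) by auto
  ultimately have "(\<Sum>i. emeasure N (f ` (A i \<inter> D))) = emeasure N (\<Union>i. f ` (A i \<inter> D))"
    by (intro suminf_emeasure)
  also have "(\<Union>i. f ` (A i \<inter> D)) = f ` ((\<Union>i. A i) \<inter> D)" by auto
  finally show "(\<Sum>i. emeasure N (f ` (A i \<inter> D))) = emeasure N (f ` ((\<Union>i. A i) \<inter> D))" .
qed

lemma countably_additive_vimage:
  assumes "\<And>B. B \<in> sets M \<Longrightarrow> {x \<in> D. h x \<in> B} \<in> sets N"
  shows "countably_additive (sets M) (\<lambda>B. emeasure N {x \<in> D. h x \<in> B})"
proof (rule countably_additiveI)
  fix A :: "nat \<Rightarrow> 'a set"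
  assume A: "range A \<subseteq> sets M" "disjoint_family A"
  have "disjoint_family (\<lambda>i. {x \<in> D. h x \<in> A i})"
    using A(2) unfolding disjoint_family_on_def by blast
  moreover have "range (\<lambda>i. {x \<in> D. h x \<in> A i}) \<subseteq> sets N"
    using A(1) assms by auto
  ultimately have "(\<Sum>i. emeasure N {x \<in> D. h x \<in> A i}) = emeasure N (\<Union>i. {x \<in> D. h x \<in> A i})"
    by (intro suminf_emeasure)
  also have "(\<Union>i. {x \<in> D. h x \<in> A i}) = {x \<in> D. h x \<in> (\<Union>i. A i)}" by auto
  finally show "(\<Sum>i. emeasure N {x \<in> D. h x \<in> A i}) = emeasure N {x \<in> D. h x \<in> (\<Union>i. A i)}" .
qed

lemma emeasure_disjointed_sum:
  assumes "\<And>i. Ch i \<in> sets M" "B \<in> sets M" "B \<subseteq> (\<Union>i::nat. Ch i)"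
  shows "emeasure M B = (\<Sum>i. emeasure M (B \<inter> disjointed Ch i))"
proof -
  have "disjointed Ch i \<in> sets M" for i
    using assms(1) by (auto simp: disjointed_def)
  moreover have "disjoint_family (\<lambda>i. B \<inter> disjointed Ch i)"
    using disjoint_family_disjointed[of Ch] by (auto simp: disjoint_family_on_def)
  ultimately have "(\<Sum>i. emeasure M (B \<inter> disjointed Ch i)) = emeasure M (\<Union>i. B \<inter> disjointed Ch i)"
    using assms(2) by (intro suminf_emeasure) auto
  also have "(\<Union>i. B \<inter> disjointed Ch i) = B"
    using assms(3) UN_disjointed_eq[of Ch] by blast
  finally show ?thesis by simp
qed

text \<open>Only images of Borel sets are required to be Borel, so that for the shift neither continuity
  nor openness has to be established.\<close>

lemma pullback_measure_formula:
  fixes \<theta> :: "'a \<Rightarrow> 'p::polish_space" and Ch :: "nat \<Rightarrow> 'a set"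
  assumes emb: "std_embedding X \<theta>" and relatively_compact_cover: "relatively_compact_cover X"
    and \<mu>: "\<mu> \<in> borel_measures Y" and fin: "\<And>K. compactin Y K \<Longrightarrow> emeasure \<mu> K < \<infinity>"
    and compY: "\<And>K. compactin Y K \<Longrightarrow> K \<in> sets (borel_algebra Y)"
    and Ch: "\<And>i. openin X (Ch i)" "(\<Union>i. Ch i) = topspace X" "\<And>i. inj_on f (Ch i)"
      "\<And>i. \<exists>K. compactin Y K \<and> f ` Ch i \<subseteq> K"
    and img: "\<And>i B. B \<in> sets (borel_algebra X) \<Longrightarrow> B \<subseteq> Ch i \<Longrightarrow> f ` B \<in> sets (borel_algebra Y)"
  shows "pullback_measure X Y f \<mu> \<in> regular_measures X"
    and "B \<in> sets (borel_algebra X) \<Longrightarrow>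
      emeasure (pullback_measure X Y f \<mu>) B = (\<Sum>i. emeasure \<mu> (f ` (B \<inter> disjointed Ch i)))"
proof -
  \<comment> \<open>\<open>f\<close> is injective on each chart, and disjointed charts count every
    point once. That the result does not depend on the charts follows from the uniqueness
    below.\<close>
  define F where "F B = (\<Sum>i. emeasure \<mu> (f ` (B \<inter> disjointed Ch i)))" for B
  define \<nu> where "\<nu> = measure_of (topspace X) (sets (borel_algebra X)) F"
  have sets_\<mu>: "sets \<mu> = sets (borel_algebra Y)"
    using \<mu> by (simp add: borel_measures_def)
  have Ds: "disjointed Ch i \<in> sets (borel_algebra X)" for i
    unfolding disjointed_def using openin_borel_algebra[OF Ch(1)]
    by (intro sets.Diff sets.finite_UN) auto
  have DCh: "disjointed Ch i \<subseteq> Ch i" for i by (rule disjointed_subset)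
  have Dinj: "inj_on f (disjointed Ch i)" for i
    using Ch(3) DCh inj_on_subset by blast
  have Dimg: "f ` (B \<inter> disjointed Ch i) \<in> sets \<mu>" if "B \<in> sets (borel_algebra X)" for B i
    using img[of "B \<inter> disjointed Ch i" i] that Ds DCh sets_\<mu> by auto
  have ca: "countably_additive (sets (borel_algebra X)) F"
    unfolding F_def
    by (intro countably_additive_suminf countably_additive_image Dinj Dimg)
  have sets_\<nu>: "sets \<nu> = sets (borel_algebra X)"
    unfolding \<nu>_def using sets.sigma_sets_eq[of "borel_algebra X"] sets.space_closed[of "borel_algebra X"]
    by (simp add: sets_measure_of)
  have \<nu>: "emeasure \<nu> B = F B" if "B \<in> sets (borel_algebra X)" for B
    unfolding \<nu>_def
  proof (rule emeasure_measure_of_sigma)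
    show "sigma_algebra (topspace X) (sets (borel_algebra X))"
      using sets.sigma_algebra_axioms[of "borel_algebra X"] by simp
    show "positive (sets (borel_algebra X)) F" by (simp add: positive_def F_def)
  qed (use ca that in auto)
  have inj_eq: "emeasure \<nu> B = emeasure \<mu> (f ` B)"
    if B: "B \<in> sets (borel_algebra X)" "inj_on f B" for B
  proof -
    have "disjoint_family (\<lambda>i. f ` (B \<inter> disjointed Ch i))"
      using disjoint_family_disjointed[of Ch] B(2) unfolding disjoint_family_on_def inj_on_def by blast
    then have "F B = emeasure \<mu> (\<Union>i. f ` (B \<inter> disjointed Ch i))"
      unfolding F_def using Dimg[OF B(1)] by (intro suminf_emeasure) auto
    also have "(\<Union>i. f ` (B \<inter> disjointed Ch i)) = f ` (B \<inter> (\<Union>i. disjointed Ch i))" by auto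
    also have "B \<inter> (\<Union>i. disjointed Ch i) = B"
      using sets.sets_into_space[OF B(1)] Ch(2) UN_disjointed_eq[of Ch] by auto
    finally show ?thesis using \<nu>[OF B(1)] by simp
  qed
  have Chs: "Ch i \<in> sets (borel_algebra X)" for i
    using Ch(1) openin_borel_algebra by blast
  have Chfin: "emeasure \<nu> (Ch i) < \<infinity>" for i
  proof -
    obtain K where K: "compactin Y K" "f ` Ch i \<subseteq> K" using Ch(4) by auto
    have "emeasure \<nu> (Ch i) = emeasure \<mu> (f ` Ch i)"
      using inj_eq Ch(3) Chs by simp
    also have "\<dots> \<le> emeasure \<mu> K"
      using K compY sets_\<mu> by (intro emeasure_mono) auto
    finally show ?thesis using fin[OF K(1)] by auto
  qed
  have \<nu>_reg: "\<nu> \<in> regular_measures X"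
  proof (rule regular_measuresI[OF emb relatively_compact_cover])
    show "\<nu> \<in> borel_measures X" by (simp add: borel_measures_def sets_\<nu>)
    fix K assume K: "compactin X K"
    have "K \<subseteq> \<Union>(range Ch)" using compactin_subset_topspace[OF K] Ch(2) by simp
    then obtain \<F> where "finite \<F>" "\<F> \<subseteq> range Ch" "K \<subseteq> \<Union>\<F>"
      using K Ch(1) unfolding compactin_def by (metis rangeE)
    then obtain I where I: "finite I" "K \<subseteq> (\<Union>i\<in>I. Ch i)"
      by (metis finite_subset_image)
    have "emeasure \<nu> K \<le> emeasure \<nu> (\<Union>i\<in>I. Ch i)"
      using I Chs sets_\<nu> by (intro emeasure_mono) auto
    also have "\<dots> \<le> (\<Sum>i\<in>I. emeasure \<nu> (Ch i))"
      using I Chs sets_\<nu> by (intro emeasure_subadditive_finite) auto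
    also have "\<dots> < \<infinity>" using Chfin I by (auto simp: less_top)
    finally show "emeasure \<nu> K < \<infinity>" .
  qed
  \<comment> \<open>Open subsets of a chart have prescribed measure, outer regularity extends this
    to Borel subsets of the chart, and the disjointed charts add up to the whole space.\<close>
  have uniq: "\<nu>' = \<nu>" if \<nu>': "\<nu>' \<in> regular_measures X"
    "\<forall>U. openin X U \<and> inj_on f U \<longrightarrow> emeasure \<nu>' U = emeasure \<mu> (f ` U)" for \<nu>'
  proof -
    have sets_\<nu>': "sets \<nu>' = sets (borel_algebra X)"
      using \<nu>' by (simp add: regular_measures_def borel_measures_def)
    have op: "emeasure \<nu>' U = emeasure \<nu> U" if "openin X U" "U \<subseteq> Ch i" for U i
      using \<nu>'(2) that inj_eq[of U] Ch(3)[of i] inj_on_subset openin_borel_algebra by metis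
    have le: "emeasure N1 B \<le> emeasure N2 B"
      if N: "N1 \<in> regular_measures X" "N2 \<in> regular_measures X"
        "\<And>U. openin X U \<Longrightarrow> U \<subseteq> Ch i \<Longrightarrow> emeasure N1 U = emeasure N2 U"
        "B \<in> sets (borel_algebra X)" "B \<subseteq> Ch i" for N1 N2 B i
    proof -
      have sN: "sets N1 = sets (borel_algebra X)" "sets N2 = sets (borel_algebra X)"
        using N by (auto simp: regular_measures_def borel_measures_def)
      have "emeasure N1 B \<le> emeasure N2 U" if U: "openin X U" "B \<subseteq> U" for U
      proof -
        have "emeasure N1 B \<le> emeasure N1 (U \<inter> Ch i)"
          using U N Ch(1) by (intro emeasure_mono) (auto simp: sN openin_borel_algebra)
        also have "\<dots> = emeasure N2 (U \<inter> Ch i)"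
          using U Ch(1) by (intro N(3)) auto
        also have "\<dots> \<le> emeasure N2 U"
          using U by (intro emeasure_mono) (auto simp: sN openin_borel_algebra)
        finally show ?thesis .
      qed
      then have "emeasure N1 B \<le> (INF U\<in>{U. openin X U \<and> B \<subseteq> U}. emeasure N2 U)"
        by (intro INF_greatest) auto
      also have "emeasure N2 B = (INF U\<in>{U. openin X U \<and> B \<subseteq> U}. emeasure N2 U)"
        using N(2) N(4)[folded sN(2)] unfolding regular_measures_def mem_Collect_eq by blast
      note this[symmetric]
      finally show ?thesis .
    qed
    have loc: "emeasure \<nu>' B = emeasure \<nu> B" if "B \<in> sets (borel_algebra X)" "B \<subseteq> Ch i" for B i
      using le[of \<nu>' \<nu> i B] le[of \<nu> \<nu>' i B] op \<nu>_reg \<nu>'(1) that by (intro antisym) auto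
    show ?thesis
    proof (rule measure_eqI)
      fix B assume B: "B \<in> sets \<nu>'"
      then have sub: "B \<subseteq> (\<Union>i. Ch i)" using sets.sets_into_space sets_\<nu>' Ch(2)
        by (metis sets_eq_imp_space_eq space_borel_algebra)
      have "emeasure \<nu>' (B \<inter> disjointed Ch i) = emeasure \<nu> (B \<inter> disjointed Ch i)" for i
        using B Ds[of i] DCh[of i] sets_\<nu>' by (intro loc[of _ i]) auto
      then show "emeasure \<nu>' B = emeasure \<nu> B"
        using B sub Chs sets_\<nu>' sets_\<nu>
          emeasure_disjointed_sum[of Ch \<nu>' B] emeasure_disjointed_sum[of Ch \<nu> B] by simp
    qed (simp add: sets_\<nu> sets_\<nu>')
  qed
  have "pullback_measure X Y f \<mu> = \<nu>"
    unfolding pullback_measure_def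
  proof (rule the_equality)
    show "\<nu> \<in> regular_measures X \<and>
      (\<forall>U. openin X U \<and> inj_on f U \<longrightarrow> emeasure \<nu> U = emeasure \<mu> (f ` U))"
      using \<nu>_reg inj_eq openin_borel_algebra by blast
  qed (use uniq in blast)
  then show "pullback_measure X Y f \<mu> \<in> regular_measures X"
    and "B \<in> sets (borel_algebra X) \<Longrightarrow>
      emeasure (pullback_measure X Y f \<mu>) B = (\<Sum>i. emeasure \<mu> (f ` (B \<inter> disjointed Ch i)))"
    using \<nu>_reg \<nu> by (auto simp: F_def)
qed

text \<open>Subtracting values set by set is meaningless where both are infinite. Domination yields
  a Radon-Nikodym density \<open>f\<close> of \<open>N\<close> with respect to \<open>M\<close>, and
  \<open>1 - f\<close> is a density of the difference.\<close>

lemma measure_difference_exists: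
  assumes M: "sigma_finite_measure M" and sN: "sets N = sets M"
    and le: "\<And>B. B \<in> sets M \<Longrightarrow> emeasure N B \<le> emeasure M B"
  shows "\<exists>D. sets D = sets M \<and> (\<forall>B\<in>sets M. emeasure M B = emeasure D B + emeasure N B)"
proof -
  interpret sigma_finite_measure M by fact
  have "absolutely_continuous M N"
    unfolding absolutely_continuous_def
  proof
    fix B assume "B \<in> null_sets M"
    then show "B \<in> null_sets N"
      using le[of B] sN by (auto simp: null_sets_def)
  qed
  then obtain f where f: "f \<in> borel_measurable M" "density M f = N"
    using Radon_Nikodym sN by blast
  have Nf: "emeasure N B = (\<integral>\<^sup>+x. f x * indicator B x \<partial>M)" if "B \<in> sets M" for B
    using f that emeasure_density by blast
  define D where "D = density M (\<lambda>x. 1 - f x)"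
  have "emeasure M B = emeasure D B + emeasure N B" if B: "B \<in> sets M" for B
  proof -
    \<comment> \<open>The difference \<open>1 - f\<close> is truncated at \<open>0\<close>, harmlessly since \<open>M\<close> and \<open>N\<close> agree within \<open>H\<close>.\<close>
    define H where "H = {x \<in> space M. 1 < f x}"
    have H: "H \<in> sets M" unfolding H_def using f(1) by measurable
    have "emeasure M (B \<inter> H) \<le> emeasure N (B \<inter> H)"
    proof -
      have "emeasure M (B \<inter> H) = (\<integral>\<^sup>+x. indicator (B \<inter> H) x \<partial>M)"
        using B H by simp
      also have "\<dots> \<le> (\<integral>\<^sup>+x. f x * indicator (B \<inter> H) x \<partial>M)"
        by (intro nn_integral_mono) (auto simp: H_def indicator_def)
      also have "\<dots> = emeasure N (B \<inter> H)" using Nf B H by simp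
      finally show ?thesis .
    qed
    then have eqH: "emeasure N (B \<inter> H) = emeasure M (B \<inter> H)"
      using le[of "B \<inter> H"] B H by (intro antisym) auto
    \<comment> \<open>The density of \<open>D\<close> vanishes on \<open>H\<close>, which is why
      \<open>D\<close> is evaluated on all of \<open>B\<close> while the other two measures are
      restricted to the complement of \<open>H\<close>.\<close>
    have "emeasure D B + emeasure N (B - H) = emeasure M (B - H)"
    proof -
      have "emeasure D B + emeasure N (B - H) =
        (\<integral>\<^sup>+x. (1 - f x) * indicator B x + f x * indicator (B - H) x \<partial>M)"
        unfolding D_def using B H f(1) Nf[of "B - H"]
        by (subst nn_integral_add) (auto simp: emeasure_density)
      also have "\<dots> = (\<integral>\<^sup>+x. indicator (B - H) x \<partial>M)"
      proof (rule nn_integral_cong)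
        fix x assume "x \<in> space M"
        then show "(1 - f x) * indicator B x + f x * indicator (B - H) x = indicator (B - H) x"
          by (cases "1 < f x") (auto simp: H_def indicator_def diff_add_cancel_ennreal
              diff_eq_0_ennreal not_less less_imp_le)
      qed
      also have "\<dots> = emeasure M (B - H)" using B H by simp
      finally show ?thesis .
    qed
    moreover have "emeasure M B = emeasure M (B - H) + emeasure M (B \<inter> H)"
      using B H by (subst plus_emeasure) (auto intro!: arg_cong[where f = "emeasure M"])
    moreover have "emeasure N B = emeasure N (B - H) + emeasure N (B \<inter> H)"
      using B H sN by (subst plus_emeasure) (auto intro!: arg_cong[where f = "emeasure N"])
    ultimately show ?thesis using eqH by (simp add: add.assoc)
  qed
  then show ?thesis by (intro exI[of _ D]) (simp add: D_def)
qed

text \<open>Kolmogorov's theorem is about probability measures. Consistency gives all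
  \<open>L n\<close> the same first marginal; if this is sigma-finite, it has a strictly positive
  integrable density, which normalises the whole family and is inverted on the limit.\<close>

lemma kolmogorov_extension_sequence:
  fixes L :: "nat \<Rightarrow> (nat \<Rightarrow> 'a::polish_space) measure"
  assumes sets_L: "\<And>n. sets (L n) = sets (PiM UNIV (\<lambda>_. borel))"
    and cons: "\<And>n m S. n \<le> m \<Longrightarrow> S \<in> sets (PiM {..n} (\<lambda>_. borel)) \<Longrightarrow>
      emeasure (L m) ((\<lambda>x. restrict x {..n}) -` S) = emeasure (L n) ((\<lambda>x. restrict x {..n}) -` S)"
    and sf: "sigma_finite_measure (distr (L 0) borel (\<lambda>x. x 0))"
  shows "\<exists>M. sets M = sets (PiM UNIV (\<lambda>_. borel)) \<and> (\<forall>n. \<forall>S\<in>sets (PiM {..n} (\<lambda>_. borel)).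
      emeasure M ((\<lambda>x. restrict x {..n}) -` S) = emeasure (L n) ((\<lambda>x. restrict x {..n}) -` S))"
proof -
  let ?B = "\<lambda>_::nat. borel :: 'a measure"
  let ?\<Omega> = "PiM UNIV ?B"
  have space_L: "space (L n) = UNIV" for n
    using sets_eq_imp_space_eq[OF sets_L] by (simp add: space_PiM)
  have rm: "(\<lambda>x. restrict x J) \<in> ?\<Omega> \<rightarrow>\<^sub>M PiM J ?B" for J
    by (rule measurable_restrict_subset) simp
  have rmL: "(\<lambda>x. restrict x J) \<in> L n \<rightarrow>\<^sub>M PiM J ?B" for J n
    using rm[of J] by (simp add: measurable_cong_sets[OF sets_L refl])
  have x0: "(\<lambda>x. x 0) \<in> ?\<Omega> \<rightarrow>\<^sub>M borel" by simp
  have x0L: "(\<lambda>x. x 0) \<in> L n \<rightarrow>\<^sub>M borel" for n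
    using x0 by (simp add: measurable_cong_sets[OF sets_L refl])
  define P0 where "P0 = distr (L 0) borel (\<lambda>x. x 0)"
  interpret P0: sigma_finite_measure P0 using sf by (simp add: P0_def)
  define R where "R n m = distr (L m) (PiM {..n} ?B) (\<lambda>x. restrict x {..n})" for n m
  have R: "R n m = R n n" if "n \<le> m" for n m
  proof (rule measure_eqI)
    fix S assume "S \<in> sets (R n m)"
    then have S: "S \<in> sets (PiM {..n} ?B)" by (simp add: R_def)
    then show "emeasure (R n m) S = emeasure (R n n) S"
      unfolding R_def using rmL that cons[OF that S] by (simp add: emeasure_distr space_L)
  qed (simp add: R_def)
  have first: "distr (L n) borel (\<lambda>x. x 0) = P0" for n
  proof -
    have "distr (L n) borel (\<lambda>x. x 0) = distr (R 0 n) borel (\<lambda>x. x 0)" for n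
      unfolding R_def using rmL by (subst distr_distr) (auto simp: o_def)
    then show ?thesis unfolding P0_def using R[of 0 n] by simp
  qed
  show ?thesis
  proof (cases "emeasure P0 (space P0) = 0")
    \<comment> \<open>The zero family cannot be normalised, and its limit is the zero
      measure.\<close>
    case True
    have z: "emeasure (L n) UNIV = 0" for n
    proof -
      have "emeasure (L n) UNIV = emeasure (distr (L n) borel (\<lambda>x. x 0)) UNIV"
        using x0L by (simp add: emeasure_distr space_L)
      then show ?thesis using True first[of n] by (simp add: P0_def)
    qed
    have "emeasure (L n) S = 0" for n S
      using z[of n] emeasure_mono[of S UNIV "L n"] sets.top[of "L n"] by (simp add: space_L)
    then show ?thesis by (intro exI[of _ "null_measure ?\<Omega>"]) simp
  next
    case False
    obtain h where h: "h \<in> borel_measurable P0" "integral\<^sup>N P0 h \<noteq> \<infinity>"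
      "\<And>x. x \<in> space P0 \<Longrightarrow> 0 < h x \<and> h x < \<infinity>"
      using P0.Ex_finite_integrable_function by auto
    have hb: "h \<in> borel_measurable borel" using h(1) by (simp add: P0_def)
    have hpos: "0 < h x" "h x < \<infinity>" for x using h(3)[of x] by (auto simp: P0_def)
    define c where "c = integral\<^sup>N P0 h"
    have c0: "c \<noteq> 0"
    proof
      assume "c = 0"
      then have "emeasure P0 {x \<in> space P0. h x \<noteq> 0} = 0"
        using nn_integral_0_iff[OF h(1)] by (simp add: c_def)
      moreover have "{x \<in> space P0. h x \<noteq> 0} = space P0"
        using hpos(1) by (auto simp: less_le)
      ultimately show False using False by simp
    qed
    have cfin: "c \<noteq> \<infinity>" using h(2) by (simp add: c_def)
    \<comment> \<open>Weighting by a function of the first coordinate turns all \<open>L n\<close> into probability measures.\<close>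
    define w where "w x = h x / c" for x
    have wb[measurable]: "w \<in> borel_measurable borel" unfolding w_def using hb by measurable
    have w0: "w x \<noteq> 0" for x
      using hpos[of x] c0 cfin by (simp add: w_def ennreal_divide_eq_0_iff)
    have wtop: "w x \<noteq> \<infinity>" for x
      using hpos[of x] c0 cfin by (auto simp: w_def ennreal_divide_eq_top_iff)
    have ww: "inverse (w x) * w x = 1" for x
      using w0[of x] wtop[of x] ennreal_divide_self[of "w x"]
      by (simp add: divide_ennreal_def mult.commute less_top)
    have w1: "(\<integral>\<^sup>+x. w x \<partial>P0) = 1"
      unfolding w_def using h(1) c0 cfin
      by (simp add: nn_integral_divide c_def[symmetric] ennreal_divide_self less_top)
    have wm: "(\<lambda>x. w (x 0)) \<in> borel_measurable ?\<Omega>" by measurable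
    define L' where "L' n = density (L n) (\<lambda>x. w (x 0))" for n
    have wmL: "(\<lambda>x. w (x 0)) \<in> borel_measurable (L n)" for n
      using wm by (simp add: measurable_cong_sets[OF sets_L refl])
    have sets_L': "sets (L' n) = sets ?\<Omega>" for n by (simp add: L'_def sets_L)
    have rmL': "(\<lambda>x. restrict x J) \<in> L' n \<rightarrow>\<^sub>M PiM J ?B" for J n
      using rm[of J] by (simp add: measurable_cong_sets[OF sets_L' refl])
    have space_L': "space (L' n) = UNIV" for n by (simp add: L'_def space_L)
    have prob': "prob_space (L' n)" for n
    proof
      have "emeasure (L' n) (space (L' n)) = (\<integral>\<^sup>+x. w (x 0) \<partial>L n)"
        unfolding L'_def using wmL sets.top[of "L n"]
        by (subst emeasure_density) (auto simp: space_L intro!: nn_integral_cong)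
      also have "\<dots> = (\<integral>\<^sup>+x. w x \<partial>distr (L n) borel (\<lambda>x. x 0))"
        using x0L by (subst nn_integral_distr) auto
      finally show "emeasure (L' n) (space (L' n)) = 1"
        using first[of n] w1 by simp
    qed
    have shift_n: "distr (L' n) (PiM J ?B) (\<lambda>x. restrict x J) = distr (L' m) (PiM J ?B) (\<lambda>x. restrict x J)"
      if "n \<le> m" "J \<subseteq> {..n}" for n m J
    proof (rule measure_eqI)
      fix S assume "S \<in> sets (distr (L' n) (PiM J ?B) (\<lambda>x. restrict x J))"
      then have S: "S \<in> sets (PiM J ?B)" by simp
      \<comment> \<open>The weight reads coordinate 0, which need not belong to \<open>J\<close>.
        The comparison therefore passes through the marginal on all of \<open>{..n}\<close>, where
        the \<open>L k\<close> are known to agree.\<close>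
      define g where "g y = w (y 0) * indicator S (restrict y J)" for y :: "nat \<Rightarrow> 'a"
      have rJ: "(\<lambda>y. restrict y J) \<in> PiM {..n} ?B \<rightarrow>\<^sub>M PiM J ?B"
        using that(2) by (rule measurable_restrict_subset)
      have g: "g \<in> borel_measurable (PiM {..n} ?B)"
        unfolding g_def using S rJ by measurable
      have "emeasure (distr (L' k) (PiM J ?B) (\<lambda>x. restrict x J)) S = integral\<^sup>N (R n k) g" for k
      proof -
        have "(\<lambda>x. restrict x J) -` S \<in> sets ?\<Omega>"
          using measurable_sets[OF rm S] by (simp add: space_PiM)
        then have "emeasure (distr (L' k) (PiM J ?B) (\<lambda>x. restrict x J)) S =
          (\<integral>\<^sup>+x. w (x 0) * indicator ((\<lambda>x. restrict x J) -` S) x \<partial>L k)"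
          using S rmL' wmL by (simp add: emeasure_distr space_L' L'_def emeasure_density sets_L space_L)
        also have "\<dots> = (\<integral>\<^sup>+x. g (restrict x {..n}) \<partial>L k)"
          using that(2) by (intro nn_integral_cong)
            (auto simp: g_def indicator_def restrict_restrict Int_absorb1)
        also have "\<dots> = integral\<^sup>N (R n k) g"
          unfolding R_def using g rmL by (subst nn_integral_distr) auto
        finally show ?thesis .
      qed
      then show "emeasure (distr (L' n) (PiM J ?B) (\<lambda>x. restrict x J)) S =
          emeasure (distr (L' m) (PiM J ?B) (\<lambda>x. restrict x J)) S"
        using R[OF that(1)] by simp
    qed simp
    \<comment> \<open>Any index beyond all elements of \<open>J\<close> gives the same marginal by
      \<open>shift_n\<close>. The inserted 0 provides an index for the empty set.\<close>
    define P where "P J = distr (L' (Max (insert 0 J))) (PiM J ?B) (\<lambda>x. restrict x J)" for J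
    have P: "P J = distr (L' n) (PiM J ?B) (\<lambda>x. restrict x J)" if "finite J" "J \<subseteq> {..n}" for J n
      unfolding P_def using that by (intro shift_n) auto
    interpret pp: polish_projective UNIV P
    proof (intro polish_projective.intro projective_family.intro)
      fix J H :: "nat set" assume JH: "J \<subseteq> H" "finite H"
      let ?n = "Max (insert 0 H)"
      have "J \<subseteq> {..?n}" "finite J" using JH by (auto intro: finite_subset Max_ge)
      then have "P J = distr (L' ?n) (PiM J ?B) (\<lambda>x. restrict x J)" by (intro P)
      also have "\<dots> = distr (distr (L' ?n) (PiM H ?B) (\<lambda>x. restrict x H)) (PiM J ?B) (\<lambda>x. restrict x J)"
        using JH rmL' by (subst distr_distr)
          (auto simp: o_def restrict_restrict Int_absorb1 intro!: measurable_restrict_subset)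
      finally show "P J = distr (P H) (PiM J ?B) (\<lambda>f. restrict f J)"
        by (simp add: P_def)
    next
      fix J :: "nat set" assume "finite J"
      interpret prob_space "L' (Max (insert 0 J))" by (rule prob')
      show "prob_space (P J)" unfolding P_def by (rule prob_space_distr[OF rmL'])
    qed
    define M' where "M' = pp.lim"
    have sets_M': "sets M' = sets ?\<Omega>" by (simp add: M'_def)
    have space_M': "space M' = UNIV" by (simp add: M'_def space_PiM)
    have rmM': "(\<lambda>x. restrict x J) \<in> M' \<rightarrow>\<^sub>M PiM J ?B" for J
      using rm[of J] by (simp add: measurable_cong_sets[OF sets_M' refl])
    have M'P: "distr M' (PiM {..n} ?B) (\<lambda>x. restrict x {..n}) =
        distr (L' n) (PiM {..n} ?B) (\<lambda>x. restrict x {..n})" for n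
    proof (rule measure_eqI)
      fix S assume "S \<in> sets (distr M' (PiM {..n} ?B) (\<lambda>x. restrict x {..n}))"
      then have S: "S \<in> sets (PiM {..n} ?B)" by simp
      have "emeasure M' ((\<lambda>x. restrict x {..n}) -` S) = emeasure (P {..n}) S"
        using pp.emeasure_lim_emb[of "{..n}" S] S by (simp add: M'_def prod_emb_def)
      then show "emeasure (distr M' (PiM {..n} ?B) (\<lambda>x. restrict x {..n})) S =
          emeasure (distr (L' n) (PiM {..n} ?B) (\<lambda>x. restrict x {..n})) S"
        using S rmM' by (subst P[symmetric]) (auto simp: emeasure_distr space_M')
    qed simp
    \<comment> \<open>\<open>w\<close> is nowhere zero or infinite, so dividing by it restores the
      original marginals exactly.\<close>
    define M where "M = density M' (\<lambda>x. inverse (w (x 0)))"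
    have iw: "(\<lambda>x. inverse (w (x 0))) \<in> borel_measurable ?\<Omega>" using wm by measurable
    have "emeasure M ((\<lambda>x. restrict x {..n}) -` S) = emeasure (L n) ((\<lambda>x. restrict x {..n}) -` S)"
      if S: "S \<in> sets (PiM {..n} ?B)" for n S
    proof -
      have vS: "(\<lambda>x. restrict x {..n}) -` S \<in> sets ?\<Omega>"
        using measurable_sets[OF rm S] by (simp add: space_PiM)
      define g where "g y = inverse (w (y 0)) * indicator S y" for y :: "nat \<Rightarrow> 'a"
      have g: "g \<in> borel_measurable (PiM {..n} ?B)"
        unfolding g_def using S by measurable
      have "emeasure M ((\<lambda>x. restrict x {..n}) -` S) =
          (\<integral>\<^sup>+x. inverse (w (x 0)) * indicator ((\<lambda>x. restrict x {..n}) -` S) x \<partial>M')"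
        unfolding M_def using vS iw
        by (subst emeasure_density) (auto simp: sets_M' measurable_cong_sets[OF sets_M' refl])
      also have "\<dots> = (\<integral>\<^sup>+x. g (restrict x {..n}) \<partial>M')"
        by (intro nn_integral_cong) (auto simp: g_def indicator_def)
      also have "\<dots> = integral\<^sup>N (distr M' (PiM {..n} ?B) (\<lambda>x. restrict x {..n})) g"
        using g rmM' by (subst nn_integral_distr) auto
      also have "\<dots> = (\<integral>\<^sup>+x. g (restrict x {..n}) \<partial>L' n)"
        unfolding M'P using g rmL' by (subst nn_integral_distr) auto
      also have "\<dots> = (\<integral>\<^sup>+x. w (x 0) * g (restrict x {..n}) \<partial>L n)"
        unfolding L'_def using g rmL wmL by (subst nn_integral_density) auto
      also have "\<dots> = (\<integral>\<^sup>+x. indicator ((\<lambda>x. restrict x {..n}) -` S) x \<partial>L n)"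
        using ww by (intro nn_integral_cong) (auto simp: g_def indicator_def mult.commute)
      also have "\<dots> = emeasure (L n) ((\<lambda>x. restrict x {..n}) -` S)"
        using vS by (simp add: sets_L)
      finally show ?thesis .
    qed
    then show ?thesis
      by (intro exI[of _ M]) (simp add: M_def sets_M')
  qed
qed

section \<open>Topologies on paths of finite length\<close>

lemma paths_of_length_0: "b \<in> paths_of_length E 0 \<longleftrightarrow> (\<exists>v\<in>topspace (vertex_space E). b = Vertex v)"
  by (auto simp: paths_of_length_def)

lemma paths_of_length_Suc:
  "b \<in> paths_of_length E (Suc n) \<longleftrightarrow> (\<exists>es. b = Finite_Path es \<and> length es = Suc n \<and>
     set es \<subseteq> topspace (edge_space E) \<and> (\<forall>k<n. src E (es ! k) = rng E (es ! Suc k)))"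
  by (auto simp: paths_of_length_def)

text \<open>The tag of the disjoint union is the length, which the path itself determines, so
  openness can be tested length by length.\<close>

lemma openin_finite_paths_topology:
  assumes top: "\<And>n. topspace (paths_topology E n) = paths_of_length E n"
  shows "openin (finite_paths_topology E) U \<longleftrightarrow> U \<subseteq> finite_paths E \<and>
    (\<forall>n. openin (paths_topology E n) (U \<inter> paths_of_length E n))"
proof -
  have len: "the_enat (path_length a) = n" if "a \<in> paths_of_length E n" for a n
    using that by (cases n) (auto simp: paths_of_length_0 paths_of_length_Suc zero_enat_def)
  show ?thesis
  proof
    assume "openin (finite_paths_topology E) U"
    then obtain W where W: "openin (sum_topology (paths_topology E) UNIV) W"
      "U = (\<lambda>a. (the_enat (path_length a), a)) -` W \<inter> finite_paths E"
      unfolding finite_paths_topology_def openin_pullback_topology by blast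
    have "openin (paths_topology E n) (U \<inter> paths_of_length E n)" for n
    proof -
      have "openin (paths_topology E n) {x. (n, x) \<in> W}"
        using W(1) by (simp add: openin_sum_topology)
      moreover from openin_subset[OF this] have "{x. (n, x) \<in> W} \<subseteq> paths_of_length E n"
        by (simp add: top)
      then have "U \<inter> paths_of_length E n = {x. (n, x) \<in> W}"
        using W(2) len by (auto simp: finite_paths_def)
      ultimately show ?thesis by simp
    qed
    with W(2) show "U \<subseteq> finite_paths E \<and> (\<forall>n. openin (paths_topology E n) (U \<inter> paths_of_length E n))"
      by auto
  next
    assume U: "U \<subseteq> finite_paths E \<and> (\<forall>n. openin (paths_topology E n) (U \<inter> paths_of_length E n))"
    define W where "W = {(n, x). x \<in> U \<inter> paths_of_length E n}"
    have "{x. (n, x) \<in> W} = U \<inter> paths_of_length E n" for n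
      by (auto simp: W_def)
    then have "openin (sum_topology (paths_topology E) UNIV) W"
      using U by (auto simp: openin_sum_topology top W_def)
    moreover have "U = (\<lambda>a. (the_enat (path_length a), a)) -` W \<inter> finite_paths E"
      using U len by (auto simp: W_def finite_paths_def)
    ultimately show "openin (finite_paths_topology E) U"
      unfolding finite_paths_topology_def openin_pullback_topology by blast
  qed
qed

lemma hd_last_nth: "length xs = Suc n \<Longrightarrow> hd xs = xs ! 0 \<and> last xs = xs ! n"
  by (cases xs) (auto simp: last_conv_nth)

locale sc_graph =
  fixes E :: "('v, 'e) graph"
  assumes topological: "topological_graph E" and sc: "second_countable_graph E"
begin

abbreviation "V0 \<equiv> vertex_space E"
abbreviation "E1 \<equiv> edge_space E"
abbreviation "P \<equiv> paths_of_length E"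
abbreviation "T \<equiv> paths_topology E"
abbreviation "TB \<equiv> boundary_topology E"
abbreviation "BV \<equiv> borel_algebra V0"
abbreviation "BF n \<equiv> borel_algebra (T n)"
abbreviation "BB \<equiv> borel_algebra TB"
abbreviation edge :: "('v, 'e) path \<Rightarrow> nat \<Rightarrow> 'e"
  where "edge b k \<equiv> the_edges b ! k"

lemma Hausdorff_V0: "Hausdorff_space V0" and Hausdorff_E1: "Hausdorff_space E1"
  and locally_compact_V0: "locally_compact_space V0" and locally_compact_E1: "locally_compact_space E1"
  and second_countable_V0: "second_countable V0" and second_countable_E1: "second_countable E1"
  and continuous_rng: "continuous_map E1 V0 (rng E)"
  and local_homeomorphism_src: "local_homeomorphism E1 V0 (src E)"
  using topological sc by (auto simp: topological_graph_def second_countable_graph_def)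

section \<open>Continuity of source, range and initial segments\<close>

lemma continuous_src: "continuous_map E1 V0 (src E)"
proof (rule continuous_map_openin_preimage_eq[THEN iffD2], intro conjI allI impI)
  have loc: "\<exists>U. openin E1 U \<and> e \<in> U \<and> continuous_map (subtopology E1 U) V0 (src E)"
    if "e \<in> topspace E1" for e
    using local_homeomorphism_src that unfolding local_homeomorphism_def
    by (meson continuous_map_into_fulltopology homeomorphic_imp_continuous_map)
  show "src E \<in> topspace E1 \<rightarrow> topspace V0"
    using loc by (fastforce simp: continuous_map_def)
  fix W assume W: "openin V0 W"
  show "openin E1 (topspace E1 \<inter> src E -` W)"
  proof (subst openin_subopen, intro ballI)
    fix e assume e: "e \<in> topspace E1 \<inter> src E -` W"
    then obtain U where U: "openin E1 U" "e \<in> U" "continuous_map (subtopology E1 U) V0 (src E)"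
      using loc by blast
    then have "openin (subtopology E1 U) {x \<in> topspace (subtopology E1 U). src E x \<in> W}"
      using W openin_continuous_map_preimage by blast
    then have "openin E1 {x \<in> topspace (subtopology E1 U). src E x \<in> W}"
      using U(1) openin_trans_full by blast
    then show "\<exists>T. openin E1 T \<and> e \<in> T \<and> T \<subseteq> topspace E1 \<inter> src E -` W"
      using e U by (intro exI[of _ "{x \<in> topspace (subtopology E1 U). src E x \<in> W}"]) auto
  qed
qed

lemma rng_in: "e \<in> topspace E1 \<Longrightarrow> rng E e \<in> topspace V0"
  and src_in: "e \<in> topspace E1 \<Longrightarrow> src E e \<in> topspace V0"
  using continuous_rng continuous_src by (auto simp: continuous_map_def)

lemma paths_edge: "b \<in> P (Suc n) \<Longrightarrow> k \<le> n \<Longrightarrow> edge b k \<in> topspace E1"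
  by (auto simp: paths_of_length_Suc)

lemma topspace_T [simp]: "topspace (T n) = P n"
proof (cases n)
  case 0
  then show ?thesis by (auto simp: paths_topology_def topspace_pullback_topology paths_of_length_0)
next
  case (Suc m)
  then show ?thesis
    using paths_edge[of _ m] by (auto simp: paths_topology_def topspace_pullback_topology)
qed

lemma continuous_into_T0:
  assumes "g \<in> topspace Y \<rightarrow> P 0" "continuous_map Y V0 (\<lambda>y. the_vertex (g y))"
  shows "continuous_map Y (T 0) g"
proof -
  have "continuous_map Y (pullback_topology (P 0) the_vertex V0) g"
    using assms by (intro continuous_map_pullback') (auto simp: o_def)
  then show ?thesis by (simp add: paths_topology_def)
qed

lemma continuous_into_TSuc:
  assumes "g \<in> topspace Y \<rightarrow> P (Suc n)" "\<And>k. k \<le> n \<Longrightarrow> continuous_map Y E1 (\<lambda>y. edge (g y) k)"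
  shows "continuous_map Y (T (Suc n)) g"
proof -
  have "continuous_map Y (pullback_topology (P (Suc n)) (\<lambda>a. \<lambda>k\<in>{..<Suc n}. edge a k)
      (product_topology (\<lambda>_. E1) {..<Suc n})) g"
    using assms by (intro continuous_map_pullback')
      (auto simp: o_def continuous_map_componentwise less_Suc_eq_le)
  then show ?thesis by (simp add: paths_topology_def)
qed

lemma continuous_tuple:
  "continuous_map (T (Suc n)) (product_topology (\<lambda>_. E1) {..<Suc n}) (\<lambda>a. \<lambda>k\<in>{..<Suc n}. edge a k)"
  using continuous_map_pullback[OF continuous_map_id, of "P (Suc n)" "\<lambda>a. \<lambda>k\<in>{..<Suc n}. edge a k"
      "product_topology (\<lambda>_. E1) {..<Suc n}"]
  by (simp add: paths_topology_def o_def)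

lemma continuous_the_vertex: "continuous_map (T 0) V0 the_vertex"
  using continuous_map_pullback[OF continuous_map_id, of "P 0" the_vertex V0]
  by (simp add: paths_topology_def o_def)

lemma continuous_edge:
  assumes "k \<le> n"
  shows "continuous_map (T (Suc n)) E1 (\<lambda>a. edge a k)"
  using continuous_tuple[of n] assms
  by (simp add: continuous_map_componentwise less_Suc_eq_le)

lemma continuous_range: "continuous_map (T n) V0 (path_range E)"
proof (cases n)
  case 0
  show ?thesis unfolding 0
    by (rule continuous_map_eq[OF continuous_the_vertex]) (auto simp: paths_of_length_0)
next
  case (Suc m)
  show ?thesis unfolding Suc
    by (rule continuous_map_eq[OF continuous_map_compose[OF continuous_edge[of 0 m] continuous_rng]])
      (auto simp: paths_of_length_Suc dest: hd_last_nth)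
qed

lemma continuous_source: "continuous_map (T n) V0 (path_source E)"
proof (cases n)
  case 0
  show ?thesis unfolding 0
    by (rule continuous_map_eq[OF continuous_the_vertex]) (auto simp: paths_of_length_0)
next
  case (Suc m)
  show ?thesis unfolding Suc
    by (rule continuous_map_eq[OF continuous_map_compose[OF continuous_edge[of m m] continuous_src]])
      (auto simp: paths_of_length_Suc dest: hd_last_nth)
qed

lemma path_range_in: "b \<in> P n \<Longrightarrow> path_range E b \<in> topspace V0"
  using continuous_range[of n] by (auto simp: continuous_map_def)

lemma path_source_in: "b \<in> P n \<Longrightarrow> path_source E b \<in> topspace V0"
  using continuous_source[of n] by (auto simp: continuous_map_def)

lemma initial_Suc_in: "b \<in> P (Suc n) \<Longrightarrow> initial E b n \<in> P n"
proof (cases n)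
  case 0
  assume "b \<in> P (Suc n)"
  then show ?thesis using path_range_in[of b "Suc n"] unfolding 0 by (auto simp: paths_of_length_0)
next
  case (Suc m)
  assume "b \<in> P (Suc n)"
  then show ?thesis
    unfolding Suc by (auto simp: paths_of_length_Suc) (meson in_set_takeD subsetD)
qed

lemma continuous_initial: "continuous_map (T (Suc n)) (T n) (\<lambda>b. initial E b n)"
proof (cases n)
  case 0
  show ?thesis unfolding 0
    using initial_Suc_in[of _ 0] continuous_range[of "Suc 0"]
    by (intro continuous_into_T0) auto
next
  case (Suc m)
  show ?thesis unfolding Suc
  proof (rule continuous_into_TSuc)
    fix k assume k: "k \<le> m"
    show "continuous_map (T (Suc (Suc m))) E1 (\<lambda>y. edge (initial E y (Suc m)) k)"
      by (rule continuous_map_eq[OF continuous_edge[of k "Suc m"]]) (use k in \<open>auto simp: paths_of_length_Suc\<close>)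
  qed (use initial_Suc_in[of _ "Suc m"] in auto)
qed

text \<open>By Tychonoff the box of tuples is compact, and composability of consecutive edges is a
  closed condition because the vertex space is Hausdorff.\<close>

lemma compactin_box:
  assumes C: "\<And>k. k \<le> n \<Longrightarrow> compactin E1 (C k)"
  shows "compactin (T (Suc n)) {b \<in> P (Suc n). \<forall>k\<le>n. edge b k \<in> C k}"
proof -
  let ?X = "product_topology (\<lambda>_. E1) {..<Suc n}"
  define K where "K = {x \<in> topspace ?X. \<forall>k<n. src E (x k) = rng E (x (Suc k))}"
  have coord: "continuous_map ?X E1 (\<lambda>x. x k)" if "k \<le> n" for k
    using that by (intro continuous_map_product_projection) auto
  have "K = topspace ?X \<inter> (\<Inter>k<n. {x \<in> topspace ?X. src E (x k) = rng E (x (Suc k))})"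
    by (auto simp: K_def)
  moreover have "closedin ?X {x \<in> topspace ?X. src E (x k) = rng E (x (Suc k))}" if "k < n" for k
    using that continuous_map_compose[OF coord continuous_src, of k]
      continuous_map_compose[OF coord continuous_rng, of "Suc k"]
    by (intro closedin_continuous_maps_eq[OF Hausdorff_V0]) (auto simp: o_def)
  ultimately have closed: "closedin ?X K"
  proof (cases "n = 0")
    \<comment> \<open>A single edge meets no condition; the intersection would run over an empty
      family, so this case is separate.\<close>
    case True
    then have "K = topspace ?X" unfolding K_def by simp
    then show ?thesis by (simp only: closedin_topspace)
  next
    case False
    assume K: "K = topspace ?X \<inter> (\<Inter>k<n. {x \<in> topspace ?X. src E (x k) = rng E (x (Suc k))})"
      and cl: "\<And>k. k < n \<Longrightarrow> closedin ?X {x \<in> topspace ?X. src E (x k) = rng E (x (Suc k))}"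
    show ?thesis
      unfolding K using False by (intro closedin_Int closedin_topspace closedin_Inter) (use cl in blast)+
  qed
  let ?\<iota> = "\<lambda>x. Finite_Path (map x [0..<Suc n]) :: ('v, 'e) path"
  have \<iota>P: "?\<iota> x \<in> P (Suc n)" if "x \<in> K" for x
    using that by (auto simp: K_def paths_of_length_Suc nth_append less_Suc_eq_le PiE_iff simp del: upt_Suc)
  have \<iota>c: "continuous_map (subtopology ?X K) (T (Suc n)) ?\<iota>"
  proof (rule continuous_into_TSuc)
    fix k assume k: "k \<le> n"
    then show "continuous_map (subtopology ?X K) E1 (\<lambda>y. edge (?\<iota> y) k)"
      using coord[OF k] by (simp add: continuous_map_from_subtopology del: upt_Suc)
  qed (use \<iota>P in auto)
  have "compactin ?X (PiE {..<Suc n} C)"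
    using C by (auto simp: compactin_PiE)
  then have "compactin ?X (K \<inter> PiE {..<Suc n} C)"
    using closed closed_Int_compactin by blast
  then have "compactin (subtopology ?X K) (K \<inter> PiE {..<Suc n} C)"
    by (simp add: compactin_subtopology)
  then have "compactin (T (Suc n)) (?\<iota> ` (K \<inter> PiE {..<Suc n} C))"
    using \<iota>c image_compactin by blast
  moreover have "?\<iota> ` (K \<inter> PiE {..<Suc n} C) = {b \<in> P (Suc n). \<forall>k\<le>n. edge b k \<in> C k}"
  proof (intro set_eqI iffI)
    fix b assume "b \<in> ?\<iota> ` (K \<inter> PiE {..<Suc n} C)"
    then obtain x where x: "x \<in> K" "x \<in> PiE {..<Suc n} C" "b = ?\<iota> x" by auto
    then show "b \<in> {b \<in> P (Suc n). \<forall>k\<le>n. edge b k \<in> C k}"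
      using \<iota>P[OF x(1)] by (auto simp: PiE_iff less_Suc_eq_le simp del: upt_Suc)
  next
    fix b assume "b \<in> {b \<in> P (Suc n). \<forall>k\<le>n. edge b k \<in> C k}"
    then obtain es where es: "b = Finite_Path es" "length es = Suc n" "set es \<subseteq> topspace E1"
      "\<forall>k<n. src E (es ! k) = rng E (es ! Suc k)" "\<forall>k\<le>n. es ! k \<in> C k"
      by (auto simp: paths_of_length_Suc)
    define x where "x = (\<lambda>k\<in>{..<Suc n}. es ! k)"
    have "x \<in> K" "x \<in> PiE {..<Suc n} C"
      using es by (auto simp: K_def x_def PiE_iff less_Suc_eq_le subset_iff)
    moreover have "b = ?\<iota> x"
      using es(1,2) by (auto simp: x_def list_eq_iff_nth_eq simp del: upt_Suc)
    ultimately show "b \<in> ?\<iota> ` (K \<inter> PiE {..<Suc n} C)" by blast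
  qed
  ultimately show ?thesis by simp
qed

lemma Hausdorff_T: "Hausdorff_space (T n)"
proof (cases n)
  case 0
  have "inj_on the_vertex (P 0)" by (auto simp: inj_on_def paths_of_length_0)
  then show ?thesis unfolding 0
    using Hausdorff_space_injective_preimage[OF Hausdorff_V0 continuous_the_vertex] by simp
next
  case (Suc m)
  have "inj_on (\<lambda>a. \<lambda>k\<in>{..<Suc m}. edge a k) (P (Suc m))"
  proof (rule inj_onI)
    fix a b assume ab: "a \<in> P (Suc m)" "b \<in> P (Suc m)"
      "(\<lambda>k\<in>{..<Suc m}. edge a k) = (\<lambda>k\<in>{..<Suc m}. edge b k)"
    then have "edge a k = edge b k" if "k < Suc m" for k
      using that by (metis lessThan_iff restrict_apply')
    with ab(1,2) show "a = b"
      by (auto simp: paths_of_length_Suc list_eq_iff_nth_eq)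
  qed
  then show ?thesis unfolding Suc
    using Hausdorff_space_injective_preimage[OF _ continuous_tuple] Hausdorff_E1
    by (simp add: Hausdorff_space_product_topology)
qed

text \<open>A bump function on paths is a product of bump functions of the edges: it is nonzero only
  if every factor is, so it vanishes off a compact box. Length 0 is a copy of the vertex
  space.\<close>

lemma bump_family_T: "\<exists>F. bump_family (T n) F"
proof (cases n)
  case 0
  obtain F where F: "bump_family V0 F"
    using bump_family_exists[OF second_countable_V0 locally_compact_V0 Hausdorff_V0] by blast
  have "bump_family (T 0) (\<lambda>i b. F i (the_vertex b))"
    unfolding bump_family_def
  proof (intro conjI allI impI)
    fix i
    show "continuous_map (T 0) euclideanreal (\<lambda>b. F i (the_vertex b))"
      using continuous_map_compose[OF continuous_the_vertex, of euclideanreal "F i"] F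
      by (simp add: bump_family_def o_def)
    show "\<forall>x\<in>topspace (T 0). 0 \<le> F i (the_vertex x)"
      using F by (auto simp: bump_family_def paths_of_length_0)
    obtain K where K: "compactin V0 K" "\<forall>x\<in>topspace V0 - K. F i x = 0"
      using F unfolding bump_family_def by meson
    have "continuous_map V0 (T 0) Vertex"
      by (intro continuous_into_T0) (auto simp: paths_of_length_0)
    then have "compactin (T 0) (Vertex ` K)" using K(1) image_compactin by blast
    moreover have "\<forall>x\<in>topspace (T 0) - Vertex ` K. F i (the_vertex x) = 0"
      using K(2) by (auto simp: paths_of_length_0) (metis DiffI imageI)
    ultimately show "\<exists>K. compactin (T 0) K \<and> (\<forall>x\<in>topspace (T 0) - K. F i (the_vertex x) = 0)"
      by blast
  next
    fix U b assume U: "openin (T 0) U \<and> b \<in> U"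
    then obtain W where W: "openin V0 W" "U = the_vertex -` W \<inter> P 0"
      by (auto simp: paths_topology_def openin_pullback_topology)
    then have "the_vertex b \<in> W" using U by auto
    then obtain i where "0 < F i (the_vertex b)" "\<forall>y\<in>topspace V0 - W. F i y = 0"
      using F W(1) unfolding bump_family_def by meson
    moreover from this have "\<forall>y\<in>topspace (T 0) - U. F i (the_vertex y) = 0"
      using W(2) by (auto simp: paths_of_length_0) (metis DiffI)
    ultimately show "\<exists>i. 0 < F i (the_vertex b) \<and> (\<forall>y\<in>topspace (T 0) - U. F i (the_vertex y) = 0)"
      by blast
  qed
  then show ?thesis unfolding 0 by blast
next
  case (Suc m)
  obtain F where F: "bump_family E1 F"
    using bump_family_exists[OF second_countable_E1 locally_compact_E1 Hausdorff_E1] by blast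
  \<comment> \<open>\<open>i\<close> codes a list whose entry \<open>k\<close> selects the function
    for edge \<open>k\<close>. Beyond the end of a short list the index is unspecified, but every
    index denotes a bump function, so the general properties hold for all \<open>i\<close>.\<close>
  define G where "G i b = (\<Prod>k\<le>m. F ((from_nat i :: nat list) ! k) (edge b k))" for i b
  have "bump_family (T (Suc m)) G"
    unfolding bump_family_def
  proof (intro conjI allI impI)
    fix i
    let ?j = "\<lambda>k. (from_nat i :: nat list) ! k"
    show "continuous_map (T (Suc m)) euclideanreal (G i)"
      unfolding G_def
    proof (rule continuous_map_prod)
      fix k assume "k \<in> {..m}"
      then show "continuous_map (T (Suc m)) euclideanreal (\<lambda>x. F (?j k) (edge x k))"
        using continuous_map_compose[OF continuous_edge[of k m], of euclideanreal "F (?j k)"] F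
        by (simp add: bump_family_def o_def)
    qed simp
    show "\<forall>x\<in>topspace (T (Suc m)). 0 \<le> G i x"
      unfolding G_def using F paths_edge by (auto simp: bump_family_def intro!: prod_nonneg)
    have "\<forall>j. \<exists>K. compactin E1 K \<and> (\<forall>x\<in>topspace E1 - K. F j x = 0)"
      using F unfolding bump_family_def by blast
    then obtain K where K: "\<And>j. compactin E1 (K j)" "\<And>j x. x \<in> topspace E1 - K j \<Longrightarrow> F j x = 0"
      by metis
    have "compactin (T (Suc m)) {b \<in> P (Suc m). \<forall>k\<le>m. edge b k \<in> K (?j k)}"
      by (intro compactin_box K)
    moreover have "\<forall>x\<in>topspace (T (Suc m)) - {b \<in> P (Suc m). \<forall>k\<le>m. edge b k \<in> K (?j k)}. G i x = 0"
    proof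
      fix b assume b: "b \<in> topspace (T (Suc m)) - {b \<in> P (Suc m). \<forall>k\<le>m. edge b k \<in> K (?j k)}"
      then obtain k where k: "k \<le> m" "edge b k \<notin> K (?j k)" by auto
      then have "F (?j k) (edge b k) = 0" using K(2) paths_edge[of b m k] b by simp
      then show "G i b = 0" unfolding G_def using k(1) by (intro prod_zero) auto
    qed
    ultimately show "\<exists>K. compactin (T (Suc m)) K \<and> (\<forall>x\<in>topspace (T (Suc m)) - K. G i x = 0)"
      by blast
  next
    fix U b assume U: "openin (T (Suc m)) U \<and> b \<in> U"
    let ?\<tau> = "\<lambda>a. \<lambda>k\<in>{..<Suc m}. edge a k"
    obtain W where W: "openin (product_topology (\<lambda>_. E1) {..<Suc m}) W" "U = ?\<tau> -` W \<inter> P (Suc m)"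
      using U by (auto simp: paths_topology_def openin_pullback_topology)
    then have b: "?\<tau> b \<in> W" "b \<in> P (Suc m)" using U by auto
    obtain Y where Y: "?\<tau> b \<in> PiE {..<Suc m} Y" "\<forall>k. openin E1 (Y k)" "PiE {..<Suc m} Y \<subseteq> W"
      using product_topology_open_contains_basis[OF W(1) b(1)] by auto
    have "\<exists>j. 0 < F j (edge b k) \<and> (\<forall>y\<in>topspace E1 - Y k. F j y = 0)" if "k \<le> m" for k
    proof -
      have "edge b k \<in> Y k" using Y(1) that by (auto simp: PiE_iff less_Suc_eq_le)
      then show ?thesis using F Y(2) unfolding bump_family_def by meson
    qed
    then obtain j where j: "\<And>k. k \<le> m \<Longrightarrow> 0 < F (j k) (edge b k)"
      "\<And>k y. k \<le> m \<Longrightarrow> y \<in> topspace E1 - Y k \<Longrightarrow> F (j k) y = 0"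
      by metis
    define i where "i = to_nat (map j [0..<Suc m])"
    have G: "G i c = (\<Prod>k\<le>m. F (j k) (edge c k))" for c
      unfolding G_def i_def by (intro prod.cong) (auto simp del: upt_Suc)
    have "0 < G i b" unfolding G using j(1) by (intro prod_pos) auto
    moreover have "G i c = 0" if c: "c \<in> P (Suc m) - U" for c
    proof -
      have "\<not> (\<forall>k\<le>m. edge c k \<in> Y k)"
      proof
        assume "\<forall>k\<le>m. edge c k \<in> Y k"
        then have "?\<tau> c \<in> PiE {..<Suc m} Y" by (simp add: restrict_PiE_iff less_Suc_eq_le)
        then have "?\<tau> c \<in> W" using Y(3) by (rule subsetD[rotated])
        with c W(2) show False by simp
      qed
      then obtain k where "k \<le> m" "edge c k \<notin> Y k" by blast
      then show ?thesis
        unfolding G using j(2)[of k "edge c k"] paths_edge[of c m k] c by (intro prod_zero) auto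
    qed
    ultimately show "\<exists>i. 0 < G i b \<and> (\<forall>y\<in>topspace (T (Suc m)) - U. G i y = 0)"
      by auto
  qed
  then show ?thesis unfolding Suc by blast
qed

lemma compactification_T: "\<exists>\<theta>. \<forall>n. compactification (T n) (\<theta> n)"
proof (rule choice, rule allI)
  fix n
  obtain F where "bump_family (T n) F" using bump_family_T by blast
  then show "\<exists>t. compactification (T n) t"
    using bump_family_compactification[OF Hausdorff_T] by blast
qed

section \<open>The space of all finite paths as a disjoint union\<close>

lemma openin_FT:
  "openin (finite_paths_topology E) U \<longleftrightarrow> U \<subseteq> finite_paths E \<and> (\<forall>n. openin (T n) (U \<inter> P n))"
  by (rule openin_finite_paths_topology) simp

lemma paths_disjoint: "a \<in> P n \<Longrightarrow> a \<in> P m \<Longrightarrow> n = m"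
  by (cases n; cases m) (auto simp: paths_of_length_0 paths_of_length_Suc)

lemma openin_T_FT: "openin (T n) U \<Longrightarrow> openin (finite_paths_topology E) U"
proof -
  assume U: "openin (T n) U"
  then have sub: "U \<subseteq> P n" using openin_subset by fastforce
  have "openin (T m) (U \<inter> P m)" for m
  proof (cases "m = n")
    case True then show ?thesis using U sub by (simp add: Int_absorb2)
  next
    case False
    then have "U \<inter> P m = {}" using sub paths_disjoint by blast
    then show ?thesis by simp
  qed
  with sub show ?thesis unfolding openin_FT by (auto simp: finite_paths_def)
qed

lemma topspace_FT [simp]: "topspace (finite_paths_topology E) = finite_paths E"
proof -
  have "openin (finite_paths_topology E) (finite_paths E)"
    unfolding openin_FT using openin_topspace[of "T _"]
    by (auto simp: finite_paths_def Int_absorb1 UN_upper)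
  then show ?thesis using openin_FT by (metis openin_subset openin_topspace subset_antisym)
qed

lemma compactin_T_FT:
  assumes "compactin (T n) K"
  shows "compactin (finite_paths_topology E) K"
proof -
  have "continuous_map (T n) (finite_paths_topology E) id"
    unfolding continuous_map_def
  proof (intro conjI allI impI)
    fix U assume "openin (finite_paths_topology E) U"
    moreover have "{x \<in> topspace (T n). id x \<in> U} = U \<inter> P n" by auto
    ultimately show "openin (T n) {x \<in> topspace (T n). id x \<in> U}" by (simp add: openin_FT)
  qed (auto simp: finite_paths_def)
  from image_compactin[OF assms this] show ?thesis by simp
qed

text \<open>The sets of paths of fixed length are open and closed and they cover, so a compact set
  meets finitely many of them, each in a compact set. The finiteness makes complements of compact
  cylinders open in the product.\<close>

lemma compactin_FT_T:
  assumes K: "compactin (finite_paths_topology E) K"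
  shows "compactin (T n) (K \<inter> P n)" "\<exists>N. K \<subseteq> (\<Union>n<N. P n)"
proof -
  have open_P: "openin (finite_paths_topology E) (P n)" for n
    using openin_T_FT[OF openin_topspace[of "T n"]] by simp
  have "finite_paths E - P n = (\<Union>m\<in>UNIV - {n}. P m)"
    using paths_disjoint by (auto simp: finite_paths_def)
  then have "closedin (finite_paths_topology E) (P n)"
    using open_P by (auto simp: closedin_def finite_paths_def)
  then have "compactin (finite_paths_topology E) (P n \<inter> K)"
    using K closed_Int_compactin by blast
  then have c: "compactin (subtopology (finite_paths_topology E) (P n)) (P n \<inter> K)"
    by (simp add: compactin_subtopology)
  have "continuous_map (subtopology (finite_paths_topology E) (P n)) (T n) id"
    unfolding continuous_map_def
  proof (intro conjI allI impI)
    fix U assume U: "openin (T n) U"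
    then have "U \<subseteq> P n" using openin_subset by fastforce
    then have "{x \<in> topspace (subtopology (finite_paths_topology E) (P n)). id x \<in> U} = U \<inter> P n"
      by (auto simp: finite_paths_def)
    then show "openin (subtopology (finite_paths_topology E) (P n))
      {x \<in> topspace (subtopology (finite_paths_topology E) (P n)). id x \<in> U}"
      using openin_T_FT[OF U] by (auto simp: openin_subtopology)
  qed auto
  from image_compactin[OF c this] show "compactin (T n) (K \<inter> P n)" by (simp add: Int_commute)
  have "K \<subseteq> \<Union>(range P)" using compactin_subset_topspace[OF K] by (simp add: finite_paths_def)
  then obtain \<F> where "finite \<F>" "\<F> \<subseteq> range P" "K \<subseteq> \<Union>\<F>"
    using K open_P unfolding compactin_def by (metis rangeE)
  then obtain I where I: "finite I" "K \<subseteq> (\<Union>n\<in>I. P n)"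
    by (metis finite_subset_image)
  obtain N where N: "I \<subseteq> {..<N}" using finite_nat_iff_bounded[THEN iffD1, OF I(1)] by blast
  then show "\<exists>N. K \<subseteq> (\<Union>n<N. P n)"
    by (intro exI[of _ N] order_trans[OF I(2)] UN_mono) auto
qed

end

section \<open>The boundary path space\<close>

text \<open>Keeps the finite paths that end at a regular vertex. They are not boundary paths, but
  the finite stages of the construction charge them.\<close>

definition all_paths :: "('v, 'e) graph \<Rightarrow> ('v, 'e) path set" where
  "all_paths E = finite_paths E \<union> infinite_paths E"

lemma path_length_paths: "a \<in> paths_of_length E n \<Longrightarrow> path_length a = enat n"
  by (cases n) (auto simp: paths_of_length_0 paths_of_length_Suc zero_enat_def)

lemma all_paths_cases:
  assumes "a \<in> all_paths E"
  obtains n where "a \<in> paths_of_length E n" "path_length a = enat n"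
  | f where "a = Infinite_Path f" "\<And>k. f k \<in> topspace (edge_space E)"
      "\<And>k. src E (f k) = rng E (f (Suc k))" "path_length a = \<infinity>"
  using assms path_length_paths[of a E]
  by (auto simp: all_paths_def finite_paths_def infinite_paths_def)

lemma boundary_subset_all_paths: "boundary_paths E \<subseteq> all_paths E"
  by (auto simp: boundary_paths_def all_paths_def)

lemma enat_eqI: "(\<And>n. enat n \<le> x \<longleftrightarrow> enat n \<le> y) \<Longrightarrow> x = y"
proof (cases x; cases y)
  fix i j assume le: "\<And>n. enat n \<le> x \<longleftrightarrow> enat n \<le> y" and eq: "x = enat i" "y = enat j"
  show ?thesis using le[of i] le[of j] unfolding eq by simp
next
  fix i assume le: "\<And>n. enat n \<le> x \<longleftrightarrow> enat n \<le> y" and eq: "x = enat i" "y = \<infinity>"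
  show ?thesis using le[of "Suc i"] unfolding eq by simp
next
  fix i assume le: "\<And>n. enat n \<le> x \<longleftrightarrow> enat n \<le> y" and eq: "x = \<infinity>" "y = enat i"
  show ?thesis using le[of "Suc i"] unfolding eq by simp
qed simp

context sc_graph
begin

abbreviation "PP \<equiv> all_paths E"
abbreviation "BP \<equiv> boundary_paths E"

lemma paths_in_all: "b \<in> P n \<Longrightarrow> b \<in> PP"
  by (auto simp: all_paths_def finite_paths_def)

lemma initial_self: "b \<in> P n \<Longrightarrow> initial E b n = b"
  by (cases n) (auto simp: paths_of_length_0 paths_of_length_Suc)

lemma initial_paths: "b \<in> P m \<Longrightarrow> n \<le> m \<Longrightarrow> initial E b n \<in> P n"
proof (induction "m - n" arbitrary: n)
  case 0
  then show ?case using initial_self by simp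
next
  case (Suc d)
  then have "initial E b (Suc n) \<in> P (Suc n)" by (metis Suc_diff_Suc Suc_leI diff_Suc_1' zero_less_Suc zero_less_diff)
  then have "initial E (initial E b (Suc n)) n \<in> P n" by (rule initial_Suc_in)
  moreover have "initial E (initial E b (Suc n)) n = initial E b n"
    using Suc.prems Suc.hyps(2) by (cases n; cases m) (auto simp: paths_of_length_Suc min_def)
  ultimately show ?case by simp
qed

lemma initial_in:
  assumes "a \<in> PP" "enat n \<le> path_length a"
  shows "initial E a n \<in> P n"
  using assms(1)
proof (cases rule: all_paths_cases)
  case (1 m)
  then show ?thesis using initial_paths assms(2) by simp
next
  case (2 f)
  then show ?thesis
    using rng_in by (cases n) (auto simp: paths_of_length_0 paths_of_length_Suc nth_append less_Suc_eq_le simp del: upt_Suc)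
qed

lemma initial_initial:
  assumes "a \<in> PP" "enat m \<le> path_length a" "n \<le> m"
  shows "initial E (initial E a m) n = initial E a n"
  using assms(1)
proof (cases rule: all_paths_cases)
  case (1 l)
  then show ?thesis
    using assms by (cases n; cases m; cases l) (auto simp: paths_of_length_0 paths_of_length_Suc min_def)
next
  case (2 f)
  then show ?thesis
    using assms(3) by (cases n; cases m) (auto simp: take_map hd_map simp del: upt_Suc)
qed

lemma path_range_all: "a \<in> PP \<Longrightarrow> path_range E a \<in> topspace V0"
  using initial_in[of a 0] by (auto simp: paths_of_length_0 zero_enat_def[symmetric])

lemma path_eqI:
  assumes ab: "a \<in> PP" "b \<in> PP" and len: "\<And>n. enat n \<le> path_length a \<longleftrightarrow> enat n \<le> path_length b"
    and ini: "\<And>n. enat n \<le> path_length a \<Longrightarrow> initial E a n = initial E b n"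
  shows "a = b"
proof -
  have l: "path_length a = path_length b"
    using len by (rule enat_eqI)
  show ?thesis
    using ab(1)
  proof (cases rule: all_paths_cases)
    case (1 n)
    with l have "path_length b = enat n" by simp
    with ab(2) have "b \<in> P n"
      by (cases rule: all_paths_cases) auto
    then show ?thesis using 1 ini[of n] initial_self by simp
  next
    case (2 f)
    with l have "path_length b = \<infinity>" by simp
    with ab(2) obtain g where g: "b = Infinite_Path g"
      by (cases rule: all_paths_cases) auto
    have "f k = g k" for k
      using ini[of "Suc k"] 2 g by simp
    then show ?thesis using 2 g by auto
  qed
qed

lemma path_source_initial:
  assumes "b \<in> P (Suc n)"
  shows "rng E (edge b n) = path_source E (initial E b n)"
proof -
  obtain es where es: "b = Finite_Path es" "length es = Suc n"
    "\<forall>k<n. src E (es ! k) = rng E (es ! Suc k)"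
    using assms by (auto simp: paths_of_length_Suc)
  show ?thesis
  proof (cases n)
    case 0
    then show ?thesis using es hd_last_nth[OF es(2)] by simp
  next
    case (Suc m)
    then have "last (take (Suc m) es) = es ! m"
      using es(2) hd_last_nth[of "take (Suc m) es" m] by simp
    then show ?thesis using es Suc by simp
  qed
qed

lemma edge_initial: "b \<in> P m \<Longrightarrow> k < n \<Longrightarrow> n \<le> m \<Longrightarrow> edge (initial E b n) k = edge b k"
  by (cases n; cases m) (auto simp: paths_of_length_Suc)

lemma cylinder_paths:
  assumes "S \<subseteq> P n"
  shows "cylinder E S = {a \<in> BP. enat n \<le> path_length a \<and> initial E a n \<in> S}"
proof -
  have "m = n" if "a \<in> BP" "enat m \<le> path_length a" "initial E a m \<in> S" for a m
    using initial_in[of a m] that assms boundary_subset_all_paths[of E] paths_disjoint by blast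
  then show ?thesis unfolding cylinder_def by blast
qed

lemma cylinder_Union: "cylinder E (\<Union>i\<in>I. S i) = (\<Union>i\<in>I. cylinder E (S i))"
  unfolding cylinder_def by blast

text \<open>A neighbourhood that witnesses regularity of one point does so for all its
  points.\<close>

lemma regular_vertices_open:
  assumes "v \<in> regular_vertices E"
  obtains U where "openin V0 U" "v \<in> U" "U \<subseteq> regular_vertices E"
    "compactin E1 {e \<in> topspace E1. rng E e \<in> V0 closure_of U}"
proof -
  obtain U where U: "openin V0 U" "v \<in> U" "compactin V0 (V0 closure_of U)"
    "compactin E1 {e \<in> topspace E1. rng E e \<in> V0 closure_of U}"
    "rng E ` {e \<in> topspace E1. rng E e \<in> U} = U"
    using assms by (auto simp: regular_vertices_def)
  moreover have "U \<subseteq> regular_vertices E"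
    using U openin_subset[OF U(1)] unfolding regular_vertices_def by blast
  ultimately show thesis using that by blast
qed

lemma openin_regular_vertices: "openin V0 (regular_vertices E)"
  by (subst openin_subopen) (metis regular_vertices_open)

end

locale embedded_graph = sc_graph E for E :: "('v, 'e) graph" +
  fixes \<theta> :: "nat \<Rightarrow> ('v, 'e) path \<Rightarrow> nat \<Rightarrow> real"
  assumes \<theta>: "\<And>n. compactification (T n) (\<theta> n)"
begin

lemma \<theta>_emb: "std_embedding (T n) (\<theta> n)"
  using \<theta> by (simp add: compactification_def)

lemma \<theta>_nz: "b \<in> P n \<Longrightarrow> \<theta> n b \<noteq> (\<lambda>_. 0)"
  using \<theta>[of n] imageI[of b "P n" "\<theta> n"] unfolding compactification_def topspace_T by metis

lemma \<theta>_eq: "b \<in> P n \<Longrightarrow> c \<in> P n \<Longrightarrow> \<theta> n b = \<theta> n c \<longleftrightarrow> b = c"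
  using std_embedding_inj[OF \<theta>_emb, of n] by (auto simp: inj_on_def)

lemma \<theta>_compact: "compact (insert (\<lambda>_. 0) (\<theta> n ` P n))"
  using \<theta>[of n] by (simp add: compactification_def)

lemma openin_T_\<theta>:
  assumes "openin (T n) U"
  obtains W where "open W" "(\<lambda>_. 0) \<notin> W" "U = \<theta> n -` W \<inter> P n"
proof -
  obtain W where W: "open W" "U = \<theta> n -` W \<inter> topspace (T n)"
    using std_embedding_openin[OF \<theta>_emb, THEN iffD1, OF assms] by auto
  have "open (W - {\<lambda>_. 0})" using W(1) by (intro open_Diff) auto
  moreover have "U = \<theta> n -` (W - {\<lambda>_. 0}) \<inter> P n"
    using W(2) \<theta>_nz by auto
  ultimately show thesis using that by blast
qed

definition \<Psi> :: "('v, 'e) path \<Rightarrow> nat \<Rightarrow> nat \<Rightarrow> real" where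
  "\<Psi> a n = (if enat n \<le> path_length a then \<theta> n (initial E a n) else (\<lambda>_. 0))"

lemma \<Psi>_zero_iff: "a \<in> PP \<Longrightarrow> \<Psi> a n = (\<lambda>_. 0) \<longleftrightarrow> \<not> enat n \<le> path_length a"
  using \<theta>_nz[OF initial_in, of a n] by (auto simp: \<Psi>_def)

lemma \<Psi>_eq: "a \<in> PP \<Longrightarrow> b \<in> P n \<Longrightarrow> \<Psi> a n = \<theta> n b \<longleftrightarrow> enat n \<le> path_length a \<and> initial E a n = b"
  using \<theta>_nz[of b n] \<theta>_eq[OF initial_in, of a n b]
  by (cases "enat n \<le> path_length a") (auto simp: \<Psi>_def)

lemma inj_\<Psi>: "inj_on \<Psi> PP"
proof (rule inj_onI)
  fix a b assume ab: "a \<in> PP" "b \<in> PP" "\<Psi> a = \<Psi> b"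
  show "a = b"
  proof (rule path_eqI[OF ab(1,2)])
    fix n
    show l: "enat n \<le> path_length a \<longleftrightarrow> enat n \<le> path_length b"
      using \<Psi>_zero_iff[OF ab(1)] \<Psi>_zero_iff[OF ab(2)] ab(3) by metis
    assume n: "enat n \<le> path_length a"
    then show "initial E a n = initial E b n"
      using \<Psi>_eq[OF ab(1) initial_in[OF ab(2)], of n] l ab(3) by (simp add: \<Psi>_def)
  qed
qed

lemma \<Psi>_initial: "b \<in> P n \<Longrightarrow> \<Psi> b m = (if m \<le> n then \<theta> m (initial E b m) else (\<lambda>_. 0))"
  by (simp add: \<Psi>_def path_length_paths)

text \<open>Recognises the image of the boundary by conditions that each involve at most two
  consecutive coordinates. Such conditions can be verified for limits of boundary paths and also
  almost everywhere for a measure given by its finite marginals; both uses occur below.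
  Compatibility under truncation makes the nonzero coordinates the initial segments of one path, and
  the last condition forbids that path to stop at a regular vertex.\<close>

lemma path_of_initials:
  assumes x: "\<And>n. x n \<in> insert (\<lambda>_. 0) (\<theta> n ` P n)" and x0: "x 0 \<noteq> (\<lambda>_. 0)"
    and ini: "\<And>n b. b \<in> P (Suc n) \<Longrightarrow> x (Suc n) = \<theta> (Suc n) b \<Longrightarrow> x n = \<theta> n (initial E b n)"
    and reg: "\<And>n b. b \<in> P n \<Longrightarrow> x n = \<theta> n b \<Longrightarrow> path_source E b \<in> regular_vertices E \<Longrightarrow>
      x (Suc n) \<noteq> (\<lambda>_. 0)"
  shows "x \<in> \<Psi> ` BP"
proof -
  have "\<forall>n. \<exists>b. x n \<noteq> (\<lambda>_. 0) \<longrightarrow> b \<in> P n \<and> x n = \<theta> n b"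
    using x by blast
  then obtain b where b: "\<And>n. x n \<noteq> (\<lambda>_. 0) \<Longrightarrow> b n \<in> P n \<and> x n = \<theta> n (b n)"
    by metis
  have prev: "x n \<noteq> (\<lambda>_. 0) \<and> b n = initial E (b (Suc n)) n" if "x (Suc n) \<noteq> (\<lambda>_. 0)" for n
  proof -
    have bS: "b (Suc n) \<in> P (Suc n)" "x (Suc n) = \<theta> (Suc n) (b (Suc n))"
      using b[OF that] by auto
    then have i: "initial E (b (Suc n)) n \<in> P n" "x n = \<theta> n (initial E (b (Suc n)) n)"
      using initial_Suc_in ini by auto
    then have "x n \<noteq> (\<lambda>_. 0)" using \<theta>_nz by simp
    with b[of n] i show ?thesis using \<theta>_eq by metis
  qed
  have chain: "x n \<noteq> (\<lambda>_. 0) \<and> b n = initial E (b m) n" if "x m \<noteq> (\<lambda>_. 0)" "n \<le> m" for n m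
    using that(2,1)
  proof (induction rule: dec_induct)
    case base
    then show ?case using b initial_self by simp
  next
    case (step k)
    have k: "x k \<noteq> (\<lambda>_. 0)" "b k = initial E (b (Suc k)) k"
      using prev[OF step.prems] by auto
    have "initial E (initial E (b (Suc k)) k) n = initial E (b (Suc k)) n"
      using b[OF step.prems] step.hyps by (intro initial_initial) (auto simp: path_length_paths paths_in_all)
    then show ?case using step.IH[OF k(1)] k(2) by simp
  qed
  show ?thesis
  proof (cases "\<forall>n. x n \<noteq> (\<lambda>_. 0)")
    case True
    \<comment> \<open>The edge with index \<open>k\<close> first occurs in the segment of length
      \<open>k + 1\<close>, and compatibility makes all longer segments agree with it.\<close>
    define f where "f k = edge (b (Suc k)) k" for k
    have bP: "b n \<in> P n" for n using b True by simp
    have be: "edge (b m) k = f k" if "k < m" for k m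
    proof -
      have "edge (b m) k = edge (initial E (b m) (Suc k)) k"
        using edge_initial[OF bP[of m], of k "Suc k"] that by simp
      also have "initial E (b m) (Suc k) = b (Suc k)"
        using chain[of m "Suc k"] True that by simp
      finally show ?thesis by (simp add: f_def)
    qed
    have fE: "f k \<in> topspace E1" for k
      unfolding f_def using paths_edge[OF bP[of "Suc k"]] by simp
    have fs: "src E (f k) = rng E (f (Suc k))" for k
      using bP[of "Suc (Suc k)"] be[of k "Suc (Suc k)"] be[of "Suc k" "Suc (Suc k)"]
      by (auto simp: paths_of_length_Suc)
    have ainf: "Infinite_Path f \<in> infinite_paths E"
      using fE fs by (auto simp: infinite_paths_def)
    have b_eq: "initial E (Infinite_Path f) n = b n" for n
    proof (cases n)
      case 0
      have "b 0 = initial E (b (Suc 0)) 0" using prev True by blast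
      also have "\<dots> = Vertex (rng E (f 0))"
        using bP[of "Suc 0"] be[of 0 "Suc 0"] by (auto simp: paths_of_length_Suc dest!: hd_last_nth)
      finally show ?thesis using 0 by simp
    next
      case (Suc m)
      then obtain es where es: "b n = Finite_Path es" "length es = Suc m"
        using bP[of n] by (auto simp: paths_of_length_Suc)
      then have "es ! k = f k" if "k < Suc m" for k
        using be[of k n] that Suc by simp
      then have "es = map f [0..<Suc m]"
        using es(2) by (auto simp: list_eq_iff_nth_eq simp del: upt_Suc)
      then show ?thesis using es Suc by simp
    qed
    have "\<Psi> (Infinite_Path f) = x"
    proof
      fix n show "\<Psi> (Infinite_Path f) n = x n"
        using b_eq[of n] b[of n] True by (simp add: \<Psi>_def)
    qed
    moreover have "Infinite_Path f \<in> BP" using ainf by (simp add: boundary_paths_def)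
    ultimately show ?thesis by blast
  next
    case False
    \<comment> \<open>The first coordinate at infinity is not 0, and the segment just before it is
      the whole path.\<close>
    define N where "N = (LEAST n. x n = (\<lambda>_. 0))"
    have N: "x N = (\<lambda>_. 0)" unfolding N_def using False LeastI_ex[of "\<lambda>n. x n = (\<lambda>_. 0)"] by blast
    then obtain n where n: "N = Suc n" using x0 by (cases N) auto
    have xn: "x n \<noteq> (\<lambda>_. 0)"
      using not_less_Least[of n "\<lambda>n. x n = (\<lambda>_. 0)"] n unfolding N_def by simp
    have bn: "b n \<in> P n" "x n = \<theta> n (b n)" using b[OF xn] by auto
    have "\<Psi> (b n) = x"
    proof
      fix m show "\<Psi> (b n) m = x m"
      proof (cases "m \<le> n")
        case True
        then show ?thesis using chain[OF xn True] b[of m] bn by (simp add: \<Psi>_initial)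
      next
        case False
        then have "x m = (\<lambda>_. 0)" using chain[of m "Suc n"] N n by (metis not_less_eq_eq)
        with False show ?thesis using bn by (simp add: \<Psi>_initial)
      qed
    qed
    moreover have "b n \<in> BP"
      using bn reg[OF bn] N n path_source_in[OF bn(1)]
      by (auto simp: boundary_paths_def finite_paths_def singular_vertices_def)
    ultimately show ?thesis by blast
  qed
qed

section \<open>The boundary topology as an induced topology\<close>

lemma cylinder_\<Psi>:
  assumes "S \<subseteq> P n"
  shows "cylinder E S = {a \<in> BP. \<Psi> a n \<in> \<theta> n ` S}"
  unfolding cylinder_paths[OF assms] using assms boundary_subset_all_paths[of E] \<Psi>_eq[of _ _ n]
  by (auto simp: image_iff subset_iff)

lemma openin_cylinder: "openin TB (cylinder E U)"
  if "openin (finite_paths_topology E) U"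
proof -
  have "openin TB (cylinder E U - cylinder E {})"
    unfolding boundary_topology_def using that
    by (intro topology_generated_by_Basis) auto
  then show ?thesis by (simp add: cylinder_def)
qed

lemma cylinder_finite_paths: "cylinder E (finite_paths E) = BP"
proof -
  have "initial E a 0 \<in> finite_paths E" if "a \<in> BP" for a
    using initial_in[of a 0] that boundary_subset_all_paths
    by (auto simp: finite_paths_def zero_enat_def[symmetric])
  then show ?thesis unfolding cylinder_def
    by (auto intro!: exI[of _ "0::nat"] simp: zero_enat_def[symmetric] simp del: initial.simps)
qed

lemma openin_compl_cylinder: "openin TB (BP - cylinder E K)"
  if "compactin (finite_paths_topology E) K"
proof -
  have "openin TB (cylinder E (finite_paths E) - cylinder E K)"
    unfolding boundary_topology_def using that openin_topspace[of "finite_paths_topology E"]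
    by (intro topology_generated_by_Basis) auto
  then show ?thesis by (simp add: cylinder_finite_paths)
qed

lemma topspace_boundary [simp]: "topspace TB = BP"
proof -
  have "openin TB BP"
    using openin_cylinder[OF openin_topspace] by (simp add: cylinder_finite_paths)
  moreover have "topspace TB \<subseteq> BP"
    unfolding boundary_topology_def by (auto simp: cylinder_def)
  ultimately show ?thesis using openin_subset by blast
qed

lemma open_coordinate: "open W \<Longrightarrow> open {x :: nat \<Rightarrow> nat \<Rightarrow> real. x n \<in> W}"
proof -
  have "continuous_on UNIV (\<lambda>x :: nat \<Rightarrow> nat \<Rightarrow> real. x n)"
    by (rule continuous_on_product_coordinates)
  then show "open W \<Longrightarrow> open {x :: nat \<Rightarrow> nat \<Rightarrow> real. x n \<in> W}"
    using open_vimage[of W "\<lambda>x. x n"] by (simp add: vimage_def)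
qed

text \<open>A cylinder over an open set confines one coordinate to an open set away from infinity;
  leaving out the cylinder over a compact set of paths of one length confines it to a neighbourhood
  of infinity. Together these are the open sets of the one-point compactification, so the basic sets
  of the boundary generate exactly the topology induced by the product.\<close>

lemma boundary_openin:
  "openin TB U \<longleftrightarrow> (\<exists>W. open W \<and> U = \<Psi> -` W \<inter> BP)"
proof
  assume "openin TB U"
  then have "generate_topology_on {cylinder E U - cylinder E K |U K.
     openin (finite_paths_topology E) U \<and> compactin (finite_paths_topology E) K} U"
    by (simp add: boundary_topology_def openin_topology_generated_by_iff)
  then have "openin (pullback_topology BP \<Psi> euclidean) U"
  proof (induction rule: generate_topology_on.induct)
    case (Basis S)
    then obtain U K where S: "S = cylinder E U - cylinder E K"
      "openin (finite_paths_topology E) U" "compactin (finite_paths_topology E) K" by auto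
    have U: "openin (T n) (U \<inter> P n)" "U \<subseteq> finite_paths E" for n
      using S(2) by (auto simp: openin_FT)
    have "\<exists>W. open W \<and> (\<lambda>_. 0) \<notin> W \<and> U \<inter> P n = \<theta> n -` W \<inter> P n" for n
      using openin_T_\<theta>[OF U(1)] by metis
    then obtain W where W: "\<And>n. open (W n)" "\<And>n. (\<lambda>_. 0) \<notin> W n"
      "\<And>n. U \<inter> P n = \<theta> n -` W n \<inter> P n"
      by metis
    have cU: "cylinder E U = \<Psi> -` (\<Union>n. {x. x n \<in> W n}) \<inter> BP"
    proof -
      have "U = (\<Union>n. U \<inter> P n)" using U(2) by (auto simp: finite_paths_def)
      then have "cylinder E U = (\<Union>n. cylinder E (U \<inter> P n))"
        using cylinder_Union[of "\<lambda>n. U \<inter> P n" UNIV] by simp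
      moreover have "cylinder E (U \<inter> P n) = \<Psi> -` {x. x n \<in> W n} \<inter> BP" for n
      proof -
        have "\<Psi> a n \<in> W n \<longleftrightarrow> enat n \<le> path_length a \<and> initial E a n \<in> U \<inter> P n" if "a \<in> BP" for a
          using W(2,3)[of n] initial_in[of a n] that boundary_subset_all_paths[of E]
          by (auto simp: \<Psi>_def)
        then show ?thesis by (subst cylinder_paths[of _ n]) auto
      qed
      ultimately show ?thesis by auto
    qed
    \<comment> \<open>Only finitely many lengths occur in \<open>K\<close>, so the intersection of
      the open conditions \<open>C n\<close> is finite.\<close>
    obtain N where N: "K \<subseteq> (\<Union>n<N. P n)" using compactin_FT_T(2)[OF S(3)] by blast
    define C where "C n = {x :: nat \<Rightarrow> nat \<Rightarrow> real. x n \<notin> \<theta> n ` (K \<inter> P n)}" for n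
    have "open (C n)" for n
    proof -
      have "compact (\<theta> n ` (K \<inter> P n))"
        using compactin_FT_T(1)[OF S(3)] std_embedding_compactin[OF \<theta>_emb] by blast
      then have "open (- \<theta> n ` (K \<inter> P n))" by (simp add: compact_imp_closed open_Compl)
      from open_coordinate[OF this, of n] show ?thesis by (simp add: C_def)
    qed
    moreover have cK: "BP - cylinder E K = \<Psi> -` (\<Inter>n<N. C n) \<inter> BP"
    proof -
      have "K = (\<Union>n<N. K \<inter> P n)" using N by auto
      then have "cylinder E K = (\<Union>n<N. cylinder E (K \<inter> P n))"
        using cylinder_Union[of "\<lambda>n. K \<inter> P n" "{..<N}"] by simp
      moreover have "cylinder E (K \<inter> P n) = {a \<in> BP. \<Psi> a n \<in> \<theta> n ` (K \<inter> P n)}" for n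
        by (rule cylinder_\<Psi>) auto
      ultimately show ?thesis by (auto simp: C_def)
    qed
    moreover have "S = \<Psi> -` ((\<Union>n. {x. x n \<in> W n}) \<inter> (\<Inter>n<N. C n)) \<inter> BP"
    proof -
      have "S = cylinder E U \<inter> (BP - cylinder E K)" using S(1) by (auto simp: cylinder_def)
      then show ?thesis using cU cK by auto
    qed
    ultimately show ?case
      unfolding openin_pullback_topology
      using W(1) by (intro exI[of _ "(\<Union>n. {x. x n \<in> W n}) \<inter> (\<Inter>n<N. C n)"])
        (auto intro!: open_Int open_UN open_INT open_coordinate)
  qed (auto intro: openin_Union)
  then show "\<exists>W. open W \<and> U = \<Psi> -` W \<inter> BP"
    by (simp add: openin_pullback_topology)
next
  assume "\<exists>W. open W \<and> U = \<Psi> -` W \<inter> BP"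
  then obtain W where W: "open W" "U = \<Psi> -` W \<inter> BP" by blast
  have "continuous_map TB
      (product_topology (\<lambda>_. euclidean :: (nat \<Rightarrow> real) topology) UNIV) \<Psi>"
  proof (subst continuous_map_componentwise_UNIV, rule allI)
    fix n
    show "continuous_map TB (euclidean :: (nat \<Rightarrow> real) topology) (\<lambda>a. \<Psi> a n)"
      unfolding continuous_map_def
    proof (intro conjI allI impI)
      fix W :: "(nat \<Rightarrow> real) set" assume "openin euclidean W"
      then have oW: "open W" by simp
      show "openin TB {a \<in> topspace TB. \<Psi> a n \<in> W}"
      proof (cases "(\<lambda>_. 0) \<in> W")
        case False
        have o: "openin (T n) (\<theta> n -` W \<inter> P n)"
          using oW std_embedding_openin[OF \<theta>_emb, of n] by auto
        have "{a \<in> BP. \<Psi> a n \<in> W} = cylinder E (\<theta> n -` W \<inter> P n)"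
          using False initial_in boundary_subset_all_paths[of E]
          by (subst cylinder_paths[of _ n]) (auto simp: \<Psi>_def)
        then show ?thesis using openin_cylinder[OF openin_T_FT[OF o]] by simp
      next
        \<comment> \<open>A neighbourhood of infinity omits only a compact set of paths, so its
          preimage is the complement of a compact cylinder.\<close>
        case True
        define K where "K = {b \<in> P n. \<theta> n b \<notin> W}"
        have "\<theta> n ` K = insert (\<lambda>_. 0) (\<theta> n ` P n) - W" using True by (auto simp: K_def)
        then have "compact (\<theta> n ` K)" using compact_diff[OF \<theta>_compact oW] by simp
        then have "compactin (T n) K"
          by (auto simp: std_embedding_compactin[OF \<theta>_emb] K_def)
        moreover have "{a \<in> BP. \<Psi> a n \<in> W} = BP - cylinder E K"
          using True initial_in boundary_subset_all_paths[of E]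
          by (subst cylinder_paths[of _ n]) (auto simp: \<Psi>_def K_def)
        ultimately show ?thesis using openin_compl_cylinder[OF compactin_T_FT] by simp
      qed
    qed auto
  qed
  then have "continuous_map TB euclidean \<Psi>"
    by (simp only: euclidean_product_topology)
  from openin_continuous_map_preimage[OF this, of W] W
  show "openin TB U"
    by (simp add: vimage_def Int_def conj_commute)
qed

end

section \<open>Properness of the range map\<close>

context sc_graph
begin

lemma continuous_initial_le:
  assumes "n \<le> m"
  shows "continuous_map (T m) (T n) (\<lambda>b. initial E b n)"
  using assms
proof (induction rule: dec_induct)
  case base
  show ?case by (rule continuous_map_eq[OF continuous_map_id]) (simp add: initial_self)
next
  case (step k)
  show ?case
  proof (rule continuous_map_eq[OF continuous_map_compose[OF continuous_initial step.IH]])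
    fix b assume "b \<in> topspace (T (Suc k))"
    then show "((\<lambda>b. initial E b n) \<circ> (\<lambda>b. initial E b k)) b = initial E b n"
      using initial_initial[of b k n] step.hyps by (simp add: paths_in_all path_length_paths)
  qed
qed

lemma continuous_Vertex: "continuous_map V0 (T 0) Vertex"
  by (intro continuous_into_T0) (auto simp: paths_of_length_0)

lemma compact_neighbourhood_E1:
  assumes "e \<in> topspace E1"
  obtains N K where "openin E1 N" "compactin E1 K" "e \<in> N" "N \<subseteq> K"
  using locally_compact_E1 assms unfolding locally_compact_space_def by blast

lemma relatively_compact_cover_V0: "relatively_compact_cover V0"
  using bump_family_exists[OF second_countable_V0 locally_compact_V0 Hausdorff_V0] bump_family_relatively_compact_cover
  by blast

lemma relatively_compact_cover_E1: "relatively_compact_cover E1"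
  using bump_family_exists[OF second_countable_E1 locally_compact_E1 Hausdorff_E1] bump_family_relatively_compact_cover
  by blast

lemma std_embedding_V0: "\<exists>\<theta> :: 'v \<Rightarrow> nat \<Rightarrow> real. std_embedding V0 \<theta>"
  using bump_family_exists[OF second_countable_V0 locally_compact_V0 Hausdorff_V0]
    bump_family_compactification[OF Hausdorff_V0] unfolding compactification_def by blast

lemma compact_V0_sets: "compactin V0 K \<Longrightarrow> K \<in> sets BV"
  using std_embedding_V0 std_embedding_compact_sets by blast

lemma std_embedding_E1: "\<exists>\<theta> :: 'e \<Rightarrow> nat \<Rightarrow> real. std_embedding E1 \<theta>"
  using bump_family_exists[OF second_countable_E1 locally_compact_E1 Hausdorff_E1]
    bump_family_compactification[OF Hausdorff_E1] unfolding compactification_def by blast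

end

context embedded_graph
begin

lemma boundary_in_all: "a \<in> BP \<Longrightarrow> a \<in> PP"
  using boundary_subset_all_paths by blast

lemma \<Psi>_0: "a \<in> PP \<Longrightarrow> \<Psi> a 0 = \<theta> 0 (Vertex (path_range E a))"
  by (simp add: \<Psi>_def zero_enat_def[symmetric])

lemma Vertex_in: "v \<in> topspace V0 \<Longrightarrow> Vertex v \<in> P 0"
  by (simp add: paths_of_length_0)

text \<open>The image lies in a product of compact spaces, so it remains to see that it is closed. A
  limit of boundary paths satisfies the hypotheses of \<open>path_of_initials\<close>: truncation is
  continuous, the range stays in \<open>K\<close>, and regularity of the last vertex would keep the
  next edge in a compact set.\<close>

lemma compact_range_preimage:
  assumes K: "compactin V0 K"
  shows "compact (\<Psi> ` {a \<in> BP. path_range E a \<in> K})"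
proof -
  let ?S = "{a \<in> BP. path_range E a \<in> K}"
  \<comment> \<open>Coordinate 0 is never at infinity and is confined to the copy of
    \<open>K\<close>; this compact set misses the zero sequence, so the limit also has a
    range.\<close>
  define C where "C n = (if n = 0 then \<theta> 0 ` Vertex ` K else insert (\<lambda>_. 0) (\<theta> n ` P n))" for n
  have KV: "K \<subseteq> topspace V0" using compactin_subset_topspace[OF K] .
  have "compactin (T 0) (Vertex ` K)" using image_compactin[OF K continuous_Vertex] .
  then have C: "compact (C n)" for n
    using \<theta>_compact std_embedding_compactin[OF \<theta>_emb, of 0] by (simp add: C_def)
  have "compactin (product_topology (\<lambda>_. euclidean :: (nat \<Rightarrow> real) topology) UNIV) (PiE UNIV C)"
    unfolding compactin_PiE using C by simp
  then have compC: "compact (PiE UNIV C)"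
    by (simp only: euclidean_product_topology compactin_euclidean_iff)
  have sub: "\<Psi> ` ?S \<subseteq> PiE UNIV C"
  proof
    fix x assume "x \<in> \<Psi> ` ?S"
    then obtain a where a: "a \<in> BP" "path_range E a \<in> K" "x = \<Psi> a" by auto
    have "\<Psi> a n \<in> C n" for n
    proof (cases "n = 0")
      case True
      then show ?thesis using a \<Psi>_0[OF boundary_in_all[OF a(1)]] by (simp add: C_def)
    next
      case False
      then show ?thesis using initial_in[OF boundary_in_all[OF a(1)], of n] by (auto simp: C_def \<Psi>_def)
    qed
    then show "x \<in> PiE UNIV C" using a by auto
  qed
  have "closed (\<Psi> ` ?S)"
    unfolding closed_sequential_limits
  proof (intro allI impI)
    fix x l assume xl: "(\<forall>j. x j \<in> \<Psi> ` ?S) \<and> x \<longlonglongrightarrow> l"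
    then have "\<exists>a. a \<in> ?S \<and> x j = \<Psi> a" for j
      by (metis (no_types, lifting) imageE)
    then obtain a where a: "\<And>j. a j \<in> ?S" "\<And>j. x j = \<Psi> (a j)" by metis
    have aP: "a j \<in> PP" and aB: "a j \<in> BP" for j using a(1)[of j] boundary_in_all by auto
    have lim: "(\<lambda>j. \<Psi> (a j) n) \<longlonglongrightarrow> l n" for n
    proof -
      have "((\<lambda>j. x j n) \<longlongrightarrow> l n) sequentially"
        by (rule continuous_on_tendsto_compose[OF continuous_on_product_coordinates[of n], where g = x])
          (use xl in auto)
      then show ?thesis by (simp add: a(2))
    qed
    have "x j \<in> PiE UNIV C" for j using sub xl by blast
    then have "l \<in> PiE UNIV C"
      using xl compact_imp_closed[OF compC] unfolding closed_sequential_limits by blast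
    then have lC: "l n \<in> C n" for n by auto
    \<comment> \<open>If a coordinate of the limit is an actual path, then the approximating paths
      are eventually at least that long, with initial segments close to it.\<close>
    have key: "\<forall>\<^sub>F j in sequentially. enat n \<le> path_length (a j) \<and> initial E (a j) n \<in> U"
      if U: "openin (T n) U" "b \<in> U" "l n = \<theta> n b" for n U b
    proof -
      obtain W where W: "open W" "(\<lambda>_. 0) \<notin> W" "U = \<theta> n -` W \<inter> P n"
        using openin_T_\<theta>[OF U(1)] .
      then have "l n \<in> W" using U by auto
      from topological_tendstoD[OF lim W(1) this]
      show ?thesis
      proof (rule eventually_mono)
        fix j assume j: "\<Psi> (a j) n \<in> W"
        then have len: "enat n \<le> path_length (a j)"
          using \<Psi>_zero_iff[OF aP[of j], of n] W(2) by metis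
        with j initial_in[OF aP[of j]] W(3)
        show "enat n \<le> path_length (a j) \<and> initial E (a j) n \<in> U" by (simp add: \<Psi>_def)
      qed
    qed
    have "l \<in> \<Psi> ` BP"
    proof (rule path_of_initials)
      show "l n \<in> insert (\<lambda>_. 0) (\<theta> n ` P n)" for n
        using lC[of n] KV Vertex_in by (auto simp: C_def split: if_splits)
      obtain v where v: "v \<in> K" "l 0 = \<theta> 0 (Vertex v)"
        using lC[of 0] by (auto simp: C_def)
      then show "l 0 \<noteq> (\<lambda>_. 0)"
        using \<theta>_nz[OF Vertex_in, of v] KV by auto
    next
      fix n b assume b: "b \<in> P (Suc n)" "l (Suc n) = \<theta> (Suc n) b"
      have "(\<lambda>j. \<Psi> (a j) n) \<longlonglongrightarrow> \<theta> n (initial E b n)"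
      proof (rule topological_tendstoI)
        fix W assume W: "open W" "\<theta> n (initial E b n) \<in> W"
        define U where "U = {c \<in> topspace (T (Suc n)). (\<theta> n \<circ> (\<lambda>b. initial E b n)) c \<in> W}"
        have "openin (T (Suc n)) U"
          unfolding U_def using W(1)
          by (intro openin_continuous_map_preimage[OF continuous_map_compose[OF continuous_initial
                std_embedding_continuous[OF \<theta>_emb]]]) simp
        moreover have "b \<in> U" using b(1) W(2) by (simp add: U_def)
        ultimately have "\<forall>\<^sub>F j in sequentially. enat (Suc n) \<le> path_length (a j) \<and> initial E (a j) (Suc n) \<in> U"
          using b(2) by (rule key)
        then show "\<forall>\<^sub>F j in sequentially. \<Psi> (a j) n \<in> W"
        proof (rule eventually_mono)
          fix j assume j: "enat (Suc n) \<le> path_length (a j) \<and> initial E (a j) (Suc n) \<in> U"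
          then have "enat n \<le> path_length (a j)"
            by (meson enat_ord_simps(1) le_SucI order_refl order_trans)
          with j show "\<Psi> (a j) n \<in> W"
            using initial_initial[OF aP[of j], of "Suc n" n] by (simp add: U_def \<Psi>_def)
        qed
      qed
      with lim show "l n = \<theta> n (initial E b n)" by (rule LIMSEQ_unique)
    next
      fix n b assume b: "b \<in> P n" "l n = \<theta> n b" "path_source E b \<in> regular_vertices E"
      obtain U where U: "openin V0 U" "path_source E b \<in> U" "U \<subseteq> regular_vertices E"
        "compactin E1 {e \<in> topspace E1. rng E e \<in> V0 closure_of U}"
        using regular_vertices_open[OF b(3)] .
      have "\<exists>N K. openin E1 N \<and> compactin E1 K \<and> N \<subseteq> K \<and> edge b k \<in> N" if "k < n" for k
      proof -
        have "edge b k \<in> topspace E1" using paths_edge[of b "n - 1" k] b(1) that by simp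
        then show ?thesis using compact_neighbourhood_E1 by metis
      qed
      then obtain N K where NK: "\<And>k. k < n \<Longrightarrow> openin E1 (N k)" "\<And>k. k < n \<Longrightarrow> compactin E1 (K k)"
        "\<And>k. k < n \<Longrightarrow> N k \<subseteq> K k" "\<And>k. k < n \<Longrightarrow> edge b k \<in> N k"
        by metis
      \<comment> \<open>A neighbourhood of \<open>b\<close> whose members have all edges in fixed
        compact sets and their source in \<open>U\<close>.\<close>
      define G where "G = {c \<in> topspace (T n). path_source E c \<in> U} \<inter>
        (\<Inter>k<n. {c \<in> topspace (T n). edge c k \<in> N k})"
      have oG: "openin (T n) G"
      proof (cases n)
        case 0
        then show ?thesis
          unfolding G_def using openin_continuous_map_preimage[OF continuous_source U(1)] by simp
      next
        case (Suc m)
        have "openin (T n) {c \<in> topspace (T n). edge c k \<in> N k}" if "k < n" for k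
          using openin_continuous_map_preimage[OF continuous_edge[of k m] NK(1)[OF that]] that Suc
          by simp
        then show ?thesis
          unfolding G_def using Suc openin_continuous_map_preimage[OF continuous_source U(1)]
          by (intro openin_Int openin_INT2) auto
      qed
      have bG: "b \<in> G" using b(1) U(2) NK(4) by (auto simp: G_def)
      \<comment> \<open>Contains every extension of a path in \<open>G\<close> by one edge: the new
        edge has its range in \<open>U\<close>. The image of this compact set is closed and misses
        infinity, so coordinate \<open>n + 1\<close> of the limit is not at infinity.\<close>
      define L where "L = {c \<in> P (Suc n). \<forall>k\<le>n. edge c k \<in>
        (if k < n then K k else {e \<in> topspace E1. rng E e \<in> V0 closure_of U})}"
      have "compactin (T (Suc n)) L"
        unfolding L_def using NK(2) U(4) by (intro compactin_box) auto
      then have cL: "closed (\<theta> (Suc n) ` L)"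
        using std_embedding_compactin[OF \<theta>_emb] compact_imp_closed by blast
      have "\<forall>\<^sub>F j in sequentially. \<Psi> (a j) (Suc n) \<in> \<theta> (Suc n) ` L"
        using key[OF oG bG b(2)]
      proof (rule eventually_mono)
        fix j assume j: "enat n \<le> path_length (a j) \<and> initial E (a j) n \<in> G"
        \<comment> \<open>A boundary path cannot end in \<open>U\<close>, all of whose vertices are
          regular, so it continues by at least one edge.\<close>
        have "path_length (a j) \<noteq> enat n"
        proof
          assume eq: "path_length (a j) = enat n"
          from aP[of j] have aj: "a j \<in> P n" by (cases rule: all_paths_cases) (use eq in auto)
          then have "path_source E (a j) \<in> regular_vertices E"
            using j U(3) initial_self by (auto simp: G_def)
          moreover have "path_source E (a j) \<in> singular_vertices E"
            using aB[of j] aj by (cases "a j"; cases n)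
              (auto simp: boundary_paths_def infinite_paths_def paths_of_length_0 paths_of_length_Suc)
          ultimately show False by (simp add: singular_vertices_def)
        qed
        with j have len: "enat (Suc n) \<le> path_length (a j)"
          by (cases "path_length (a j)") auto
        let ?c = "initial E (a j) (Suc n)"
        have c: "?c \<in> P (Suc n)" using initial_in[OF aP len] .
        have ci: "initial E ?c n = initial E (a j) n"
          using initial_initial[OF aP len, of n] by simp
        have "edge ?c k \<in> K k" if "k < n" for k
          using edge_initial[OF c that] ci j NK(3)[OF that] that by (auto simp: G_def)
        moreover have "edge ?c n \<in> {e \<in> topspace E1. rng E e \<in> V0 closure_of U}"
          using path_source_initial[OF c] ci j paths_edge[OF c, of n] closure_of_subset[OF openin_subset[OF U(1)]]
          by (auto simp: G_def)
        ultimately have "?c \<in> L" using c by (auto simp: L_def le_less)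
        then show "\<Psi> (a j) (Suc n) \<in> \<theta> (Suc n) ` L" using len by (simp add: \<Psi>_def)
      qed
      then have "l (Suc n) \<in> \<theta> (Suc n) ` L"
        using Lim_in_closed_set[OF cL _ _ lim] by simp
      then obtain c where "c \<in> P (Suc n)" "l (Suc n) = \<theta> (Suc n) c" by (auto simp: L_def)
      then show "l (Suc n) \<noteq> (\<lambda>_. 0)" using \<theta>_nz[of c "Suc n"] by simp
    qed
    then obtain b where b: "b \<in> BP" "l = \<Psi> b" by blast
    obtain v where v: "v \<in> K" "l 0 = \<theta> 0 (Vertex v)"
      using lC[of 0] by (auto simp: C_def)
    then have "path_range E b = v"
      using \<Psi>_eq[OF boundary_in_all[OF b(1)] Vertex_in, of v] b KV by auto
    then show "l \<in> \<Psi> ` ?S" using b v by blast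
  qed
  with compC have "compact (PiE UNIV C \<inter> \<Psi> ` ?S)" by (rule compact_Int_closed)
  with sub show ?thesis by (simp add: Int_absorb1)
qed

lemma openin_range_preimage:
  assumes "openin V0 U"
  shows "openin TB {a \<in> BP. path_range E a \<in> U}"
proof -
  have "openin (T 0) {b \<in> topspace (T 0). path_range E b \<in> U}"
    using openin_continuous_map_preimage[OF continuous_range assms] .
  then obtain W where W: "open W" "(\<lambda>_. 0) \<notin> W" "{b \<in> topspace (T 0). path_range E b \<in> U} = \<theta> 0 -` W \<inter> P 0"
    using openin_T_\<theta> by blast
  have "path_range E a \<in> U \<longleftrightarrow> \<Psi> a 0 \<in> W" if "a \<in> BP" for a
  proof -
    have "Vertex (path_range E a) \<in> P 0" using path_range_all boundary_in_all[OF that] Vertex_in by blast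
    then have "Vertex (path_range E a) \<in> {b \<in> topspace (T 0). path_range E b \<in> U} \<longleftrightarrow>
        \<theta> 0 (Vertex (path_range E a)) \<in> W"
      unfolding W(3) by simp
    then show ?thesis
      using \<open>Vertex (path_range E a) \<in> P 0\<close> \<Psi>_0[OF boundary_in_all[OF that]] by simp
  qed
  then have "{a \<in> BP. path_range E a \<in> U} = \<Psi> -` {x. x 0 \<in> W} \<inter> BP" by auto
  then show ?thesis using open_coordinate[OF W(1)] boundary_openin by blast
qed

lemma continuous_boundary_range: "continuous_map TB V0 (path_range E)"
  using openin_range_preimage path_range_all boundary_in_all by (auto simp: continuous_map_def)

text \<open>That the image is Borel is the substantial part: by properness it is a countable union
  of compact sets.\<close>

lemma std_embedding_boundary: "std_embedding TB \<Psi>"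
  unfolding std_embedding_def
proof (intro conjI allI)
  show "inj_on \<Psi> (topspace TB)"
    using inj_on_subset[OF inj_\<Psi>] boundary_in_all by auto
  show "openin TB U \<longleftrightarrow> (\<exists>W. open W \<and> U = \<Psi> -` W \<inter> topspace TB)" for U
    by (simp add: boundary_openin)
  obtain W K where "\<And>n::nat. openin V0 (W n)" and W: "\<And>n. compactin V0 (K n)" "\<And>n. W n \<subseteq> K n"
    "(\<Union>n. W n) = topspace V0"
    using relatively_compact_coverE[OF relatively_compact_cover_V0] by metis
  have "\<Psi> ` topspace TB = (\<Union>n. \<Psi> ` {a \<in> BP. path_range E a \<in> K n})"
  proof (intro subset_antisym subsetI)
    fix x assume "x \<in> \<Psi> ` topspace TB"
    then obtain a where a: "a \<in> BP" "x = \<Psi> a" by auto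
    then have "path_range E a \<in> (\<Union>n. W n)" using path_range_all boundary_in_all unfolding W(3) by blast
    then obtain n where "path_range E a \<in> K n" using W(2) by blast
    then show "x \<in> (\<Union>n. \<Psi> ` {a \<in> BP. path_range E a \<in> K n})" using a by blast
  qed auto
  moreover have "\<Psi> ` {a \<in> BP. path_range E a \<in> K n} \<in> sets borel" for n
    using compact_range_preimage[OF W(1)] by (rule borel_compact)
  ultimately show "\<Psi> ` topspace TB \<in> sets borel" by auto
qed

lemma compactin_range_preimage:
  assumes "compactin V0 K"
  shows "compactin TB {a \<in> BP. path_range E a \<in> K}"
  using compact_range_preimage[OF assms] by (auto simp: std_embedding_compactin[OF std_embedding_boundary])

lemma relatively_compact_cover_boundary: "relatively_compact_cover TB"
proof -
  obtain W K where W: "\<And>n::nat. openin V0 (W n)" "\<And>n. compactin V0 (K n)" "\<And>n. W n \<subseteq> K n"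
    "(\<Union>n. W n) = topspace V0"
    using relatively_compact_coverE[OF relatively_compact_cover_V0] by metis
  show ?thesis
    unfolding relatively_compact_cover_def
  proof (rule exI[of _ "\<lambda>n. {a \<in> BP. path_range E a \<in> W n}"], intro conjI allI)
    fix n
    show "openin TB {a \<in> BP. path_range E a \<in> W n}"
      using openin_range_preimage W(1) by blast
    show "\<exists>C. compactin TB C \<and> {a \<in> BP. path_range E a \<in> W n} \<subseteq> C"
      using compactin_range_preimage[OF W(2)[of n]] W(3)[of n] by blast
  next
    have "\<exists>n. path_range E a \<in> W n" if "a \<in> BP" for a
      using path_range_all[OF boundary_in_all[OF that]] W(4) by blast
    then show "(\<Union>n. {a \<in> BP. path_range E a \<in> W n}) = topspace TB" by auto
  qed
qed

section \<open>The Borel structure of the path space\<close>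

text \<open>The analogue of \<open>cylinder\<close> inside all paths rather than boundary paths, for
  segments of one fixed length.\<close>

definition path_cylinder :: "nat \<Rightarrow> ('v, 'e) path set \<Rightarrow> ('v, 'e) path set" where
  "path_cylinder n B = {a \<in> PP. enat n \<le> path_length a \<and> initial E a n \<in> B}"

definition cylinders :: "('v, 'e) path set set" where
  "cylinders = {path_cylinder n B |n B. B \<in> sets (BF n)}"

text \<open>The set of all paths receives a sigma-algebra but no topology. The boundary is a
  measurable subset of it, and measures are compared and iterated here, where conditions on segments
  need no intersection with the boundary.\<close>

definition path_algebra :: "('v, 'e) path measure" where
  "path_algebra = sigma PP cylinders"

lemma cylinders_Pow: "cylinders \<subseteq> Pow PP"
  by (auto simp: cylinders_def path_cylinder_def)

lemma space_path_algebra [simp]: "space path_algebra = PP"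
  unfolding path_algebra_def using cylinders_Pow by (rule space_measure_of)

lemma sets_path_algebra: "sets path_algebra = sigma_sets PP cylinders"
  unfolding path_algebra_def using cylinders_Pow by (rule sets_measure_of)

lemma path_cylinder_sets: "B \<in> sets (BF n) \<Longrightarrow> path_cylinder n B \<in> sets path_algebra"
  by (auto simp: sets_path_algebra cylinders_def)

lemma Borel_T_subset: "B \<in> sets (BF n) \<Longrightarrow> B \<subseteq> P n"
  using sets.sets_into_space by fastforce

lemma P_sets: "P n \<in> sets (BF n)"
  using openin_borel_algebra[OF openin_topspace[of "T n"]] by simp

lemma path_cylinder_\<Psi>:
  assumes "B \<in> sets (BF n)"
  shows "path_cylinder n B = {a \<in> PP. \<Psi> a n \<in> \<theta> n ` B}"
  using Borel_T_subset[OF assms] \<Psi>_eq[of _ _ n] unfolding path_cylinder_def by blast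

lemma \<Psi>_coordinate_measurable:
  assumes M: "space M = PP" "\<And>B. B \<in> sets (BF n) \<Longrightarrow> path_cylinder n B \<in> sets M"
  shows "(\<lambda>a. \<Psi> a n) \<in> M \<rightarrow>\<^sub>M borel"
proof (rule measurableI)
  fix W :: "(nat \<Rightarrow> real) set" assume W: "W \<in> sets borel"
  have m: "\<theta> n -` W \<inter> P n \<in> sets (BF n)"
    using measurable_sets[OF std_embedding_measurable[OF \<theta>_emb] W, of n] by simp
  have "(\<lambda>a. \<Psi> a n) -` W \<inter> space M = path_cylinder n (\<theta> n -` W \<inter> P n) \<union>
      (if (\<lambda>_. 0) \<in> W then PP - path_cylinder n (P n) else {})"
    using initial_in by (auto simp: path_cylinder_def \<Psi>_def M(1) split: if_splits)
  also have "\<dots> \<in> sets M"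
    using M(2)[OF m] M(2)[OF P_sets] sets.compl_sets[of "path_cylinder n (P n)" M] M(1) by auto
  finally show "(\<lambda>a. \<Psi> a n) -` W \<inter> space M \<in> sets M" .
qed simp

lemma \<Psi>_measurable: "\<Psi> \<in> path_algebra \<rightarrow>\<^sub>M borel"
  by (intro measurable_coordinatewise_then_product \<Psi>_coordinate_measurable path_cylinder_sets) simp_all

lemma \<Psi>_vimage: "S \<subseteq> PP \<Longrightarrow> \<Psi> -` (\<Psi> ` S) \<inter> PP = S"
proof (intro set_eqI)
  fix a assume S: "S \<subseteq> PP"
  show "a \<in> \<Psi> -` (\<Psi> ` S) \<inter> PP \<longleftrightarrow> a \<in> S"
  proof (cases "a \<in> PP")
    case True
    then show ?thesis using inj_on_image_mem_iff[OF inj_\<Psi> True S] by simp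
  qed (use S in auto)
qed

lemma boundary_path_algebra: "BP \<in> sets path_algebra"
proof -
  have "\<Psi> ` BP \<in> sets borel"
    using std_embedding_range[OF std_embedding_boundary] by simp
  from measurable_sets[OF \<Psi>_measurable this]
  have "\<Psi> -` (\<Psi> ` BP) \<inter> PP \<in> sets path_algebra" by simp
  moreover have "\<Psi> -` (\<Psi> ` BP) \<inter> PP = BP"
    by (rule \<Psi>_vimage[OF boundary_subset_all_paths])
  ultimately show ?thesis by simp
qed

lemma boundary_inclusion_measurable: "(\<lambda>a. a) \<in> BB \<rightarrow>\<^sub>M path_algebra"
  unfolding path_algebra_def
proof (rule measurable_measure_of[OF cylinders_Pow])
  show "(\<lambda>a. a) \<in> space (BB) \<rightarrow> PP"
    using boundary_in_all by auto
  fix S assume "S \<in> cylinders"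
  then obtain n B where S: "S = path_cylinder n B" "B \<in> sets (BF n)"
    by (auto simp: cylinders_def)
  then have B: "\<theta> n ` B \<in> sets borel" using std_embedding_sets[OF \<theta>_emb] by blast
  have "(\<lambda>x :: nat \<Rightarrow> nat \<Rightarrow> real. x n) \<in> borel_measurable borel"
    by (rule borel_measurable_continuous_onI[OF continuous_on_product_coordinates])
  note meas = measurable_compose[OF std_embedding_measurable[OF std_embedding_boundary] this]
  have "(\<lambda>a. \<Psi> a n) -` (\<theta> n ` B) \<inter> BP \<in> sets (BB)"
    using measurable_sets[OF meas B] by simp
  moreover have "(\<lambda>a. a) -` S \<inter> space (BB) = (\<lambda>a. \<Psi> a n) -` (\<theta> n ` B) \<inter> BP"
    unfolding S(1) path_cylinder_\<Psi>[OF S(2)] using boundary_in_all by auto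
  ultimately show "(\<lambda>a. a) -` S \<inter> space (BB)
      \<in> sets (BB)" by simp
qed

text \<open>Both sigma-algebras arise from the coordinates of \<open>\<Psi>\<close>: Borel sets of
  the boundary are its preimages of Borel sets, and a cylinder is a condition on one coordinate.
  Topology can be left aside from here on when measurability is at stake.\<close>

lemma boundary_sets:
  "B \<in> sets (BB) \<longleftrightarrow> B \<in> sets path_algebra \<and> B \<subseteq> BP"
proof
  assume B: "B \<in> sets (BB)"
  then have B': "\<Psi> ` B \<in> sets borel" "B \<subseteq> BP"
    using std_embedding_sets[OF std_embedding_boundary] by auto
  have "\<Psi> -` (\<Psi> ` B) \<inter> PP = B"
    by (rule \<Psi>_vimage[OF order_trans[OF B'(2) boundary_subset_all_paths]])
  with measurable_sets[OF \<Psi>_measurable B'(1)] B'(2) show "B \<in> sets path_algebra \<and> B \<subseteq> BP" by simp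
next
  assume B: "B \<in> sets path_algebra \<and> B \<subseteq> BP"
  with measurable_sets[OF boundary_inclusion_measurable, of B]
  show "B \<in> sets (BB)"
    by (simp add: Int_absorb2 vimage_def)
qed

text \<open>A condition on a shorter segment is also one on a longer segment. So cylinders form a
  generator closed under intersection, as uniqueness of measures requires.\<close>

lemma path_cylinder_Int:
  assumes nm: "n \<le> m" and B: "B \<in> sets (BF n)" and C: "C \<in> sets (BF m)"
  shows "\<exists>D\<in>sets (BF m). path_cylinder n B \<inter> path_cylinder m C = path_cylinder m D"
proof -
  have "(\<lambda>b. initial E b n) -` B \<inter> P m \<in> sets (BF m)"
    using measurable_sets[OF continuous_map_measurable[OF continuous_initial_le[OF nm]] B] by simp
  then have m: "C \<inter> ((\<lambda>b. initial E b n) -` B \<inter> P m) \<in> sets (BF m)"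
    using C by auto
  have "path_cylinder n B \<inter> path_cylinder m C = path_cylinder m (C \<inter> ((\<lambda>b. initial E b n) -` B \<inter> P m))"
  proof (intro set_eqI iffI)
    fix a assume "a \<in> path_cylinder n B \<inter> path_cylinder m C"
    then show "a \<in> path_cylinder m (C \<inter> ((\<lambda>b. initial E b n) -` B \<inter> P m))"
      using initial_initial[of a m n] initial_in[of a m] nm by (auto simp: path_cylinder_def)
  next
    fix a assume a: "a \<in> path_cylinder m (C \<inter> ((\<lambda>b. initial E b n) -` B \<inter> P m))"
    then have "enat n \<le> path_length a"
      using nm by (auto simp: path_cylinder_def intro: order_trans[of "enat n" "enat m"])
    with a show "a \<in> path_cylinder n B \<inter> path_cylinder m C"
      using initial_initial[of a m n] nm by (auto simp: path_cylinder_def)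
  qed
  with m show ?thesis by blast
qed

lemma cylinders_Int_stable: "Int_stable cylinders"
proof (rule Int_stableI)
  fix S S' assume "S \<in> cylinders" "S' \<in> cylinders"
  then obtain n B m C where "S = path_cylinder n B" "S' = path_cylinder m C"
    "B \<in> sets (BF n)" "C \<in> sets (BF m)"
    by (auto simp: cylinders_def)
  then show "S \<inter> S' \<in> cylinders"
    using path_cylinder_Int[of n m B C] path_cylinder_Int[of m n C B] nat_le_linear[of n m]
    by (auto simp: cylinders_def Int_commute)
qed

end

section \<open>Prepending an edge\<close>

fun prep :: "'e \<Rightarrow> ('v, 'e) path \<Rightarrow> ('v, 'e) path" where
  "prep e (Vertex v) = Finite_Path [e]"
| "prep e (Finite_Path es) = Finite_Path (e # es)"
| "prep e (Infinite_Path f) = Infinite_Path (case_nat e f)"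

lemma path_length_prep: "path_length (prep e a) = eSuc (path_length a)"
  by (cases a) (auto simp: eSuc_enat zero_enat_def)

lemma path_range_prep [simp]: "path_range E (prep e a) = rng E e"
  by (cases a) auto

context sc_graph
begin

lemma prep_paths:
  assumes "b \<in> P n" "e \<in> topspace E1" "src E e = path_range E b"
  shows "prep e b \<in> P (Suc n)"
proof (cases n)
  case 0
  then show ?thesis using assms by (auto simp: paths_of_length_0 paths_of_length_Suc)
next
  case (Suc m)
  then obtain es where es: "b = Finite_Path es" "length es = Suc m" "set es \<subseteq> topspace E1"
    "\<forall>k<m. src E (es ! k) = rng E (es ! Suc k)"
    using assms(1) by (auto simp: paths_of_length_Suc)
  have "src E ((e # es) ! k) = rng E ((e # es) ! Suc k)" if "k < Suc m" for k
    using that es assms(3) hd_last_nth[OF es(2)] by (cases k) auto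
  then show ?thesis using es assms(2) Suc unfolding paths_of_length_Suc by auto
qed

lemma edge_prep_0: "edge (prep e b) 0 = e" if "b \<in> P n"
  using that by (cases n) (auto simp: paths_of_length_0 paths_of_length_Suc)

lemma prep_all:
  assumes "a \<in> PP" "e \<in> topspace E1" "src E e = path_range E a"
  shows "prep e a \<in> PP"
  using assms(1)
proof (cases rule: all_paths_cases)
  case (1 n)
  then show ?thesis using prep_paths[OF _ assms(2,3)] paths_in_all by blast
next
  case (2 f)
  have "\<forall>k. case_nat e f k \<in> topspace E1 \<and> src E (case_nat e f k) = rng E (case_nat e f (Suc k))"
    using 2 assms(2,3) by (auto split: nat.split)
  then show ?thesis unfolding all_paths_def infinite_paths_def 2(1) by auto
qed

lemma initial_prep:
  assumes "a \<in> PP" "enat n \<le> path_length a"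
  shows "initial E (prep e a) (Suc n) = prep e (initial E a n)"
  using assms(1)
proof (cases rule: all_paths_cases)
  case (1 m)
  then show ?thesis
    using assms(2) by (cases n; cases m) (auto simp: paths_of_length_0 paths_of_length_Suc)
next
  case (2 f)
  then show ?thesis
    by (cases n) (auto simp: map_upt_Suc simp del: upt_Suc)
qed

text \<open>Being a boundary path depends only on how the path ends.\<close>

lemma prep_boundary:
  assumes "a \<in> PP" "e \<in> topspace E1" "src E e = path_range E a"
  shows "prep e a \<in> BP \<longleftrightarrow> a \<in> BP"
  using assms(1)
proof (cases rule: all_paths_cases)
  case (1 n)
  have s: "path_source E (prep e a) = path_source E a"
    using 1(1) assms(3) by (cases n) (auto simp: paths_of_length_0 paths_of_length_Suc)
  have fin: "prep e a \<in> finite_paths E" "a \<in> finite_paths E"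
    using 1(1) prep_paths[OF 1(1) assms(2,3)] by (auto simp: finite_paths_def)
  have "prep e a \<notin> infinite_paths E" "a \<notin> infinite_paths E"
    using 1(1) by (cases n; auto simp: infinite_paths_def paths_of_length_0 paths_of_length_Suc)+
  then show ?thesis using s fin by (simp add: boundary_paths_def)
next
  case (2 f)
  then have "a \<in> BP" by (auto simp: boundary_paths_def infinite_paths_def)
  moreover have "prep e a \<in> BP"
    using prep_all[OF assms] 2(1)
    by (auto simp: boundary_paths_def all_paths_def finite_paths_def paths_of_length_def split: if_splits)
  ultimately show ?thesis by simp
qed

lemma shift_prep:
  assumes "a \<in> PP" "src E e = path_range E a"
  shows "shift E (prep e a) = a"
  using assms(1)
proof (cases rule: all_paths_cases)
  case (1 n)
  then show ?thesis
    using assms(2) by (cases n) (auto simp: paths_of_length_0 paths_of_length_Suc Suc_le_eq)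
next
  case (2 f)
  then show ?thesis by simp
qed

lemma prep_decompose:
  assumes "a \<in> PP" "1 \<le> path_length a"
  obtains e a' where "a' \<in> PP" "e \<in> topspace E1" "src E e = path_range E a'" "a = prep e a'"
  using assms(1)
proof (cases rule: all_paths_cases)
  case (1 n)
  then obtain m where n: "n = Suc m" using assms(2) by (cases n) (auto simp: zero_enat_def[symmetric])
  then obtain e es where a: "a = Finite_Path (e # es)" "length es = m" "e \<in> topspace E1"
    "set es \<subseteq> topspace E1" "\<forall>k<m. src E ((e # es) ! k) = rng E ((e # es) ! Suc k)"
    using 1(1) by (auto simp: paths_of_length_Suc length_Suc_conv)
  show thesis
  proof (cases es)
    case Nil
    have "Vertex (src E e) \<in> P 0" using src_in[OF a(3)] by (simp add: paths_of_length_0)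
    then show thesis using a Nil by (intro that[of "Vertex (src E e)" e]) (auto intro: paths_in_all)
  next
    case (Cons d ds)
    then obtain l where l: "m = Suc l" using a(2) by auto
    have "src E (es ! k) = rng E (es ! Suc k)" if "k < l" for k
      using a(5)[rule_format, of "Suc k"] that l by simp
    then have "Finite_Path es \<in> P (Suc l)"
      using a l unfolding paths_of_length_Suc by auto
    moreover have "src E e = rng E (hd es)"
      using a(5)[rule_format, of 0] l Cons by simp
    ultimately show thesis using a
      by (intro that[of "Finite_Path es" e]) (auto intro: paths_in_all)
  qed
next
  case (2 f)
  have "Infinite_Path (\<lambda>k. f (Suc k)) \<in> PP"
    using 2 by (auto simp: all_paths_def infinite_paths_def)
  moreover have "case_nat (f 0) (\<lambda>k. f (Suc k)) = f" by (auto split: nat.split)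
  ultimately show thesis
    using 2 by (intro that[of "Infinite_Path (\<lambda>k. f (Suc k))" "f 0"]) auto
qed

text \<open>Continuity of the local inverse makes images of Borel sets Borel, and the compact bound
  on the image makes pulled-back measures finite on charts.\<close>

definition chart :: "'e set \<Rightarrow> bool" where
  "chart U \<longleftrightarrow> openin E1 U \<and> inj_on (src E) U \<and> openin V0 (src E ` U) \<and>
     continuous_map (subtopology V0 (src E ` U)) E1 (inv_into U (src E)) \<and>
     (\<exists>K. compactin V0 K \<and> src E ` U \<subseteq> K)"

text \<open>Every open subset of a sufficiently small neighbourhood is a chart, so those members of
  a countable base that are charts cover the edge space.\<close>

lemma charts_exist: "\<exists>Ch :: nat \<Rightarrow> 'e set. (\<forall>i. chart (Ch i)) \<and> (\<Union>i. Ch i) = topspace E1"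
proof -
  have chartI: "chart B" if U: "openin E1 U" "openin V0 (src E ` U)"
      "homeomorphic_map (subtopology E1 U) (subtopology V0 (src E ` U)) (src E)"
      and B: "openin E1 B" "B \<subseteq> U" "\<exists>K. compactin V0 K \<and> src E ` B \<subseteq> K" for U B
  proof -
    have Ut: "U \<subseteq> topspace E1" "src E ` U \<subseteq> topspace V0" using U openin_subset by auto
    have inj: "inj_on (src E) U"
      using homeomorphic_imp_injective_map[OF U(3)] Ut by (simp add: Int_absorb1)
    have "openin (subtopology E1 U) B" using B by (simp add: openin_open_subtopology U(1))
    then have "openin (subtopology V0 (src E ` U)) (src E ` B)"
      using homeomorphic_imp_open_map[OF U(3)] by (simp add: open_map_def)
    then have oB: "openin V0 (src E ` B)" using U(2) openin_trans_full by blast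
    obtain g where g: "homeomorphic_maps (subtopology E1 U) (subtopology V0 (src E ` U)) (src E) g"
      using U(3) homeomorphic_map_maps by blast
    then have gc: "continuous_map (subtopology V0 (src E ` U)) E1 g"
      by (auto simp: homeomorphic_maps_def continuous_map_in_subtopology)
    have ginv: "g (src E x) = x" if "x \<in> U" for x
      using g that Ut by (auto simp: homeomorphic_maps_def)
    have "subtopology (subtopology V0 (src E ` U)) (src E ` B) = subtopology V0 (src E ` B)"
      using B(2) by (simp add: subtopology_subtopology Int_absorb1 image_mono)
    then have "continuous_map (subtopology V0 (src E ` B)) E1 g"
      using continuous_map_from_subtopology[OF gc, of "src E ` B"] by simp
    then have "continuous_map (subtopology V0 (src E ` B)) E1 (inv_into B (src E))"
    proof (rule continuous_map_eq)
      fix v assume "v \<in> topspace (subtopology V0 (src E ` B))"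
      then obtain x where x: "x \<in> B" "v = src E x" by auto
      then show "g v = inv_into B (src E) v"
        using ginv[of x] B(2) inv_into_f_f[OF inj_on_subset[OF inj B(2)] x(1)] by auto
    qed
    then show ?thesis
      unfolding chart_def using B oB inj_on_subset[OF inj B(2)] by blast
  qed
  have small: "\<exists>U. openin E1 U \<and> e \<in> U \<and> (\<forall>B. openin E1 B \<and> B \<subseteq> U \<longrightarrow> chart B)"
    if e: "e \<in> topspace E1" for e
  proof -
    obtain U where U: "openin E1 U" "e \<in> U" "openin V0 (src E ` U)"
      "homeomorphic_map (subtopology E1 U) (subtopology V0 (src E ` U)) (src E)"
      using local_homeomorphism_src e unfolding local_homeomorphism_def by meson
    obtain W K where W: "openin V0 W" "compactin V0 K" "src E e \<in> W" "W \<subseteq> K"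
      using locally_compact_V0 src_in[OF e] unfolding locally_compact_space_def by meson
    define U' where "U' = U \<inter> {x \<in> topspace E1. src E x \<in> W}"
    have "openin E1 U'"
      unfolding U'_def using U(1) openin_continuous_map_preimage[OF continuous_src W(1)] by blast
    moreover have "e \<in> U'" using U(2) W(3) e by (simp add: U'_def)
    moreover have "chart B" if "openin E1 B" "B \<subseteq> U'" for B
      using that W(2,4) by (intro chartI[OF U(1,3,4)]) (auto simp: U'_def)
    ultimately show ?thesis by blast
  qed
  obtain \<B> where \<B>: "countable \<B>" "\<And>B. B \<in> \<B> \<Longrightarrow> openin E1 B"
    "\<And>U x. openin E1 U \<Longrightarrow> x \<in> U \<Longrightarrow> \<exists>B\<in>\<B>. x \<in> B \<and> B \<subseteq> U"
    using second_countable_E1 unfolding second_countable_def by metis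
  \<comment> \<open>Adding the empty chart keeps the family nonempty, hence enumerable by
    \<open>from_nat_into\<close>, even if there are no edges.\<close>
  have empty: "chart {}"
    unfolding chart_def by (auto simp: continuous_map_on_empty intro!: exI[of _ "{}"])
  define \<G> where "\<G> = insert {} {B \<in> \<B>. chart B}"
  have G: "countable \<G>" "\<G> \<noteq> {}" using \<B>(1) by (auto simp: \<G>_def)
  have "\<Union>\<G> = topspace E1"
  proof (intro subset_antisym subsetI)
    fix x assume "x \<in> \<Union>\<G>"
    then show "x \<in> topspace E1" using \<B>(2) openin_subset by (fastforce simp: \<G>_def)
  next
    fix x assume "x \<in> topspace E1"
    then obtain U where U: "openin E1 U" "x \<in> U" "\<forall>B. openin E1 B \<and> B \<subseteq> U \<longrightarrow> chart B"
      using small by blast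
    then obtain B where "B \<in> \<B>" "x \<in> B" "B \<subseteq> U" using \<B>(3) by blast
    then show "x \<in> \<Union>\<G>" using U(3) \<B>(2) by (auto simp: \<G>_def)
  qed
  moreover have "range (from_nat_into \<G>) = \<G>" using G by (intro range_from_nat_into) auto
  moreover have "chart B" if "B \<in> \<G>" for B using that empty by (auto simp: \<G>_def)
  ultimately show ?thesis by (intro exI[of _ "from_nat_into \<G>"]) (metis rangeI)
qed

end

section \<open>Inverse branches of the shift\<close>

locale charted_graph = embedded_graph E \<theta> for E :: "('v, 'e) graph" and \<theta> +
  fixes Ch :: "nat \<Rightarrow> 'e set"
  assumes chart: "\<And>i. chart (Ch i)" and Ch_cover: "(\<Union>i. Ch i) = topspace E1"
begin

abbreviation "D \<equiv> disjointed Ch"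

definition sec :: "nat \<Rightarrow> 'v \<Rightarrow> 'e" where
  "sec i = inv_into (Ch i) (src E)"

lemma Ch_open: "openin E1 (Ch i)" and Ch_inj: "inj_on (src E) (Ch i)"
  and Ch_image: "openin V0 (src E ` Ch i)" and Ch_compact: "\<exists>K. compactin V0 K \<and> src E ` Ch i \<subseteq> K"
  and sec_continuous: "continuous_map (subtopology V0 (src E ` Ch i)) E1 (sec i)"
  using chart[of i] by (auto simp: chart_def sec_def)

lemma Ch_subset: "Ch i \<subseteq> topspace E1" using Ch_cover by blast

lemma D_subset: "D i \<subseteq> Ch i" by (rule disjointed_subset)

lemma sec_src: "e \<in> Ch i \<Longrightarrow> sec i (src E e) = e"
  unfolding sec_def using Ch_inj by (rule inv_into_f_f)

lemma src_sec: "v \<in> src E ` Ch i \<Longrightarrow> src E (sec i v) = v"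
  unfolding sec_def by (rule f_inv_into_f)

lemma sec_in_D: "v \<in> src E ` D i \<Longrightarrow> sec i v \<in> D i"
  using sec_src D_subset by fastforce

lemma src_sec_D: "v \<in> src E ` D i \<Longrightarrow> src E (sec i v) = v"
  using src_sec D_subset by blast

lemma sec_E1: "v \<in> src E ` D i \<Longrightarrow> sec i v \<in> topspace E1"
  using sec_in_D D_subset Ch_subset by blast

lemma D_sets: "D i \<in> sets (borel_algebra E1)"
  unfolding disjointed_def using openin_borel_algebra[OF Ch_open]
  by (intro sets.Diff sets.finite_UN) auto

lemma src_image_eq: "B \<subseteq> Ch i \<Longrightarrow> src E ` B = {v \<in> src E ` Ch i. sec i v \<in> B}"
  using sec_src src_sec by fastforce

lemma src_image_sets:
  assumes "B \<in> sets (borel_algebra E1)" "B \<subseteq> Ch i"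
  shows "src E ` B \<in> sets (BV)"
proof -
  have o: "src E ` Ch i \<in> sets (BV)"
    using Ch_image by (rule openin_borel_algebra)
  have "sec i -` B \<inter> src E ` Ch i \<in> sets (borel_algebra (subtopology V0 (src E ` Ch i)))"
    using measurable_sets[OF continuous_map_measurable[OF sec_continuous] assms(1), of i]
      openin_subset[OF Ch_image[of i]] by (simp add: Int_absorb1)
  then have "sec i -` B \<inter> src E ` Ch i \<in> sets (BV)"
    by (simp add: borel_subtopology_sets[OF o])
  moreover have "src E ` B = sec i -` B \<inter> src E ` Ch i"
    using src_image_eq[OF assms(2)] by auto
  ultimately show ?thesis by simp
qed

lemma src_D_sets: "src E ` D i \<in> sets (BV)"
  using src_image_sets[OF D_sets D_subset] .

definition dom :: "nat \<Rightarrow> ('v, 'e) path set" where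
  "dom i = {a \<in> PP. path_range E a \<in> src E ` D i}"

text \<open>An inverse branch of the shift: on \<open>dom i\<close> it prepends the only edge of
  \<open>D i\<close> whose source is the range of the path.\<close>

definition ext :: "nat \<Rightarrow> ('v, 'e) path \<Rightarrow> ('v, 'e) path" where
  "ext i a = prep (sec i (path_range E a)) a"

definition pre :: "nat \<Rightarrow> nat \<Rightarrow> ('v, 'e) path set \<Rightarrow> ('v, 'e) path set" where
  "pre i n B = {b \<in> P n. path_range E b \<in> src E ` D i \<and> ext i b \<in> B}"

text \<open>The level-0 counterpart of \<open>pre\<close>: after prepending, only the range of the
  new edge is tested. As \<open>src_image_pre0\<close> shows, it is the set of sources of the edges
  in \<open>D i\<close> with range in \<open>B\<close>, which is how the transfer operator sees this
  branch.\<close>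

definition pre0 :: "nat \<Rightarrow> 'v set \<Rightarrow> 'v set" where
  "pre0 i B = {v \<in> src E ` D i. rng E (sec i v) \<in> B}"

lemma dom_PP: "a \<in> dom i \<Longrightarrow> a \<in> PP" by (simp add: dom_def)

lemma ext_props:
  assumes "a \<in> dom i"
  shows "ext i a \<in> PP" "ext i a \<in> BP \<longleftrightarrow> a \<in> BP" "shift E (ext i a) = a"
    "path_length (ext i a) = eSuc (path_length a)"
    "path_range E (ext i a) = rng E (sec i (path_range E a))"
proof -
  have a: "a \<in> PP" "path_range E a \<in> src E ` D i" using assms by (auto simp: dom_def)
  have s: "sec i (path_range E a) \<in> topspace E1" "src E (sec i (path_range E a)) = path_range E a"
    using a(2) sec_E1 src_sec_D by auto
  show "ext i a \<in> PP" "ext i a \<in> BP \<longleftrightarrow> a \<in> BP" "shift E (ext i a) = a"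
    "path_length (ext i a) = eSuc (path_length a)"
    "path_range E (ext i a) = rng E (sec i (path_range E a))"
    unfolding ext_def
    using prep_all[OF a(1) s] prep_boundary[OF a(1) s] shift_prep[OF a(1) s(2)] path_length_prep by auto
qed

lemma src_image_pre0: "src E ` (rng E -` B \<inter> topspace E1 \<inter> D i) = pre0 i B"
proof (intro set_eqI iffI)
  fix v assume "v \<in> src E ` (rng E -` B \<inter> topspace E1 \<inter> D i)"
  then obtain e where e: "v = src E e" "rng E e \<in> B" "e \<in> D i" by auto
  then show "v \<in> pre0 i B" using sec_src[of e i] D_subset[of i] by (auto simp: pre0_def)
next
  fix v assume "v \<in> pre0 i B"
  then have v: "v \<in> src E ` D i" "rng E (sec i v) \<in> B" by (auto simp: pre0_def)
  then have "sec i v \<in> rng E -` B \<inter> topspace E1 \<inter> D i" using sec_in_D sec_E1 by auto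
  with src_sec_D[OF v(1)] show "v \<in> src E ` (rng E -` B \<inter> topspace E1 \<inter> D i)" by (metis imageI)
qed

lemma pre0_sets:
  assumes "B \<in> sets (BV)"
  shows "pre0 i B \<in> sets (BV)"
proof -
  have "rng E -` B \<inter> topspace E1 \<in> sets (borel_algebra E1)"
    using measurable_sets[OF continuous_map_measurable[OF continuous_rng] assms] by simp
  then have "src E ` (rng E -` B \<inter> topspace E1 \<inter> D i) \<in> sets (BV)"
    using D_sets D_subset by (intro src_image_sets[of _ i]) auto
  then show ?thesis by (simp only: src_image_pre0)
qed

text \<open>Prepending is continuous on the open set of paths whose range lies in the image of the
  chart \<open>Ch i\<close>. The piece \<open>D i\<close> is merely Borel and is imposed
  afterwards.\<close>

lemma pre_sets:
  assumes B: "B \<in> sets (BF (Suc n))"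
  shows "pre i n B \<in> sets (BF n)"
proof -
  let ?O = "{b \<in> topspace (T n). path_range E b \<in> src E ` Ch i}"
  have oO: "openin (T n) ?O"
    using openin_continuous_map_preimage[OF continuous_range Ch_image] .
  then have O: "?O \<in> sets (BF n)" by (rule openin_borel_algebra)
  let ?Y = "subtopology (T n) ?O"
  have tY: "topspace ?Y = ?O" by auto
  have sc: "continuous_map ?Y E1 (\<lambda>b. sec i (path_range E b))"
  proof -
    have "continuous_map ?Y (subtopology V0 (src E ` Ch i)) (path_range E)"
      using continuous_range by (auto simp: continuous_map_in_subtopology continuous_map_from_subtopology)
    from continuous_map_compose[OF this sec_continuous] show ?thesis by (simp add: o_def)
  qed
  have extP: "ext i b \<in> P (Suc n)" if "b \<in> ?O" for b
  proof -
    have "src E (sec i (path_range E b)) = path_range E b" using that src_sec by blast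
    moreover have "sec i (path_range E b) \<in> topspace E1"
      using continuous_map_image_subset_topspace[OF sc] that tY by blast
    ultimately show ?thesis using that unfolding ext_def by (intro prep_paths) auto
  qed
  have "continuous_map ?Y (T (Suc n)) (ext i)"
  proof (rule continuous_into_TSuc)
    show "ext i \<in> topspace ?Y \<rightarrow> P (Suc n)" using extP tY by auto
    fix k assume k: "k \<le> n"
    show "continuous_map ?Y E1 (\<lambda>y. edge (ext i y) k)"
    proof (cases k)
      case 0
      show ?thesis
        by (rule continuous_map_eq[OF sc]) (auto simp: 0 ext_def edge_prep_0)
    next
      case (Suc l)
      then obtain m where m: "n = Suc m" using k by (cases n) auto
      show ?thesis
        by (rule continuous_map_eq[OF continuous_map_from_subtopology[OF continuous_edge[of l m, folded m]]])
          (use k Suc m in \<open>auto simp: ext_def paths_of_length_Suc\<close>)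
    qed
  qed
  from measurable_sets[OF continuous_map_measurable[OF this] B]
  have "ext i -` B \<inter> ?O \<in> sets (borel_algebra ?Y)" by (simp only: tY space_borel_algebra)
  then have "ext i -` B \<inter> ?O \<in> sets (BF n)"
    using borel_subtopology_sets[OF O] by blast
  moreover have "path_range E -` (src E ` D i) \<inter> P n \<in> sets (BF n)"
    using measurable_sets[OF continuous_map_measurable[OF continuous_range] src_D_sets[of i], of n] by simp
  moreover have "pre i n B = (ext i -` B \<inter> ?O) \<inter> (path_range E -` (src E ` D i) \<inter> P n)"
    using D_subset[of i] by (auto simp: pre_def)
  ultimately show ?thesis by auto
qed

lemma Vertex_image_sets:
  assumes "B \<in> sets (BV)"
  shows "Vertex ` B \<in> sets (BF 0)"
proof -
  have "the_vertex -` B \<inter> P 0 \<in> sets (BF 0)"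
    using measurable_sets[OF continuous_map_measurable[OF continuous_the_vertex] assms] by simp
  moreover have "the_vertex -` B \<inter> P 0 = Vertex ` B"
    using sets.sets_into_space[OF assms] by (auto simp: paths_of_length_0)
  ultimately show ?thesis by simp
qed

lemma Borel_T0: 
  assumes "B \<in> sets (BF 0)"
  obtains C where "C \<in> sets (BV)" "B = Vertex ` C"
proof -
  have "Vertex -` B \<inter> topspace V0 \<in> sets (BV)"
    using measurable_sets[OF continuous_map_measurable[OF continuous_Vertex] assms] by simp
  moreover have "B = Vertex ` (Vertex -` B \<inter> topspace V0)"
  proof (intro subset_antisym subsetI)
    fix b assume b: "b \<in> B"
    then obtain v where "v \<in> topspace V0" "b = Vertex v"
      using subsetD[OF Borel_T_subset[OF assms] b] by (auto simp: paths_of_length_0)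
    with b show "b \<in> Vertex ` (Vertex -` B \<inter> topspace V0)" by auto
  qed auto
  ultimately show thesis using that by blast
qed

lemma path_cylinder_0: "path_cylinder 0 (Vertex ` B) = {a \<in> PP. path_range E a \<in> B}"
  by (auto simp: path_cylinder_def zero_enat_def[symmetric])

lemma range_sets: "B \<in> sets (BV) \<Longrightarrow> {a \<in> PP. path_range E a \<in> B} \<in> sets path_algebra"
  using path_cylinder_sets[OF Vertex_image_sets] by (simp add: path_cylinder_0)

lemma dom_sets: "dom i \<in> sets path_algebra"
  unfolding dom_def using range_sets[OF src_D_sets] .

lemma ext_path_cylinder_0: "{a \<in> dom i. ext i a \<in> path_cylinder 0 (Vertex ` B)} = {a \<in> PP. path_range E a \<in> pre0 i B}"
  unfolding path_cylinder_0 using ext_props(1,5) by (auto simp: dom_def pre0_def)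

text \<open>Trades a condition on \<open>n + 1\<close> edges for one on \<open>n\<close> edges; all
  later inductions on the length of cylinders rest on it.\<close>

lemma ext_path_cylinder_Suc: "{a \<in> dom i. ext i a \<in> path_cylinder (Suc n) B} = path_cylinder n (pre i n B)"
proof -
  have "ext i a \<in> path_cylinder (Suc n) B \<longleftrightarrow> enat n \<le> path_length a \<and> initial E a n \<in> pre i n B"
    if a: "a \<in> dom i" for a
  proof (cases "enat n \<le> path_length a")
    case True
    have r: "path_range E (initial E a n) = path_range E a"
      using initial_initial[OF dom_PP[OF a] True, of 0] by simp
    have "initial E (ext i a) (Suc n) = ext i (initial E a n)"
      unfolding ext_def r using initial_prep[OF dom_PP[OF a] True] .
    then show ?thesis
      using a True r ext_props(1,4)[OF a] initial_in[OF dom_PP[OF a] True]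
      by (auto simp: path_cylinder_def pre_def dom_def eSuc_enat[symmetric])
  next
    case False
    then show ?thesis
      using ext_props(4)[OF a] by (auto simp: path_cylinder_def eSuc_enat[symmetric])
  qed
  moreover have "a \<in> dom i" if "a \<in> path_cylinder n (pre i n B)" for a
  proof -
    have a: "a \<in> PP" "enat n \<le> path_length a" "initial E a n \<in> pre i n B"
      using that by (auto simp: path_cylinder_def)
    have "path_range E (initial E a n) = path_range E a"
      using initial_initial[OF a(1,2), of 0] by simp
    then show ?thesis using a by (auto simp: dom_def pre_def)
  qed
  moreover have "a \<in> path_cylinder n (pre i n B) \<longleftrightarrow> enat n \<le> path_length a \<and> initial E a n \<in> pre i n B"
    if "a \<in> dom i" for a using dom_PP[OF that] by (simp add: path_cylinder_def)
  ultimately show ?thesis by blast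
qed

lemma ext_measurable: "ext i \<in> restrict_space path_algebra (dom i) \<rightarrow>\<^sub>M path_algebra"
proof -
  have sp: "space (restrict_space path_algebra (dom i)) = dom i"
    using sets.sets_into_space[OF dom_sets[of i]] by (simp add: space_restrict_space Int_absorb2)
  have "ext i \<in> restrict_space path_algebra (dom i) \<rightarrow>\<^sub>M sigma PP cylinders"
  proof (rule measurable_measure_of[OF cylinders_Pow])
    show "ext i \<in> space (restrict_space path_algebra (dom i)) \<rightarrow> PP"
      using ext_props(1) sp by auto
    fix S assume "S \<in> cylinders"
    then obtain n B where S: "S = path_cylinder n B" "B \<in> sets (BF n)"
      by (auto simp: cylinders_def)
    have "{a \<in> dom i. ext i a \<in> S} \<in> sets path_algebra"
    proof (cases n)
      case 0
      then obtain C where "C \<in> sets (BV)" "B = Vertex ` C"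
        using Borel_T0 S(2) by metis
      then show ?thesis using range_sets[OF pre0_sets] S(1) 0 by (simp add: ext_path_cylinder_0)
    next
      case (Suc m)
      then show ?thesis using path_cylinder_sets[OF pre_sets] S by (simp add: ext_path_cylinder_Suc)
    qed
    moreover have "ext i -` S \<inter> dom i = {a \<in> dom i. ext i a \<in> S}" by auto
    ultimately show "ext i -` S \<inter> space (restrict_space path_algebra (dom i)) \<in> sets (restrict_space path_algebra (dom i))"
      unfolding sp using dom_sets by (auto simp: sets_restrict_space_measurable)
  qed
  then show ?thesis by (simp add: path_algebra_def)
qed

lemma ext_sets:
  assumes "S \<in> sets path_algebra"
  shows "{a \<in> dom i. ext i a \<in> S} \<in> sets path_algebra"
proof -
  have sp: "space (restrict_space path_algebra (dom i)) = dom i"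
    using sets.sets_into_space[OF dom_sets[of i]] by (simp add: space_restrict_space Int_absorb2)
  have "ext i -` S \<inter> dom i \<in> sets (restrict_space path_algebra (dom i))"
    using measurable_sets[OF ext_measurable assms, of i] by (simp add: sp)
  then have "ext i -` S \<inter> dom i \<in> sets path_algebra"
    using dom_sets by (simp add: sets_restrict_space_measurable)
  moreover have "ext i -` S \<inter> dom i = {a \<in> dom i. ext i a \<in> S}" by auto
  ultimately show ?thesis by simp
qed

section \<open>Boundary paths of positive length\<close>

abbreviation "pos \<equiv> positive_boundary_paths E"

lemma pos_subset: "pos \<subseteq> BP" by (auto simp: positive_boundary_paths_def)

lemma pos_eq: "pos = path_cylinder 1 (P 1) \<inter> BP"
  using initial_in boundary_in_all by (auto simp: positive_boundary_paths_def path_cylinder_def one_enat_def)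

lemma pos_sets: "pos \<in> sets path_algebra"
  unfolding pos_eq using path_cylinder_sets[OF P_sets] boundary_path_algebra by auto

lemma open_first_edge:
  assumes "openin E1 U"
  shows "openin TB {a \<in> BP. 1 \<le> path_length a \<and> edge (initial E a 1) 0 \<in> U}"
proof -
  have o: "openin (T (Suc 0)) {b \<in> topspace (T (Suc 0)). edge b 0 \<in> U}"
    using openin_continuous_map_preimage[OF continuous_edge[of 0 0] assms] by simp
  have "cylinder E {b \<in> topspace (T (Suc 0)). edge b 0 \<in> U} =
      {a \<in> BP. 1 \<le> path_length a \<and> edge (initial E a 1) 0 \<in> U}"
    using initial_in[of _ "Suc 0"] boundary_in_all
    by (subst cylinder_paths[of _ "Suc 0"]) (auto simp: one_enat_def)
  then show ?thesis using openin_cylinder[OF openin_T_FT[OF o]] by simp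
qed

lemma openin_pos: "openin TB pos"
proof -
  have "pos = {a \<in> BP. 1 \<le> path_length a \<and> edge (initial E a 1) 0 \<in> topspace E1}"
    using paths_edge[of _ 0 0] initial_in[of _ "Suc 0"] boundary_in_all
    by (auto simp: positive_boundary_paths_def one_enat_def)
  then show ?thesis using open_first_edge[OF openin_topspace] by simp
qed

end

section \<open>Quasi-invariant and sub-invariant measures\<close>

lemma regular_measures_sets: "\<mu> \<in> regular_measures X \<Longrightarrow> sets \<mu> = sets (borel_algebra X)"
  by (simp add: regular_measures_def borel_measures_def)

lemma regular_measures_space: "\<mu> \<in> regular_measures X \<Longrightarrow> space \<mu> = topspace X"
  using sets_eq_imp_space_eq[OF regular_measures_sets] by fastforce

lemma regular_measures_finite: "\<mu> \<in> regular_measures X \<Longrightarrow> compactin X K \<Longrightarrow> emeasure \<mu> K < \<infinity>"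
  by (simp add: regular_measures_def)

lemma convex_comb_regular:
  fixes \<theta> :: "'v \<Rightarrow> 'p::polish_space"
  assumes emb: "std_embedding X \<theta>" "relatively_compact_cover X" and \<mu>: "\<mu> \<in> regular_measures X" "\<nu> \<in> regular_measures X"
  shows "convex_comb t \<mu> \<nu> \<in> regular_measures X"
proof (rule regular_measuresI[OF emb])
  show "convex_comb t \<mu> \<nu> \<in> borel_measures X"
    using regular_measures_sets[OF \<mu>(1)] by (simp add: borel_measures_def)
  fix K assume K: "compactin X K"
  have "emeasure (convex_comb t \<mu> \<nu>) K = ennreal t * emeasure \<mu> K + ennreal (1 - t) * emeasure \<nu> K"
    using std_embedding_compact_sets[OF emb(1) K] regular_measures_sets \<mu> by (intro emeasure_convex_comb) auto
  also have "\<dots> < \<infinity>"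
    using regular_measures_finite[OF \<mu>(1) K] regular_measures_finite[OF \<mu>(2) K]
    by (simp add: ennreal_mult_less_top)
  finally show "emeasure (convex_comb t \<mu> \<nu>) K < \<infinity>" .
qed

lemma suminf_convex_comb:
  fixes f g :: "nat \<Rightarrow> ennreal"
  shows "(\<Sum>i. c * f i + d * g i) = c * (\<Sum>i. f i) + d * (\<Sum>i. g i)"
  by (simp add: suminf_add[symmetric] ennreal_suminf_cmult)

context charted_graph
begin

text \<open>Closed as the complement of a basic open set, and contained in the preimage of the
  compact set of ranges of edges in \<open>K\<close>, which is compact by properness.\<close>

lemma compactin_first_edge:
  assumes K: "compactin E1 K"
  shows "compactin TB {a \<in> BP. 1 \<le> path_length a \<and> edge (initial E a 1) 0 \<in> K}"
proof -
  let ?S = "{a \<in> BP. 1 \<le> path_length a \<and> edge (initial E a 1) 0 \<in> K}"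
  have "compactin (T (Suc 0)) {b \<in> P (Suc 0). \<forall>k\<le>0. edge b k \<in> K}"
    using K by (intro compactin_box)
  then have "compactin (T (Suc 0)) {b \<in> P (Suc 0). edge b 0 \<in> K}" by simp
  from openin_compl_cylinder[OF compactin_T_FT[OF this]]
  have "openin TB (BP - cylinder E {b \<in> P (Suc 0). edge b 0 \<in> K})" .
  moreover have S: "cylinder E {b \<in> P (Suc 0). edge b 0 \<in> K} = ?S"
    using initial_in[of _ "Suc 0"] boundary_in_all
    by (subst cylinder_paths[of _ "Suc 0"]) (auto simp: one_enat_def)
  ultimately have cl: "closedin TB ?S"
    by (auto simp: closedin_def)
  have "compactin TB {a \<in> BP. path_range E a \<in> rng E ` K}"
    using compactin_range_preimage[OF image_compactin[OF K continuous_rng]] .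
  moreover have "?S \<subseteq> {a \<in> BP. path_range E a \<in> rng E ` K}"
  proof
    fix a assume a: "a \<in> ?S"
    then have aP: "a \<in> PP" "enat (Suc 0) \<le> path_length a"
      using boundary_in_all by (auto simp: one_enat_def)
    have "rng E (edge (initial E a 1) 0) = path_range E a"
      using path_source_initial[of "initial E a 1" 0] initial_in[OF aP] initial_initial[OF aP, of 0]
      by simp
    with a show "a \<in> {a \<in> BP. path_range E a \<in> rng E ` K}" by force
  qed
  ultimately show ?thesis using cl closed_compactin by blast
qed

abbreviation "PT \<equiv> positive_boundary_topology E"

lemma PT_eq: "PT = subtopology TB pos"
  by (simp add: positive_boundary_topology_def)

lemma topspace_PT [simp]: "topspace PT = pos"
  using pos_subset by (auto simp: PT_eq)

lemma std_embedding_PT: "std_embedding PT \<Psi>"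
  unfolding PT_eq by (rule std_embedding_subtopology[OF std_embedding_boundary openin_pos])

lemma openin_PT: "openin TB U \<Longrightarrow> U \<subseteq> pos \<Longrightarrow> openin PT U"
  unfolding PT_eq by (auto simp: openin_subtopology)

lemma first_edge_pos: "{a \<in> BP. 1 \<le> path_length a \<and> edge (initial E a 1) 0 \<in> U} \<subseteq> pos"
  by (auto simp: positive_boundary_paths_def)

lemma first_edge_E1:
  assumes "a \<in> pos" shows "edge (initial E a 1) 0 \<in> topspace E1"
  using assms paths_edge[of _ 0 0] initial_in[of a "Suc 0"] boundary_in_all
  by (auto simp: positive_boundary_paths_def one_enat_def)

text \<open>A compact set of boundary paths may meet \<open>pos\<close> in a non-compact set.
  Confining the first edge to a compact set yields compact sets that lie inside
  \<open>pos\<close>.\<close>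

lemma relatively_compact_cover_PT: "relatively_compact_cover PT"
proof -
  obtain W K where W: "\<And>n::nat. openin E1 (W n)" "\<And>n. compactin E1 (K n)" "\<And>n. W n \<subseteq> K n"
    "(\<Union>n. W n) = topspace E1"
    using relatively_compact_coverE[OF relatively_compact_cover_E1] by metis
  show ?thesis
    unfolding relatively_compact_cover_def
  proof (rule exI[of _ "\<lambda>n. {a \<in> BP. 1 \<le> path_length a \<and> edge (initial E a 1) 0 \<in> W n}"],
      intro conjI allI)
    fix n
    show "openin PT {a \<in> BP. 1 \<le> path_length a \<and> edge (initial E a 1) 0 \<in> W n}"
      by (rule openin_PT[OF open_first_edge[OF W(1)] first_edge_pos])
    have "compactin PT {a \<in> BP. 1 \<le> path_length a \<and> edge (initial E a 1) 0 \<in> K n}"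
      unfolding PT_eq compactin_subtopology
      using compactin_first_edge[OF W(2)] first_edge_pos by blast
    then show "\<exists>C. compactin PT C \<and> {a \<in> BP. 1 \<le> path_length a \<and> edge (initial E a 1) 0 \<in> W n} \<subseteq> C"
      using W(3)[of n] by (intro exI[of _ "{a \<in> BP. 1 \<le> path_length a \<and> edge (initial E a 1) 0 \<in> K n}"]) auto
  next
    have "\<exists>n. edge (initial E a 1) 0 \<in> W n" if "a \<in> pos" for a
      using first_edge_E1[OF that] W(4) by blast
    then show "(\<Union>n. {a \<in> BP. 1 \<le> path_length a \<and> edge (initial E a 1) 0 \<in> W n}) = topspace PT"
      by (auto simp: positive_boundary_paths_def)
  qed
qed

lemma PT_sets: "B \<in> sets (borel_algebra PT) \<longleftrightarrow> B \<in> sets path_algebra \<and> B \<subseteq> pos"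
  unfolding PT_eq using borel_subtopology_sets[OF openin_borel_algebra[OF openin_pos]] boundary_sets pos_subset
  by blast

definition path_chart :: "nat \<Rightarrow> ('v, 'e) path set" where
  "path_chart i = {a \<in> BP. 1 \<le> path_length a \<and> edge (initial E a 1) 0 \<in> Ch i}"

lemma disjointed_path_chart:
  "disjointed path_chart i = {a \<in> BP. 1 \<le> path_length a \<and> edge (initial E a 1) 0 \<in> D i}"
  by (auto simp: disjointed_def path_chart_def)

lemma first_edge_prep:
  assumes "a \<in> PP" shows "edge (initial E (prep e a) 1) 0 = e"
proof -
  have "enat 0 \<le> path_length a" by (simp add: zero_enat_def[symmetric])
  then have "initial E (prep e a) (Suc 0) = prep e (initial E a 0)" "initial E a 0 \<in> P 0"
    using initial_prep[OF assms, of 0] initial_in[OF assms, of 0] by auto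
  then show ?thesis using edge_prep_0 by simp
qed

text \<open>Images under the shift become preimages under the measurable branches, which yields both
  the measurability of these images and the summands of the pullback.\<close>

lemma shift_image:
  assumes B: "B \<subseteq> pos"
  shows "shift E ` (B \<inter> disjointed path_chart i) = {a \<in> dom i. ext i a \<in> B}"
proof (intro subset_antisym subsetI)
  fix y assume "y \<in> shift E ` (B \<inter> disjointed path_chart i)"
  then obtain x where x: "x \<in> B" "x \<in> disjointed path_chart i" "y = shift E x" by auto
  then have "x \<in> PP" "1 \<le> path_length x" using boundary_in_all by (auto simp: disjointed_path_chart)
  then obtain e a where a: "a \<in> PP" "e \<in> topspace E1" "src E e = path_range E a" "x = prep e a"
    by (rule prep_decompose)
  have e: "e \<in> D i" using x(2) first_edge_prep[OF a(1)] a(4) by (simp add: disjointed_path_chart)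
  then have "sec i (path_range E a) = e" using sec_src D_subset a(3) by (metis subsetD)
  then have "ext i a = x" using a(4) by (simp add: ext_def)
  moreover have "a \<in> dom i" using a(1) e a(3)[symmetric] by (simp add: dom_def)
  moreover have "y = a" using x(3) a shift_prep by simp
  ultimately show "y \<in> {a \<in> dom i. ext i a \<in> B}" using x(1) by simp
next
  fix a assume "a \<in> {a \<in> dom i. ext i a \<in> B}"
  then have a: "a \<in> dom i" "ext i a \<in> B" by auto
  then have "ext i a \<in> pos" using B by blast
  moreover have "edge (initial E (ext i a) 1) 0 \<in> D i"
    unfolding ext_def first_edge_prep[OF dom_PP[OF a(1)]]
    using a(1) by (intro sec_in_D) (simp add: dom_def)
  ultimately have "ext i a \<in> B \<inter> disjointed path_chart i"
    using a(2) by (auto simp: disjointed_path_chart positive_boundary_paths_def)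
  then show "a \<in> shift E ` (B \<inter> disjointed path_chart i)"
    using ext_props(3)[OF a(1)] by (metis imageI)
qed

lemma path_chart_cover: "(\<Union>i. path_chart i) = pos"
proof
  show "pos \<subseteq> (\<Union>i. path_chart i)"
  proof
    fix a assume a: "a \<in> pos"
    then have "edge (initial E a 1) 0 \<in> (\<Union>i. Ch i)"
      using first_edge_E1 unfolding Ch_cover by blast
    with a show "a \<in> (\<Union>i. path_chart i)" by (auto simp: path_chart_def positive_boundary_paths_def)
  qed
qed (auto simp: path_chart_def positive_boundary_paths_def)

lemma pullback_shift:
  assumes \<nu>: "\<nu> \<in> regular_measures TB"
  shows "sets (pullback_measure PT TB (shift E) \<nu>) = sets (borel_algebra PT)"
    and "\<And>B. B \<in> sets path_algebra \<Longrightarrow> B \<subseteq> pos \<Longrightarrow>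
      emeasure (pullback_measure PT TB (shift E) \<nu>) B =
      (\<Sum>i. emeasure \<nu> {a \<in> dom i. ext i a \<in> B})"
proof -
  have dec: "\<exists>e a. a \<in> PP \<and> e \<in> Ch i \<and> src E e = path_range E a \<and> x = prep e a \<and> shift E x = a \<and> a \<in> BP"
    if x: "x \<in> path_chart i" for x i
  proof -
    have "x \<in> PP" "1 \<le> path_length x" "x \<in> BP" using x boundary_in_all by (auto simp: path_chart_def)
    then obtain e a where a: "a \<in> PP" "e \<in> topspace E1" "src E e = path_range E a" "x = prep e a"
      using prep_decompose by blast
    then show ?thesis
      using x first_edge_prep[OF a(1)] shift_prep[OF a(1,3)] prep_boundary[OF a(1-3)] \<open>x \<in> BP\<close>
      by (intro exI[of _ e] exI[of _ a]) (auto simp: path_chart_def)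
  qed
  have BM: "\<nu> \<in> borel_measures TB"
    using \<nu> by (simp add: regular_measures_def)
  have open': "openin PT (path_chart i)" for i
    unfolding path_chart_def by (rule openin_PT[OF open_first_edge[OF Ch_open] first_edge_pos])
  have inj': "inj_on (shift E) (path_chart i)" for i
  proof (rule inj_onI)
    fix x y assume xy: "x \<in> path_chart i" "y \<in> path_chart i" "shift E x = shift E y"
    obtain e a where a: "e \<in> Ch i" "src E e = path_range E a" "x = prep e a" "shift E x = a"
      using dec[OF xy(1)] by blast
    obtain d b where b: "d \<in> Ch i" "src E d = path_range E b" "y = prep d b" "shift E y = b"
      using dec[OF xy(2)] by blast
    have "a = b" using a(4) b(4) xy(3) by simp
    moreover from this have "e = d" using a b Ch_inj[of i] by (metis inj_onD)
    ultimately show "x = y" using a(3) b(3) by simp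
  qed
  have comp': "\<exists>K. compactin TB K \<and> shift E ` path_chart i \<subseteq> K" for i
  proof -
    \<comment> \<open>The shifted path has as range the source of the removed edge, so its range
      stays in a compact set and properness applies.\<close>
    obtain K where K: "compactin V0 K" "src E ` Ch i \<subseteq> K" using Ch_compact by blast
    have "shift E ` path_chart i \<subseteq> {a \<in> BP. path_range E a \<in> K}"
      using dec[of _ i] K(2) by (smt (verit, ccfv_SIG) image_subset_iff mem_Collect_eq)
    then show ?thesis using compactin_range_preimage[OF K(1)] by blast
  qed
  have img': "shift E ` B \<in> sets (BB)" if B: "B \<in> sets (borel_algebra PT)" for B
  proof -
    have Bp: "B \<in> sets path_algebra" "B \<subseteq> pos" using B PT_sets by auto
    have "B \<inter> (\<Union>i. disjointed path_chart i) = B"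
      unfolding UN_disjointed_eq using Bp(2) path_chart_cover by (simp add: Int_absorb2)
    then have "shift E ` B = shift E ` (B \<inter> (\<Union>i. disjointed path_chart i))" by simp
    also have "\<dots> = (\<Union>i. shift E ` (B \<inter> disjointed path_chart i))" by auto
    also have "\<dots> = (\<Union>i. {a \<in> dom i. ext i a \<in> B})" using shift_image[OF Bp(2)] by simp
    also have "\<dots> \<in> sets (BB)"
    proof -
      have "{a \<in> dom i. ext i a \<in> B} \<in> sets (BB)" for i
        using ext_sets[OF Bp(1)] boundary_sets ext_props(2) Bp(2) pos_subset by blast
      then show ?thesis by (intro sets.countable_UN) auto
    qed
    finally show ?thesis .
  qed
  have cover: "(\<Union>i. path_chart i) = topspace PT" by (simp add: path_chart_cover)
  note form = pullback_measure_formula[where X = PT and Y = TB and f = "shift E"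
      and \<mu> = \<nu> and Ch = path_chart, OF std_embedding_PT relatively_compact_cover_PT BM _ _ open' cover inj' comp']
  show "sets (pullback_measure PT TB (shift E) \<nu>) = sets (borel_algebra PT)"
    by (rule regular_measures_sets, rule form(1))
      (use regular_measures_finite[OF \<nu>] std_embedding_compact_sets[OF std_embedding_boundary] img' in blast)+
  fix B assume B: "B \<in> sets path_algebra" "B \<subseteq> pos"
  then have "B \<in> sets (borel_algebra PT)" using PT_sets by blast
  then have "emeasure (pullback_measure PT TB (shift E) \<nu>) B =
      (\<Sum>i. emeasure \<nu> (shift E ` (B \<inter> disjointed path_chart i)))"
    by (rule form(2)[rotated 3])
      (use regular_measures_finite[OF \<nu>] std_embedding_compact_sets[OF std_embedding_boundary] img' in blast)+
  then show "emeasure (pullback_measure PT TB (shift E) \<nu>) B =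
      (\<Sum>i. emeasure \<nu> {a \<in> dom i. ext i a \<in> B})"
    by (simp add: shift_image[OF B(2)])
qed

text \<open>The working form of quasi-invariance: countable sums over branches on measurable sets of
  paths, linear in the measure, with the definite description of the pullback eliminated.\<close>

lemma quasi_invariant_iff:
  "\<nu> \<in> quasi_invariant_measures E \<beta> \<longleftrightarrow> \<nu> \<in> regular_measures TB \<and>
     (\<forall>B\<in>sets path_algebra. B \<subseteq> pos \<longrightarrow>
        (\<Sum>i. emeasure \<nu> {a \<in> dom i. ext i a \<in> B}) = ennreal (exp \<beta>) * emeasure \<nu> B)"
proof -
  have "pullback_measure PT TB (shift E) \<nu> =
      scale_measure (ennreal (exp \<beta>)) (restrict_space \<nu> pos) \<longleftrightarrow>
     (\<forall>B\<in>sets path_algebra. B \<subseteq> pos \<longrightarrow>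
        (\<Sum>i. emeasure \<nu> {a \<in> dom i. ext i a \<in> B}) = ennreal (exp \<beta>) * emeasure \<nu> B)" (is "?L \<longleftrightarrow> ?R")
    if \<nu>: "\<nu> \<in> regular_measures TB"
  proof -
    have s\<nu>: "sets \<nu> = sets BB" and sp\<nu>: "space \<nu> = BP"
      using regular_measures_sets[OF \<nu>] regular_measures_space[OF \<nu>] by auto
    have pos\<nu>: "pos \<in> sets \<nu>" using pos_sets pos_subset boundary_sets s\<nu> by blast
    have rs: "emeasure (scale_measure (ennreal (exp \<beta>)) (restrict_space \<nu> pos)) B =
        ennreal (exp \<beta>) * emeasure \<nu> B" if "B \<subseteq> pos" for B
      using that pos\<nu> by (simp add: emeasure_restrict_space sets.Int_space_eq2)
    have "sets (restrict_space \<nu> pos) = sets (borel_algebra PT)"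
      using s\<nu> boundary_sets pos_subset pos\<nu>
      by (intro set_eqI) (auto simp: sets_restrict_space_measurable PT_sets)
    then have sR: "sets (scale_measure (ennreal (exp \<beta>)) (restrict_space \<nu> pos)) = sets (borel_algebra PT)"
      by simp
    show ?thesis
    proof
      assume ?L
      show ?R
      proof (intro ballI impI)
        fix B assume B: "B \<in> sets path_algebra" "B \<subseteq> pos"
        show "(\<Sum>i. emeasure \<nu> {a \<in> dom i. ext i a \<in> B}) = ennreal (exp \<beta>) * emeasure \<nu> B"
          unfolding pullback_shift(2)[OF \<nu> B, symmetric] \<open>?L\<close> using rs[OF B(2)] .
      qed
    next
      assume R: ?R
      show ?L
      proof (rule measure_eqI)
        fix B assume "B \<in> sets (pullback_measure PT TB (shift E) \<nu>)"
        then have "B \<in> sets path_algebra" "B \<subseteq> pos" using pullback_shift(1)[OF \<nu>] PT_sets by auto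
        then show "emeasure (pullback_measure PT TB (shift E) \<nu>) B =
            emeasure (scale_measure (ennreal (exp \<beta>)) (restrict_space \<nu> pos)) B"
          using pullback_shift(2)[OF \<nu>] rs R by simp
      qed (simp only: sR pullback_shift(1)[OF \<nu>])
    qed
  qed
  then show ?thesis unfolding quasi_invariant_measures_def by blast
qed

text \<open>The pullback along the source map sums over the pieces \<open>D i\<close> the measure of
  the set of sources, and pushing forward restricts to edges with range in \<open>B\<close>; these
  sources form \<open>pre0 i B\<close>.\<close>

lemma transfer_formula:
  assumes \<mu>: "\<mu> \<in> regular_measures V0"
  shows "sets (transfer E \<mu>) = sets (BV)"
    and "\<And>B. B \<in> sets (BV) \<Longrightarrow>
      emeasure (transfer E \<mu>) B = (\<Sum>i. emeasure \<mu> (pre0 i B))"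
proof -
  obtain \<theta>E :: "'e \<Rightarrow> nat \<Rightarrow> real" where \<theta>E: "std_embedding E1 \<theta>E" using std_embedding_E1 by blast
  have BM: "\<mu> \<in> borel_measures V0" using \<mu> by (simp add: regular_measures_def)
  let ?\<nu> = "pullback_measure E1 V0 (src E) \<mu>"
  note form = pullback_measure_formula[where X = E1 and Y = V0 and f = "src E"
      and \<mu> = \<mu> and Ch = Ch, OF \<theta>E relatively_compact_cover_E1 BM _ _ Ch_open Ch_cover Ch_inj Ch_compact]
  have form1: "?\<nu> \<in> regular_measures E1"
    by (rule form(1))
      (use regular_measures_finite[OF \<mu>] compact_V0_sets src_image_sets in blast)+
  have form2: "emeasure ?\<nu> B = (\<Sum>i. emeasure \<mu> (src E ` (B \<inter> D i)))"
    if "B \<in> sets (borel_algebra E1)" for B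
    using that by (rule form(2)[rotated 3])
      (use regular_measures_finite[OF \<mu>] compact_V0_sets src_image_sets in blast)+
  have s: "sets ?\<nu> = sets (borel_algebra E1)" and sp: "space ?\<nu> = topspace E1"
    using regular_measures_sets[OF form1] regular_measures_space[OF form1] by auto
  show "sets (transfer E \<mu>) = sets (BV)"
    by (simp add: transfer_def pushforward_def)
  fix B assume B: "B \<in> sets (BV)"
  have rm: "rng E \<in> ?\<nu> \<rightarrow>\<^sub>M BV"
    using continuous_map_measurable[OF continuous_rng] by (simp add: measurable_cong_sets[OF s refl])
  have m: "rng E -` B \<inter> topspace E1 \<in> sets (borel_algebra E1)"
    using measurable_sets[OF rm B] s sp by simp
  have "emeasure (transfer E \<mu>) B = emeasure ?\<nu> (rng E -` B \<inter> topspace E1)"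
    unfolding transfer_def pushforward_def using rm B by (simp add: emeasure_distr sp)
  also have "\<dots> = (\<Sum>i. emeasure \<mu> (src E ` (rng E -` B \<inter> topspace E1 \<inter> D i)))"
    using form2[OF m] by simp
  also have "\<dots> = (\<Sum>i. emeasure \<mu> (pre0 i B))"
    by (simp only: src_image_pre0)
  finally show "emeasure (transfer E \<mu>) B = (\<Sum>i. emeasure \<mu> (pre0 i B))" .
qed

section \<open>The pushforward along the range map\<close>

abbreviation "push \<equiv> pushforward V0 (path_range E)"

lemma range_boundary_sets: "B \<in> sets (BV) \<Longrightarrow> {a \<in> BP. path_range E a \<in> B} \<in> sets BB"
proof -
  assume "B \<in> sets (BV)"
  then have "path_range E -` B \<inter> BP \<in> sets BB"
    using measurable_sets[OF continuous_map_measurable[OF continuous_boundary_range]] by simp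
  moreover have "path_range E -` B \<inter> BP = {a \<in> BP. path_range E a \<in> B}" by auto
  ultimately show ?thesis by simp
qed

lemma push_emeasure:
  assumes s: "sets \<nu> = sets BB" and B: "B \<in> sets (BV)"
  shows "emeasure (push \<nu>) B = emeasure \<nu> {a \<in> BP. path_range E a \<in> B}"
proof -
  have "path_range E \<in> \<nu> \<rightarrow>\<^sub>M BV"
    using continuous_map_measurable[OF continuous_boundary_range] by (simp add: measurable_cong_sets[OF s refl])
  moreover have "path_range E -` B \<inter> space \<nu> = {a \<in> BP. path_range E a \<in> B}"
    using sets_eq_imp_space_eq[OF s] by auto
  ultimately show ?thesis using B by (simp add: pushforward_def emeasure_distr)
qed

lemma sets_push [simp]: "sets (push \<nu>) = sets (BV)"
  by (simp add: pushforward_def)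

lemma push_regular:
  assumes \<nu>: "\<nu> \<in> regular_measures TB"
  shows "push \<nu> \<in> regular_measures V0"
proof -
  obtain \<theta>V :: "'v \<Rightarrow> nat \<Rightarrow> real" where \<theta>V: "std_embedding V0 \<theta>V" using std_embedding_V0 by blast
  show ?thesis
  proof (rule regular_measuresI[OF \<theta>V relatively_compact_cover_V0])
    fix K assume K: "compactin V0 K"
    show "emeasure (push \<nu>) K < \<infinity>"
      using push_emeasure[OF regular_measures_sets[OF \<nu>] compact_V0_sets[OF K]]
        regular_measures_finite[OF \<nu> compactin_range_preimage[OF K]] by simp
  qed (simp add: borel_measures_def)
qed

text \<open>A boundary path of length 0 is a singular vertex, so a path with regular range has at
  least one edge.\<close>

lemma range_regular_pos:
  assumes "B \<subseteq> regular_vertices E" "a \<in> BP" "path_range E a \<in> B"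
  shows "a \<in> pos"
proof (rule ccontr)
  assume "a \<notin> pos"
  then have "path_length a = 0" using assms(2) by (auto simp: positive_boundary_paths_def not_le enat_0_iff iless_eSuc0 one_eSuc)
  moreover from boundary_in_all[OF assms(2)] have "a \<in> P 0"
    by (cases rule: all_paths_cases) (use calculation in \<open>auto simp: enat_0_iff\<close>)
  ultimately obtain v where v: "a = Vertex v" by (auto simp: paths_of_length_0)
  then have "v \<in> singular_vertices E"
    using assms(2) by (auto simp: boundary_paths_def infinite_paths_def)
  then show False using v assms by (auto simp: singular_vertices_def)
qed

text \<open>Applied to the paths of positive length with range in \<open>B\<close>, quasi-invariance
  identifies the transferred measure of \<open>B\<close> with exp \<beta> times their mass. The
  inequality leaves out the paths of length 0; over regular vertices there are none.\<close>

lemma push_sub_invariant: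
  assumes \<nu>: "\<nu> \<in> quasi_invariant_measures E \<beta>"
  shows "push \<nu> \<in> sub_invariant_measures E \<beta>"
proof -
  have reg: "\<nu> \<in> regular_measures TB"
    and q: "\<And>B. B \<in> sets path_algebra \<Longrightarrow> B \<subseteq> pos \<Longrightarrow>
        (\<Sum>i. emeasure \<nu> {a \<in> dom i. ext i a \<in> B}) = ennreal (exp \<beta>) * emeasure \<nu> B"
    using \<nu> quasi_invariant_iff by auto
  have s: "sets \<nu> = sets BB" using regular_measures_sets[OF reg] .
  have tr: "emeasure (transfer E (push \<nu>)) B = ennreal (exp \<beta>) * emeasure \<nu> (pos \<inter> {a \<in> BP. path_range E a \<in> B})"
    if B: "B \<in> sets (BV)" for B
  proof -
    let ?S = "pos \<inter> {a \<in> BP. path_range E a \<in> B}"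
    have S: "?S \<in> sets path_algebra" using range_boundary_sets[OF B] boundary_sets pos_sets by blast
    have "{a \<in> BP. path_range E a \<in> pre0 i B} = {a \<in> dom i. ext i a \<in> ?S}" for i
    proof (intro set_eqI iffI)
      fix a assume a: "a \<in> {a \<in> BP. path_range E a \<in> pre0 i B}"
      then have d: "a \<in> dom i" using boundary_in_all by (auto simp: pre0_def dom_def)
      show "a \<in> {a \<in> dom i. ext i a \<in> ?S}"
        using a d ext_props(2,4,5)[OF d] by (auto simp: pre0_def positive_boundary_paths_def one_eSuc)
    next
      fix a assume "a \<in> {a \<in> dom i. ext i a \<in> ?S}"
      then show "a \<in> {a \<in> BP. path_range E a \<in> pre0 i B}"
        using ext_props(2,5)[of a i] by (auto simp: pre0_def dom_def)
    qed
    then have "emeasure (push \<nu>) (pre0 i B) = emeasure \<nu> {a \<in> dom i. ext i a \<in> ?S}" for i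
      using push_emeasure[OF s pre0_sets[OF B]] by simp
    then show ?thesis
      using transfer_formula(2)[OF push_regular[OF reg] B] q[OF S] by simp
  qed
  show ?thesis
    unfolding sub_invariant_measures_def mem_Collect_eq
  proof (intro conjI ballI impI)
    show "push \<nu> \<in> regular_measures V0" using push_regular[OF reg] .
    fix B assume B: "B \<in> sets (BV)"
    have "emeasure \<nu> (pos \<inter> {a \<in> BP. path_range E a \<in> B}) \<le> emeasure \<nu> {a \<in> BP. path_range E a \<in> B}"
      using range_boundary_sets[OF B] s by (intro emeasure_mono) auto
    then show "emeasure (transfer E (push \<nu>)) B \<le> ennreal (exp \<beta>) * emeasure (push \<nu>) B"
      unfolding tr[OF B] push_emeasure[OF s B] by (rule mult_left_mono) simp
    assume "B \<subseteq> regular_vertices E"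
    then have "pos \<inter> {a \<in> BP. path_range E a \<in> B} = {a \<in> BP. path_range E a \<in> B}"
      using range_regular_pos by blast
    then show "emeasure (transfer E (push \<nu>)) B = ennreal (exp \<beta>) * emeasure (push \<nu>) B"
      unfolding tr[OF B] push_emeasure[OF s B] by simp
  qed
qed

section \<open>Injectivity of the pushforward\<close>

lemma measure_eq_path_algebra:
  assumes s: "sets N = sets path_algebra" "sets N' = sets path_algebra"
    and eq: "\<And>n B. B \<in> sets (BF n) \<Longrightarrow> emeasure N (path_cylinder n B) = emeasure N' (path_cylinder n B)"
    and fin: "\<And>K. compactin V0 K \<Longrightarrow> emeasure N {a \<in> PP. path_range E a \<in> K} < \<infinity>"
  shows "N = N'"
proof -
  obtain W K where W: "\<And>n::nat. openin V0 (W n)" "\<And>n. compactin V0 (K n)" "\<And>n. W n \<subseteq> K n"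
    "(\<Union>n. W n) = topspace V0"
    using relatively_compact_coverE[OF relatively_compact_cover_V0] by metis
  show ?thesis
  proof (rule measure_eqI_generator_eq[OF cylinders_Int_stable cylinders_Pow])
    show "sets N = sigma_sets PP cylinders" "sets N' = sigma_sets PP cylinders"
      using s sets_path_algebra by auto
    show "emeasure N X = emeasure N' X" if "X \<in> cylinders" for X
      using that eq by (auto simp: cylinders_def)
    show "range (\<lambda>n. path_cylinder 0 (Vertex ` W n)) \<subseteq> cylinders"
      using Vertex_image_sets[OF openin_borel_algebra[OF W(1)]] by (auto simp: cylinders_def)
    show "(\<Union>n. path_cylinder 0 (Vertex ` W n)) = PP"
      unfolding path_cylinder_0 using path_range_all W(4) by blast
    fix n
    have "emeasure N (path_cylinder 0 (Vertex ` W n)) \<le> emeasure N {a \<in> PP. path_range E a \<in> K n}"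
      unfolding path_cylinder_0 using W(3) range_sets[OF compact_V0_sets[OF W(2)]] s
      by (intro emeasure_mono) auto
    then show "emeasure N (path_cylinder 0 (Vertex ` W n)) \<noteq> \<infinity>"
      using fin[OF W(2)[of n]] by (auto simp: top_unique)
  qed
qed

text \<open>Extension by zero from the boundary to all paths, so that measures on the boundary can
  be evaluated on cylinders of \<open>path_algebra\<close>.\<close>

definition incl :: "('v, 'e) path measure \<Rightarrow> ('v, 'e) path measure" where
  "incl \<nu> = distr \<nu> path_algebra (\<lambda>a. a)"

lemma incl:
  assumes s: "sets \<nu> = sets BB"
  shows "sets (incl \<nu>) = sets path_algebra" "\<And>S. S \<in> sets path_algebra \<Longrightarrow> emeasure (incl \<nu>) S = emeasure \<nu> (S \<inter> BP)"
proof -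
  have "(\<lambda>a. a) \<in> \<nu> \<rightarrow>\<^sub>M path_algebra"
    using boundary_inclusion_measurable by (simp add: measurable_cong_sets[OF s refl])
  moreover have "space \<nu> = BP" using sets_eq_imp_space_eq[OF s] by simp
  ultimately show "\<And>S. S \<in> sets path_algebra \<Longrightarrow> emeasure (incl \<nu>) S = emeasure \<nu> (S \<inter> BP)"
    by (simp add: incl_def emeasure_distr)
qed (simp add: incl_def)

lemma quasi_cylinder_Suc:
  assumes \<nu>: "\<nu> \<in> quasi_invariant_measures E \<beta>" and B: "B \<in> sets (BF (Suc n))"
  shows "ennreal (exp \<beta>) * emeasure (incl \<nu>) (path_cylinder (Suc n) B) =
    (\<Sum>i. emeasure (incl \<nu>) (path_cylinder n (pre i n B)))"
proof -
  have reg: "\<nu> \<in> regular_measures TB"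
    and q: "\<And>B. B \<in> sets path_algebra \<Longrightarrow> B \<subseteq> pos \<Longrightarrow>
        (\<Sum>i. emeasure \<nu> {a \<in> dom i. ext i a \<in> B}) = ennreal (exp \<beta>) * emeasure \<nu> B"
    using \<nu> quasi_invariant_iff by auto
  have s: "sets \<nu> = sets BB" using regular_measures_sets[OF reg] .
  let ?S = "path_cylinder (Suc n) B \<inter> BP"
  have S: "?S \<in> sets path_algebra" using path_cylinder_sets[OF B] boundary_path_algebra by auto
  have "?S \<subseteq> pos"
    by (auto simp: path_cylinder_def positive_boundary_paths_def one_enat_def intro: order_trans[of _ "enat (Suc n)"])
  note qS = q[OF S this]
  have pz: "{a \<in> dom i. ext i a \<in> ?S} = path_cylinder n (pre i n B) \<inter> BP" for i
  proof -
    have "{a \<in> dom i. ext i a \<in> ?S} = {a \<in> dom i. ext i a \<in> path_cylinder (Suc n) B} \<inter> BP"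
      using ext_props(2) by blast
    then show ?thesis by (simp add: ext_path_cylinder_Suc)
  qed
  show ?thesis
    using qS[unfolded pz, symmetric] incl(2)[OF s] path_cylinder_sets[OF B] path_cylinder_sets[OF pre_sets[OF B]] by simp
qed

lemma push_inj: "inj_on push (quasi_invariant_measures E \<beta>)"
proof (rule inj_onI)
  fix \<nu> \<nu>' assume \<nu>: "\<nu> \<in> quasi_invariant_measures E \<beta>" and \<nu>': "\<nu>' \<in> quasi_invariant_measures E \<beta>"
    and eq: "push \<nu> = push \<nu>'"
  have reg: "\<nu> \<in> regular_measures TB" "\<nu>' \<in> regular_measures TB"
    using \<nu> \<nu>' quasi_invariant_iff by auto
  have s: "sets \<nu> = sets BB" "sets \<nu>' = sets BB" using regular_measures_sets reg by auto
  \<comment> \<open>Cylinders of level 0 are preimages under the range map, where the two measures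
    agree by assumption; this starts the induction.\<close>
  have r0: "emeasure (incl \<nu>) {a \<in> PP. path_range E a \<in> B} = emeasure (push \<nu>) B"
    if "B \<in> sets (BV)" "sets \<nu> = sets BB" for B \<nu>
  proof -
    have "{a \<in> PP. path_range E a \<in> B} \<inter> BP = {a \<in> BP. path_range E a \<in> B}" using boundary_in_all by auto
    then show ?thesis using incl(2)[OF that(2) range_sets[OF that(1)]] push_emeasure[OF that(2,1)] by simp
  qed
  have "emeasure (incl \<nu>) (path_cylinder n B) = emeasure (incl \<nu>') (path_cylinder n B)"
    if "B \<in> sets (BF n)" for n B
    using that
  proof (induction n arbitrary: B)
    case 0
    then obtain C where "C \<in> sets (BV)" "B = Vertex ` C" by (rule Borel_T0)
    then show ?case using r0 s eq by (simp add: path_cylinder_0)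
  next
    case (Suc n)
    have "ennreal (exp \<beta>) * emeasure (incl \<nu>) (path_cylinder (Suc n) B) =
        ennreal (exp \<beta>) * emeasure (incl \<nu>') (path_cylinder (Suc n) B)"
      unfolding quasi_cylinder_Suc[OF \<nu> Suc.prems] quasi_cylinder_Suc[OF \<nu>' Suc.prems]
      using Suc.IH[OF pre_sets[OF Suc.prems]] by simp
    then show ?case by (simp add: ennreal_mult_cancel_left)
  qed
  moreover have "emeasure (incl \<nu>) {a \<in> PP. path_range E a \<in> K} < \<infinity>" if K: "compactin V0 K" for K
  proof -
    show ?thesis
      using r0[OF compact_V0_sets[OF K] s(1)] regular_measures_finite[OF push_regular[OF reg(1)] K] by simp
  qed
  ultimately have i: "incl \<nu> = incl \<nu>'"
    using measure_eq_path_algebra[of "incl \<nu>" "incl \<nu>'"] incl(1)[OF s(1)] incl(1)[OF s(2)] by blast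
  show "\<nu> = \<nu>'"
  proof (rule measure_eqI)
    fix B assume "B \<in> sets \<nu>"
    then have "B \<in> sets path_algebra" "B \<inter> BP = B" using s boundary_sets by auto
    then show "emeasure \<nu> B = emeasure \<nu>' B"
      using incl(2)[OF s(1), of B] incl(2)[OF s(2), of B] i by simp
  qed (simp add: s)
qed

end

section \<open>Construction of the quasi-invariant measure\<close>

locale sub_invariant = charted_graph E \<theta> Ch for E :: "('v, 'e) graph" and \<theta> Ch +
  fixes \<beta> :: real and \<mu> :: "'v measure"
  assumes \<mu>: "\<mu> \<in> sub_invariant_measures E \<beta>"
begin

abbreviation "\<kappa> \<equiv> ennreal (exp (- \<beta>))"

lemma \<mu>_regular: "\<mu> \<in> regular_measures V0"
  and transfer_le: "B \<in> sets BV \<Longrightarrow> emeasure (transfer E \<mu>) B \<le> ennreal (exp \<beta>) * emeasure \<mu> B"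
  and transfer_eq: "B \<in> sets BV \<Longrightarrow> B \<subseteq> regular_vertices E \<Longrightarrow>
    emeasure (transfer E \<mu>) B = ennreal (exp \<beta>) * emeasure \<mu> B"
  using \<mu> by (auto simp: sub_invariant_measures_def)

lemma sets_\<mu>: "sets \<mu> = sets BV" and space_\<mu>: "space \<mu> = topspace V0"
  using regular_measures_sets[OF \<mu>_regular] regular_measures_space[OF \<mu>_regular] by auto

lemma exp_\<kappa>: "ennreal (exp \<beta>) * \<kappa> = 1" "\<kappa> * ennreal (exp \<beta>) = 1"
  by (simp_all add: ennreal_mult[symmetric] exp_minus)

lemma cover_V0:
  obtains W where "\<And>n::nat. W n \<in> sets BV" "\<And>n. emeasure \<mu> (W n) < \<infinity>" "(\<Union>n. W n) = topspace V0"
proof -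
  obtain W K where W: "\<And>n::nat. openin V0 (W n)" "\<And>n. compactin V0 (K n)" "\<And>n. W n \<subseteq> K n"
    "(\<Union>n. W n) = topspace V0"
    using relatively_compact_coverE[OF relatively_compact_cover_V0] by metis
  have "emeasure \<mu> (W n) < \<infinity>" for n
  proof -
    have "emeasure \<mu> (W n) \<le> emeasure \<mu> (K n)"
      using W(3) compact_V0_sets[OF W(2)] sets_\<mu> by (intro emeasure_mono) auto
    then show ?thesis using regular_measures_finite[OF \<mu>_regular W(2)[of n]] by simp
  qed
  then show thesis using that[of W] W(1,4) openin_borel_algebra by blast
qed

lemma sigma_finite_\<mu>: "sigma_finite_measure \<mu>"
proof -
  obtain W where W: "\<And>n::nat. W n \<in> sets BV" "\<And>n. emeasure \<mu> (W n) < \<infinity>" "(\<Union>n. W n) = topspace V0"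
    using cover_V0 by blast
  show ?thesis
  proof
    have "emeasure \<mu> a \<noteq> \<infinity>" if "a \<in> range W" for a
      using that W(2) by (auto simp: less_top)
    then show "\<exists>A. countable A \<and> A \<subseteq> sets \<mu> \<and> \<Union> A = space \<mu> \<and> (\<forall>a\<in>A. emeasure \<mu> a \<noteq> \<infinity>)"
      using W(1,3) sets_\<mu> space_\<mu> by (intro exI[of _ "range W"]) auto
  qed
qed

lemma \<kappa>_transfer_le:
  assumes "B \<in> sets BV"
  shows "\<kappa> * emeasure (transfer E \<mu>) B \<le> emeasure \<mu> B"
proof -
  have "\<kappa> * emeasure (transfer E \<mu>) B \<le> \<kappa> * (ennreal (exp \<beta>) * emeasure \<mu> B)"
    using transfer_le[OF assms] by (rule mult_left_mono) simp
  also have "\<dots> = emeasure \<mu> B" by (simp add: mult.assoc[symmetric] exp_\<kappa>)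
  finally show ?thesis .
qed

lemma defect_exists:
  "\<exists>\<eta>. sets \<eta> = sets BV \<and> (\<forall>B\<in>sets BV. emeasure \<mu> B = emeasure \<eta> B + \<kappa> * emeasure (transfer E \<mu>) B)"
  using measure_difference_exists[OF sigma_finite_\<mu>, of "scale_measure \<kappa> (transfer E \<mu>)"]
    transfer_formula(1)[OF \<mu>_regular] \<kappa>_transfer_le sets_\<mu> by simp

text \<open>In the end this is the mass that the constructed measure gives to the boundary paths of
  length 0.\<close>

definition \<eta> :: "'v measure" where
  "\<eta> = (SOME \<eta>. sets \<eta> = sets BV \<and>
     (\<forall>B\<in>sets BV. emeasure \<mu> B = emeasure \<eta> B + \<kappa> * emeasure (transfer E \<mu>) B))"

lemma sets_\<eta>: "sets \<eta> = sets BV"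
  and \<mu>_decomp: "B \<in> sets BV \<Longrightarrow> emeasure \<mu> B = emeasure \<eta> B + \<kappa> * (\<Sum>i. emeasure \<mu> (pre0 i B))"
  using someI_ex[OF defect_exists] transfer_formula(2)[OF \<mu>_regular] unfolding \<eta>_def[symmetric] by auto

lemma regular_sets: "regular_vertices E \<in> sets BV"
  using openin_regular_vertices by (rule openin_borel_algebra)

lemma \<eta>_regular: "emeasure \<eta> (regular_vertices E) = 0"
proof -
  obtain W where W: "\<And>n::nat. W n \<in> sets BV" "\<And>n. emeasure \<mu> (W n) < \<infinity>" "(\<Union>n. W n) = topspace V0"
    using cover_V0 by blast
  \<comment> \<open>Equality on regular vertices only says that a value is unchanged by adding that
    of \<open>\<eta>\<close>. Cancelling needs finite measure, hence the cut with
    \<open>W n\<close>.\<close>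
  have z: "emeasure \<eta> (regular_vertices E \<inter> W n) = 0" for n
  proof -
    let ?B = "regular_vertices E \<inter> W n"
    have B: "?B \<in> sets BV" using regular_sets W(1) by auto
    have fin: "emeasure \<mu> ?B < \<infinity>"
      using W(2)[of n] emeasure_mono[of ?B "W n" \<mu>] W(1)[of n] sets_\<mu> by (auto simp: less_top top_unique)
    have "\<kappa> * emeasure (transfer E \<mu>) ?B = emeasure \<mu> ?B"
      using transfer_eq[OF B] by (simp add: mult.assoc[symmetric] exp_\<kappa>)
    then have "emeasure \<mu> ?B = emeasure \<eta> ?B + emeasure \<mu> ?B"
      using \<mu>_decomp[OF B] transfer_formula(2)[OF \<mu>_regular B] by simp
    then have "emeasure \<mu> ?B + 0 = emeasure \<mu> ?B + emeasure \<eta> ?B"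
      by (simp add: add.commute)
    with fin show ?thesis by (metis ennreal_add_left_cancel infinity_ennreal_def less_irrefl)
  qed
  have "regular_vertices E = (\<Union>n. regular_vertices E \<inter> W n)"
    using W(3) sets.sets_into_space[OF regular_sets] by auto
  moreover have "emeasure \<eta> (\<Union>n. regular_vertices E \<inter> W n) = 0"
    using z regular_sets W(1) sets_\<eta> by (intro emeasure_UN_eq_0) auto
  ultimately show ?thesis by simp
qed

section \<open>The iteration and its invariants\<close>

definition G :: "('v, 'e) path measure \<Rightarrow> ('v, 'e) path measure" where
  "G \<Lambda> = measure_of PP (sets path_algebra) (\<lambda>S. emeasure \<eta> {v \<in> topspace V0. Vertex v \<in> S} +
     \<kappa> * (\<Sum>i. emeasure \<Lambda> {a \<in> dom i. ext i a \<in> S}))"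

lemma sets_G [simp]: "sets (G \<Lambda>) = sets path_algebra"
  unfolding G_def using sets.sigma_sets_eq[of path_algebra] sets.space_closed[of path_algebra] by (simp add: sets_measure_of)

lemma Vertex_vimage_sets: "S \<in> sets path_algebra \<Longrightarrow> {v \<in> topspace V0. Vertex v \<in> S} \<in> sets BV"
proof -
  have "Vertex \<in> BV \<rightarrow>\<^sub>M sigma PP cylinders"
  proof (rule measurable_measure_of[OF cylinders_Pow])
    show "Vertex \<in> space BV \<rightarrow> PP" using paths_in_all[OF Vertex_in] by auto
    fix S assume "S \<in> cylinders"
    then obtain n B where S: "S = path_cylinder n B" "B \<in> sets (BF n)"
      by (auto simp: cylinders_def)
    show "Vertex -` S \<inter> space BV \<in> sets BV"
    proof (cases n)
      case 0
      then obtain C where C: "C \<in> sets BV" "B = Vertex ` C" using S(2) Borel_T0 by metis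
      have "Vertex -` S \<inter> space BV = C"
        using sets.sets_into_space[OF C(1)] paths_in_all[OF Vertex_in] unfolding S(1) 0 C(2) path_cylinder_0 by auto
      then show ?thesis using C(1) by simp
    next
      case (Suc m)
      then have "Vertex -` S \<inter> space BV = {}" by (auto simp: S(1) path_cylinder_def zero_enat_def)
      then show ?thesis by simp
    qed
  qed
  moreover assume "S \<in> sets path_algebra"
  ultimately have "Vertex -` S \<inter> topspace V0 \<in> sets BV"
    unfolding path_algebra_def[symmetric] using measurable_sets[of Vertex BV path_algebra S] by simp
  moreover have "Vertex -` S \<inter> topspace V0 = {v \<in> topspace V0. Vertex v \<in> S}" by auto
  ultimately show ?thesis by simp
qed

lemma emeasure_G:
  assumes \<Lambda>: "sets \<Lambda> = sets path_algebra" and S: "S \<in> sets path_algebra"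
  shows "emeasure (G \<Lambda>) S = emeasure \<eta> {v \<in> topspace V0. Vertex v \<in> S} +
     \<kappa> * (\<Sum>i. emeasure \<Lambda> {a \<in> dom i. ext i a \<in> S})"
  unfolding G_def
proof (rule emeasure_measure_of_sigma)
  show "sigma_algebra PP (sets path_algebra)"
    using sets.sigma_algebra_axioms[of path_algebra] by simp
  show "countably_additive (sets path_algebra) (\<lambda>S. emeasure \<eta> {v \<in> topspace V0. Vertex v \<in> S} +
     \<kappa> * (\<Sum>i. emeasure \<Lambda> {a \<in> dom i. ext i a \<in> S}))"
    using Vertex_vimage_sets ext_sets \<Lambda> sets_\<eta>
    by (intro countably_additive_plus countably_additive_suminf countably_additive_vimage) auto
qed (use S in \<open>auto simp: positive_def\<close>)

text \<open>The defect is precisely what the prepended paths lack, so the distribution of the range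
  is \<mu> at every stage.\<close>

lemma G_range:
  assumes \<Lambda>: "sets \<Lambda> = sets path_algebra" and B: "B \<in> sets BV"
    and eq: "\<And>C. C \<in> sets BV \<Longrightarrow> emeasure \<Lambda> {a \<in> PP. path_range E a \<in> C} = emeasure \<mu> C"
  shows "emeasure (G \<Lambda>) {a \<in> PP. path_range E a \<in> B} = emeasure \<mu> B"
proof -
  have "{v \<in> topspace V0. Vertex v \<in> {a \<in> PP. path_range E a \<in> B}} = B"
    using sets.sets_into_space[OF B] paths_in_all[OF Vertex_in] by auto
  moreover have "{a \<in> dom i. ext i a \<in> {a \<in> PP. path_range E a \<in> B}} = {a \<in> PP. path_range E a \<in> pre0 i B}" for i
    using ext_path_cylinder_0[of i B] by (simp add: path_cylinder_0)
  ultimately show ?thesis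
    using emeasure_G[OF \<Lambda> range_sets[OF B]] eq[OF pre0_sets[OF B]] \<mu>_decomp[OF B] by simp
qed

lemma G_cylinder_Suc:
  assumes \<Lambda>: "sets \<Lambda> = sets path_algebra" and B: "B \<in> sets (BF (Suc n))"
  shows "emeasure (G \<Lambda>) (path_cylinder (Suc n) B) = \<kappa> * (\<Sum>i. emeasure \<Lambda> (path_cylinder n (pre i n B)))"
proof -
  have e: "{v \<in> topspace V0. Vertex v \<in> path_cylinder (Suc n) B} = {}"
    by (auto simp: path_cylinder_def zero_enat_def)
  show ?thesis
    using emeasure_G[OF \<Lambda> path_cylinder_sets[OF B], unfolded e] by (simp add: ext_path_cylinder_Suc)
qed

text \<open>\<open>\<Lambda> n\<close> is the distribution of the first \<open>n\<close> edges of a boundary path; up to a null set, its paths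
  of length less than \<open>n\<close> have ended at a singular vertex.\<close>

definition \<Lambda> :: "nat \<Rightarrow> ('v, 'e) path measure" where
  "\<Lambda> n = (G ^^ n) (distr \<mu> path_algebra Vertex)"

lemma \<Lambda>_Suc: "\<Lambda> (Suc n) = G (\<Lambda> n)"
  by (simp add: \<Lambda>_def)

lemma sets_\<Lambda>: "sets (\<Lambda> n) = sets path_algebra"
  by (cases n) (simp_all add: \<Lambda>_def)

lemma space_\<Lambda>: "space (\<Lambda> n) = PP"
  using sets_eq_imp_space_eq[OF sets_\<Lambda>] by simp

lemma \<Lambda>_0: "S \<in> sets path_algebra \<Longrightarrow> emeasure (\<Lambda> 0) S = emeasure \<mu> {v \<in> topspace V0. Vertex v \<in> S}"
proof -
  assume S: "S \<in> sets path_algebra"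
  have "Vertex \<in> \<mu> \<rightarrow>\<^sub>M path_algebra"
  proof (rule measurableI)
    show "Vertex v \<in> space path_algebra" if "v \<in> space \<mu>" for v
      using that paths_in_all[OF Vertex_in] space_\<mu> by auto
    fix S assume "S \<in> sets path_algebra"
    moreover have "Vertex -` S \<inter> space \<mu> = {v \<in> topspace V0. Vertex v \<in> S}" using space_\<mu> by auto
    ultimately show "Vertex -` S \<inter> space \<mu> \<in> sets \<mu>" using Vertex_vimage_sets sets_\<mu> by simp
  qed
  moreover have "Vertex -` S \<inter> space \<mu> = {v \<in> topspace V0. Vertex v \<in> S}" using space_\<mu> by auto
  ultimately show ?thesis using S by (simp add: \<Lambda>_def emeasure_distr)
qed

lemma \<Lambda>_range: "B \<in> sets BV \<Longrightarrow> emeasure (\<Lambda> n) {a \<in> PP. path_range E a \<in> B} = emeasure \<mu> B"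
proof (induction n arbitrary: B)
  case 0
  have "{v \<in> topspace V0. Vertex v \<in> {a \<in> PP. path_range E a \<in> B}} = B"
    using sets.sets_into_space[OF 0] paths_in_all[OF Vertex_in] by auto
  then show ?case using \<Lambda>_0[OF range_sets[OF 0]] by simp
next
  case (Suc n)
  show ?case unfolding \<Lambda>_Suc by (rule G_range[OF sets_\<Lambda> Suc.prems Suc.IH])
qed

text \<open>On cylinders of level \<open>k + 1\<close> the map \<open>G\<close> sees its argument
  only on level \<open>k\<close>, and on level 0 every stage gives \<mu>; so stage \<open>k\<close>
  has already fixed level \<open>k\<close>.\<close>

lemma \<Lambda>_cylinder_consistent:
  assumes "B \<in> sets (BF k)" "k \<le> n" "k \<le> m"
  shows "emeasure (\<Lambda> m) (path_cylinder k B) = emeasure (\<Lambda> n) (path_cylinder k B)"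
  using assms
proof (induction k arbitrary: n m B)
  case 0
  then obtain C where "C \<in> sets BV" "B = Vertex ` C" using Borel_T0 by metis
  then show ?case using \<Lambda>_range by (simp add: path_cylinder_0)
next
  case (Suc k)
  then obtain n' m' where nm: "n = Suc n'" "m = Suc m'" "k \<le> n'" "k \<le> m'"
    by (metis Suc_le_D Suc_le_mono)
  show ?case
    unfolding nm(1,2) \<Lambda>_Suc G_cylinder_Suc[OF sets_\<Lambda> Suc.prems(1)]
    using Suc.IH[OF pre_sets[OF Suc.prems(1)] nm(3,4)] by simp
qed

text \<open>The finite paths of length \<open>n\<close> that are not boundary paths.\<close>

definition regular_end :: "nat \<Rightarrow> ('v, 'e) path set" where
  "regular_end n = {a \<in> P n. path_source E a \<in> regular_vertices E}"

lemma source_regular_sets: "{b \<in> P n. path_source E b \<in> regular_vertices E} \<in> sets (BF n)"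
  using openin_borel_algebra[OF openin_continuous_map_preimage[OF continuous_source openin_regular_vertices, of n]]
  by simp

lemma regular_end_sets: "regular_end n \<in> sets path_algebra"
proof -
  have "regular_end n = path_cylinder n {b \<in> P n. path_source E b \<in> regular_vertices E} - path_cylinder (Suc n) (P (Suc n))"
  proof (intro set_eqI iffI)
    fix a assume "a \<in> regular_end n"
    then show "a \<in> path_cylinder n {b \<in> P n. path_source E b \<in> regular_vertices E} - path_cylinder (Suc n) (P (Suc n))"
      by (auto simp: regular_end_def path_cylinder_def paths_in_all path_length_paths initial_self)
  next
    fix a assume a: "a \<in> path_cylinder n {b \<in> P n. path_source E b \<in> regular_vertices E} - path_cylinder (Suc n) (P (Suc n))"
    then have aP: "a \<in> PP" "enat n \<le> path_length a" "\<not> enat (Suc n) \<le> path_length a"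
      using initial_in by (auto simp: path_cylinder_def)
    then have "path_length a = enat n" by (cases "path_length a") auto
    with aP(1) have "a \<in> P n" by (cases rule: all_paths_cases) auto
    with a show "a \<in> regular_end n" by (auto simp: regular_end_def path_cylinder_def initial_self)
  qed
  then show ?thesis using path_cylinder_sets[OF source_regular_sets] path_cylinder_sets[OF P_sets] by auto
qed

text \<open>A path of positive length ending at a regular vertex arises from a shorter one with the
  same end at the previous stage; a path of length 0 is charged only by \<open>\<eta>\<close>, which
  ignores regular vertices. The strict bound matters: at stage \<open>m\<close> the paths of length
  \<open>m\<close> have not yet been continued.\<close>

lemma regular_end_null: "n < m \<Longrightarrow> emeasure (\<Lambda> m) (regular_end n) = 0"
proof (induction m arbitrary: n)
  case (Suc m)
  have "{v \<in> topspace V0. Vertex v \<in> regular_end n} \<subseteq> regular_vertices E"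
    by (cases n) (auto simp: regular_end_def paths_of_length_0 paths_of_length_Suc)
  then have 1: "emeasure \<eta> {v \<in> topspace V0. Vertex v \<in> regular_end n} = 0"
    using \<eta>_regular emeasure_mono[of _ "regular_vertices E" \<eta>] regular_sets sets_\<eta> by (metis le_zero_eq)
  have 2: "emeasure (\<Lambda> m) {a \<in> dom i. ext i a \<in> regular_end n} = 0" for i
  proof (cases n)
    case 0
    have "ext i a \<notin> regular_end n" if "a \<in> dom i" for a
    proof
      assume "ext i a \<in> regular_end n"
      then have "path_length (ext i a) = 0" using 0 path_length_paths by (fastforce simp: regular_end_def zero_enat_def)
      then show False using ext_props(4)[OF that] by simp
    qed
    then have e: "{a \<in> dom i. ext i a \<in> regular_end n} = {}" by blast
    show ?thesis unfolding e by simp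
  next
    case (Suc n')
    have "{a \<in> dom i. ext i a \<in> regular_end n} \<subseteq> regular_end n'"
    proof
      fix a assume "a \<in> {a \<in> dom i. ext i a \<in> regular_end n}"
      then have a: "a \<in> dom i" "ext i a \<in> P (Suc n')" "path_source E (ext i a) \<in> regular_vertices E"
        using Suc by (auto simp: regular_end_def)
      have "eSuc (path_length a) = enat (Suc n')"
        using ext_props(4)[OF a(1)] path_length_paths[OF a(2)] by simp
      then have l: "path_length a = enat n'" by (metis eSuc_enat eSuc_inject)
      from dom_PP[OF a(1)] have aP: "a \<in> P n'" by (cases rule: all_paths_cases) (use l in auto)
      have "path_source E (ext i a) = path_source E a"
      proof (cases n')
        case 0
        then obtain v where "a = Vertex v" using aP by (auto simp: paths_of_length_0)
        then show ?thesis using a(1) src_sec_D by (simp add: ext_def dom_def)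
      next
        case (Suc l)
        then show ?thesis using aP by (auto simp: ext_def paths_of_length_Suc)
      qed
      then show "a \<in> regular_end n'" using a(3) aP by (simp add: regular_end_def)
    qed
    then have "emeasure (\<Lambda> m) {a \<in> dom i. ext i a \<in> regular_end n} \<le> emeasure (\<Lambda> m) (regular_end n')"
      using regular_end_sets sets_\<Lambda> by (intro emeasure_mono) auto
    also have "\<dots> = 0" using Suc.prems Suc by (intro Suc.IH) simp
    finally show ?thesis by simp
  qed
  show ?case unfolding \<Lambda>_Suc emeasure_G[OF sets_\<Lambda> regular_end_sets] using 1 2 by simp
qed simp

section \<open>The limit measure on sequences\<close>

abbreviation "\<Omega> \<equiv> PiM UNIV (\<lambda>_::nat. borel :: (nat \<Rightarrow> real) measure)"

lemma sets_\<Omega>: "sets \<Omega> = sets borel"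
  by (rule sets_PiM_equal_borel)

lemma \<Psi>_measurable_\<Omega>: "\<Psi> \<in> \<Lambda> n \<rightarrow>\<^sub>M \<Omega>"
  using \<Psi>_measurable by (simp add: measurable_cong_sets[OF sets_\<Lambda> sets_\<Omega>])

lemma restrict_vimage:
  assumes "S \<in> sets (PiM {..n} (\<lambda>_. borel :: (nat \<Rightarrow> real) measure))"
  shows "(\<lambda>x. restrict x {..n}) -` S \<in> sets \<Omega>"
proof -
  have "(\<lambda>x. restrict x {..n}) \<in> \<Omega> \<rightarrow>\<^sub>M PiM {..n} (\<lambda>_. borel)"
    by (rule measurable_restrict_subset) simp
  from measurable_sets[OF this assms] show ?thesis by (simp add: space_PiM)
qed

text \<open>The first \<open>n + 1\<close> coordinates are measurable for the sigma-algebra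
  generated by the cylinders of level at most \<open>n\<close>. The two stages agree on these
  cylinders, which are closed under intersection, hence on all events in these coordinates.\<close>

lemma \<Lambda>_consistent:
  assumes nm: "n \<le> m" and S: "S \<in> sets (PiM {..n} (\<lambda>_. borel :: (nat \<Rightarrow> real) measure))"
  shows "emeasure (distr (\<Lambda> m) \<Omega> \<Psi>) ((\<lambda>x. restrict x {..n}) -` S) =
    emeasure (distr (\<Lambda> n) \<Omega> \<Psi>) ((\<lambda>x. restrict x {..n}) -` S)"
proof -
  define C where "C = {path_cylinder k B |k B. k \<le> n \<and> B \<in> sets (BF k)}"
  have C_cyl: "C \<subseteq> cylinders" by (auto simp: C_def cylinders_def)
  then have C_Pow: "C \<subseteq> Pow PP" using cylinders_Pow by blast
  have C_Int: "Int_stable C"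
  proof (rule Int_stableI)
    fix X Y assume "X \<in> C" "Y \<in> C"
    then obtain k l B B' where XY: "X = path_cylinder k B" "Y = path_cylinder l B'" "k \<le> n" "l \<le> n"
      "B \<in> sets (BF k)" "B' \<in> sets (BF l)"
      by (auto simp: C_def)
    show "X \<inter> Y \<in> C"
    proof (cases "k \<le> l")
      case True
      then show ?thesis using path_cylinder_Int[OF True XY(5,6)] XY by (auto simp: C_def)
    next
      case False
      then have "l \<le> k" by simp
      then show ?thesis using path_cylinder_Int[OF _ XY(6,5)] XY by (auto simp: C_def Int_commute)
    qed
  qed
  \<comment> \<open>The image under the identity is the measure restricted to the smaller
    sigma-algebra.\<close>
  have id: "(\<lambda>a. a) \<in> \<Lambda> j \<rightarrow>\<^sub>M sigma PP C" for j
  proof (rule measurable_measure_of[OF C_Pow])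
    fix X assume "X \<in> C"
    then show "(\<lambda>a. a) -` X \<inter> space (\<Lambda> j) \<in> sets (\<Lambda> j)"
      using C_cyl sets.sets_into_space[of X path_algebra] by (auto simp: sets_\<Lambda> space_\<Lambda> sets_path_algebra Int_absorb2)
  qed (simp add: space_\<Lambda>)
  have sC: "sets (sigma PP C) = sigma_sets PP C" using C_Pow by (rule sets_measure_of)
  have spC: "space (sigma PP C) = PP" using C_Pow by (rule space_measure_of)
  have em: "emeasure (distr (\<Lambda> j) (sigma PP C) (\<lambda>a. a)) X = emeasure (\<Lambda> j) X"
    if "X \<in> sigma_sets PP C" for j X
    using that id sC sets.sets_into_space[of X "sigma PP C"] spC
    by (simp add: emeasure_distr space_\<Lambda> Int_absorb2)
  obtain W where W: "\<And>n::nat. W n \<in> sets BV" "\<And>n. emeasure \<mu> (W n) < \<infinity>" "(\<Union>n. W n) = topspace V0"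
    using cover_V0 by blast
  have eq: "distr (\<Lambda> m) (sigma PP C) (\<lambda>a. a) = distr (\<Lambda> n) (sigma PP C) (\<lambda>a. a)"
  proof (rule measure_eqI_generator_eq[OF C_Int C_Pow])
    fix X assume X: "X \<in> C"
    then have Xs: "X \<in> sigma_sets PP C" by blast
    obtain k B where "X = path_cylinder k B" "k \<le> n" "B \<in> sets (BF k)"
      using X by (auto simp: C_def)
    then show "emeasure (distr (\<Lambda> m) (sigma PP C) (\<lambda>a. a)) X = emeasure (distr (\<Lambda> n) (sigma PP C) (\<lambda>a. a)) X"
      unfolding em[OF Xs] using \<Lambda>_cylinder_consistent[of B k n m] nm by simp
  next
    have sub: "path_cylinder 0 (Vertex ` W i) \<in> C" for i
      using Vertex_image_sets[OF W(1)] by (auto simp: C_def)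
    then show "range (\<lambda>i. path_cylinder 0 (Vertex ` W i)) \<subseteq> C" by blast
    show "(\<Union>i. path_cylinder 0 (Vertex ` W i)) = PP"
      unfolding path_cylinder_0 using path_range_all W(3) by blast
    fix i
    show "emeasure (distr (\<Lambda> m) (sigma PP C) (\<lambda>a. a)) (path_cylinder 0 (Vertex ` W i)) \<noteq> \<infinity>"
      using W(2)[of i] sub[of i] \<Lambda>_range[OF W(1)]
      by (subst em) (auto simp: path_cylinder_0 less_top)
  qed (simp_all add: sC)
  have "(\<lambda>a. \<lambda>k\<in>{..n}. \<Psi> a k) \<in> sigma PP C \<rightarrow>\<^sub>M PiM {..n} (\<lambda>_. borel)"
  proof (rule measurable_restrict)
    fix k assume "k \<in> {..n}"
    then have "path_cylinder k B \<in> sets (sigma PP C)" if "B \<in> sets (BF k)" for B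
      using that unfolding sC by (intro sigma_sets.Basic) (auto simp: C_def)
    then show "(\<lambda>a. \<Psi> a k) \<in> sigma PP C \<rightarrow>\<^sub>M borel"
      by (intro \<Psi>_coordinate_measurable spC)
  qed
  from measurable_sets[OF this S]
  have X: "{a \<in> PP. restrict (\<Psi> a) {..n} \<in> S} \<in> sigma_sets PP C"
    by (simp add: spC sC vimage_def Int_def conj_commute)
  have "emeasure (distr (\<Lambda> j) \<Omega> \<Psi>) ((\<lambda>x. restrict x {..n}) -` S) =
      emeasure (\<Lambda> j) {a \<in> PP. restrict (\<Psi> a) {..n} \<in> S}" for j
  proof -
    have "\<Psi> -` ((\<lambda>x. restrict x {..n}) -` S) \<inter> space (\<Lambda> j) = {a \<in> PP. restrict (\<Psi> a) {..n} \<in> S}"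
      by (auto simp: space_\<Lambda>)
    then show ?thesis using \<Psi>_measurable_\<Omega> restrict_vimage[OF S] by (simp add: emeasure_distr)
  qed
  then show ?thesis using em[OF X, of m] em[OF X, of n] eq by simp
qed

lemma first_marginal_sigma_finite:
  "sigma_finite_measure (distr (distr (\<Lambda> 0) \<Omega> \<Psi>) borel (\<lambda>x. x 0))"
proof -
  let ?Q = "distr (distr (\<Lambda> 0) \<Omega> \<Psi>) borel (\<lambda>x. x 0)"
  obtain W where W: "\<And>n::nat. W n \<in> sets BV" "\<And>n. emeasure \<mu> (W n) < \<infinity>" "(\<Union>n. W n) = topspace V0"
    using cover_V0 by blast
  have em: "emeasure ?Q S = emeasure (\<Lambda> 0) {a \<in> PP. \<Psi> a 0 \<in> S}" if "S \<in> sets borel" for S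
  proof -
    have "(\<lambda>x. x 0) \<in> \<Omega> \<rightarrow>\<^sub>M borel" by simp
    moreover have "(\<lambda>x. x 0) -` S \<in> sets \<Omega>"
      using measurable_sets[OF calculation that] by (simp add: space_PiM)
    moreover have "\<Psi> -` ((\<lambda>x. x 0) -` S) \<inter> space (\<Lambda> 0) = {a \<in> PP. \<Psi> a 0 \<in> S}"
      by (auto simp: space_\<Lambda>)
    ultimately show ?thesis
      using that \<Psi>_measurable_\<Omega>[of 0] by (simp add: emeasure_distr space_PiM)
  qed
  have WS: "\<theta> 0 ` Vertex ` W n \<in> sets borel" for n
    using Vertex_image_sets[OF W(1)] std_embedding_sets[OF \<theta>_emb] by blast
  have PS: "\<theta> 0 ` P 0 \<in> sets borel"
    using std_embedding_range[OF \<theta>_emb, of 0] by simp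
  have 1: "emeasure ?Q (\<theta> 0 ` Vertex ` W n) \<noteq> \<infinity>" for n
  proof -
    have "{a \<in> PP. \<Psi> a 0 \<in> \<theta> 0 ` Vertex ` W n} = {a \<in> PP. path_range E a \<in> W n}"
      using path_cylinder_\<Psi>[OF Vertex_image_sets[OF W(1)], of n] path_cylinder_0[of "W n"] by simp
    then show ?thesis using em[OF WS] \<Lambda>_range[OF W(1)] W(2)[of n] by (simp add: less_top)
  qed
  \<comment> \<open>The sequence type is larger than the path space, so the sets coming from
    \<open>W n\<close> do not cover it. The rest carries no mass and joins the cover as one more
    set.\<close>
  have 2: "emeasure ?Q (- \<theta> 0 ` P 0) \<noteq> \<infinity>"
  proof -
    have e: "{a \<in> PP. \<Psi> a 0 \<in> - \<theta> 0 ` P 0} = {}"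
      using \<Psi>_0 path_range_all Vertex_in by auto
    show ?thesis using em[OF borel_comp[OF PS], unfolded e] by simp
  qed
  have un: "\<Union> (insert (- \<theta> 0 ` P 0) (range (\<lambda>n. \<theta> 0 ` Vertex ` W n))) = UNIV"
  proof -
    have "x \<in> (\<Union>n. \<theta> 0 ` Vertex ` W n)" if im: "x \<in> \<theta> 0 ` P 0" for x
    proof -
      obtain v where v: "v \<in> topspace V0" "x = \<theta> 0 (Vertex v)"
        using im by (auto simp: paths_of_length_0)
      then obtain n where "v \<in> W n" using W(3) by blast
      with v(2) show ?thesis by blast
    qed
    then show ?thesis by auto
  qed
  show ?thesis
  proof
    have "\<forall>a\<in>insert (- \<theta> 0 ` P 0) (range (\<lambda>n. \<theta> 0 ` Vertex ` W n)). emeasure ?Q a \<noteq> \<infinity>"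
      using 1 2 by blast
    then show "\<exists>A. countable A \<and> A \<subseteq> sets ?Q \<and> \<Union> A = space ?Q \<and> (\<forall>a\<in>A. emeasure ?Q a \<noteq> \<infinity>)"
      using un WS PS
      by (intro exI[of _ "insert (- \<theta> 0 ` P 0) (range (\<lambda>n. \<theta> 0 ` Vertex ` W n))"]) (auto simp: borel_comp)
  qed
qed

lemma limit_exists:
  "\<exists>M. sets M = sets \<Omega> \<and> (\<forall>n. \<forall>S\<in>sets (PiM {..n} (\<lambda>_. borel)).
     emeasure M ((\<lambda>x. restrict x {..n}) -` S) = emeasure (\<Lambda> n) {a \<in> PP. restrict (\<Psi> a) {..n} \<in> S})"
proof -
  have "emeasure (distr (\<Lambda> n) \<Omega> \<Psi>) ((\<lambda>x. restrict x {..n}) -` S) =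
      emeasure (\<Lambda> n) {a \<in> PP. restrict (\<Psi> a) {..n} \<in> S}"
    if S: "S \<in> sets (PiM {..n} (\<lambda>_. borel))" for n S
  proof -
    have "\<Psi> -` ((\<lambda>x. restrict x {..n}) -` S) \<inter> space (\<Lambda> n) = {a \<in> PP. restrict (\<Psi> a) {..n} \<in> S}"
      by (auto simp: space_\<Lambda>)
    then show ?thesis using \<Psi>_measurable_\<Omega> restrict_vimage[OF S] by (simp add: emeasure_distr)
  qed
  moreover have "\<exists>M. sets M = sets \<Omega> \<and> (\<forall>n. \<forall>S\<in>sets (PiM {..n} (\<lambda>_. borel)).
      emeasure M ((\<lambda>x. restrict x {..n}) -` S) =
      emeasure (distr (\<Lambda> n) \<Omega> \<Psi>) ((\<lambda>x. restrict x {..n}) -` S))"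
    by (rule kolmogorov_extension_sequence[OF _ \<Lambda>_consistent first_marginal_sigma_finite]) simp_all
  ultimately show ?thesis by simp
qed

definition M :: "(nat \<Rightarrow> nat \<Rightarrow> real) measure" where
  "M = (SOME M. sets M = sets \<Omega> \<and> (\<forall>n. \<forall>S\<in>sets (PiM {..n} (\<lambda>_. borel)).
     emeasure M ((\<lambda>x. restrict x {..n}) -` S) = emeasure (\<Lambda> n) {a \<in> PP. restrict (\<Psi> a) {..n} \<in> S}))"

lemma M_spec: "sets M = sets \<Omega> \<and> (\<forall>n. \<forall>S\<in>sets (PiM {..n} (\<lambda>_. borel)).
     emeasure M ((\<lambda>x. restrict x {..n}) -` S) = emeasure (\<Lambda> n) {a \<in> PP. restrict (\<Psi> a) {..n} \<in> S})"
  unfolding M_def by (rule someI_ex[OF limit_exists])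

lemma sets_M: "sets M = sets borel"
  using M_spec sets_\<Omega> by simp

lemma M_marginal: "S \<in> sets (PiM {..n} (\<lambda>_. borel)) \<Longrightarrow>
     emeasure M ((\<lambda>x. restrict x {..n}) -` S) = emeasure (\<Lambda> n) {a \<in> PP. restrict (\<Psi> a) {..n} \<in> S}"
  using M_spec[THEN conjunct2, rule_format] .

text \<open>All conditions on the limit concern two consecutive coordinates, whose joint law is that
  of the finite stage \<open>Suc n\<close>.\<close>

lemma M_pair:
  assumes R: "R \<in> sets (borel \<Otimes>\<^sub>M borel)"
  shows "{x. (x n, x (Suc n)) \<in> R} \<in> sets M"
    and "emeasure M {x. (x n, x (Suc n)) \<in> R} = emeasure (\<Lambda> (Suc n)) {a \<in> PP. (\<Psi> a n, \<Psi> a (Suc n)) \<in> R}"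
proof -
  have "(\<lambda>x. (x n, x (Suc n))) \<in> PiM {..Suc n} (\<lambda>_. borel :: (nat \<Rightarrow> real) measure) \<rightarrow>\<^sub>M borel \<Otimes>\<^sub>M borel"
    by (intro measurable_Pair measurable_component_singleton) auto
  from measurable_sets[OF this R]
  have S: "(\<lambda>x. (x n, x (Suc n))) -` R \<inter> space (PiM {..Suc n} (\<lambda>_. borel)) \<in> sets (PiM {..Suc n} (\<lambda>_. borel))" .
  have 1: "(\<lambda>x. restrict x {..Suc n}) -` ((\<lambda>x. (x n, x (Suc n))) -` R \<inter> space (PiM {..Suc n} (\<lambda>_. borel)))
      = {x. (x n, x (Suc n)) \<in> R}"
    by (auto simp: space_PiM)
  show "{x. (x n, x (Suc n)) \<in> R} \<in> sets M"
    using restrict_vimage[OF S] unfolding 1 sets_M sets_\<Omega> .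
  have 2: "{a \<in> PP. restrict (\<Psi> a) {..Suc n} \<in> (\<lambda>x. (x n, x (Suc n))) -` R \<inter> space (PiM {..Suc n} (\<lambda>_. borel))}
      = {a \<in> PP. (\<Psi> a n, \<Psi> a (Suc n)) \<in> R}"
    by (auto simp: space_PiM)
  show "emeasure M {x. (x n, x (Suc n)) \<in> R} = emeasure (\<Lambda> (Suc n)) {a \<in> PP. (\<Psi> a n, \<Psi> a (Suc n)) \<in> R}"
    using M_marginal[OF S] unfolding 1 2 .
qed

text \<open>Dropping the last edge, expressed in embedding coordinates, so that compatibility of
  consecutive segments becomes a Borel condition on pairs of sequences.\<close>

definition trunc :: "nat \<Rightarrow> (nat \<Rightarrow> real) \<Rightarrow> nat \<Rightarrow> real" where
  "trunc n y = (if y \<in> \<theta> (Suc n) ` P (Suc n)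
     then \<theta> n (initial E (inv_into (P (Suc n)) (\<theta> (Suc n)) y) n) else (\<lambda>_. 0))"

lemma trunc_\<theta>: "b \<in> P (Suc n) \<Longrightarrow> trunc n (\<theta> (Suc n) b) = \<theta> n (initial E b n)"
  using std_embedding_inj[OF \<theta>_emb, of "Suc n"] by (simp add: trunc_def inv_into_f_f)

lemma trunc_measurable: "trunc n \<in> borel_measurable borel"
proof -
  have "(\<lambda>b. \<theta> n (initial E b n)) \<in> BF (Suc n) \<rightarrow>\<^sub>M borel"
    using measurable_compose[OF continuous_map_measurable[OF continuous_initial]
      std_embedding_measurable[OF \<theta>_emb]] .
  from std_embedding_extend_measurable[OF \<theta>_emb this, unfolded topspace_T] show ?thesis
    unfolding trunc_def[abs_def] .
qed

section \<open>The limit is carried by boundary paths\<close>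

definition Q :: "(nat \<Rightarrow> nat \<Rightarrow> real) set" where
  "Q = \<Psi> ` BP"

lemma Q_sets: "Q \<in> sets borel"
  using std_embedding_range[OF std_embedding_boundary] by (simp add: Q_def)

lemma \<theta>_image_sets: "B \<in> sets (BF n) \<Longrightarrow> \<theta> n ` B \<in> sets borel"
  using std_embedding_sets[OF \<theta>_emb] by blast

text \<open>The pairs of consecutive coordinates that violate a hypothesis of \<open>path_of_initials\<close>.\<close>

definition exceptional :: "nat \<Rightarrow> ((nat \<Rightarrow> real) \<times> (nat \<Rightarrow> real)) set" where
  "exceptional n = {(y, z). y \<notin> insert (\<lambda>_. 0) (\<theta> n ` P n) \<or> n = 0 \<and> y = (\<lambda>_. 0) \<or>
     z \<in> \<theta> (Suc n) ` P (Suc n) \<and> y \<noteq> trunc n z \<or>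
     y \<in> \<theta> n ` {b \<in> P n. path_source E b \<in> regular_vertices E} \<and> z = (\<lambda>_. 0)}"

lemma exceptional_sets: "exceptional n \<in> sets (borel \<Otimes>\<^sub>M borel)"
proof -
  have z: "{\<lambda>_. 0 :: real} \<in> sets (borel :: (nat \<Rightarrow> real) measure)"
    by (intro borel_closed) simp
  have t: "{p \<in> space (borel \<Otimes>\<^sub>M borel). fst p \<noteq> trunc n (snd p)} \<in> sets (borel \<Otimes>\<^sub>M borel)"
  proof -
    have "{p \<in> space (borel \<Otimes>\<^sub>M borel). fst p = trunc n (snd p)} \<in> sets (borel \<Otimes>\<^sub>M borel)"
      by (intro measurable_equality_set measurable_fst measurable_compose[OF measurable_snd trunc_measurable])
    then have "space (borel \<Otimes>\<^sub>M borel) - {p \<in> space (borel \<Otimes>\<^sub>M borel). fst p = trunc n (snd p)}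
        \<in> sets (borel \<Otimes>\<^sub>M borel)" by (rule sets.compl_sets)
    moreover have "space (borel \<Otimes>\<^sub>M borel) - {p \<in> space (borel \<Otimes>\<^sub>M borel). fst p = trunc n (snd p)} =
        {p \<in> space (borel \<Otimes>\<^sub>M borel). fst p \<noteq> trunc n (snd p)}" by blast
    ultimately show ?thesis by simp
  qed
  have i: "- insert (\<lambda>_. 0) (\<theta> n ` P n) \<in> sets borel"
    using z \<theta>_image_sets[OF P_sets, of n] by (intro borel_comp) (metis insert_is_Un sets.Un)
  have "exceptional n = (- insert (\<lambda>_. 0) (\<theta> n ` P n)) \<times> UNIV \<union> (if n = 0 then {\<lambda>_. 0} else {}) \<times> UNIV \<union>
     (UNIV \<times> \<theta> (Suc n) ` P (Suc n)) \<inter> {p \<in> space (borel \<Otimes>\<^sub>M borel). fst p \<noteq> trunc n (snd p)} \<union>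
     \<theta> n ` {b \<in> P n. path_source E b \<in> regular_vertices E} \<times> {\<lambda>_. 0}"
    unfolding exceptional_def by (intro set_eqI) (auto simp: space_pair_measure simp del: insert_iff image_iff)
  also have "\<dots> \<in> sets (borel \<Otimes>\<^sub>M borel)"
    using z t i \<theta>_image_sets[OF P_sets] \<theta>_image_sets[OF source_regular_sets]
    by (intro sets.Un sets.Int pair_measureI) simp_all
  finally show ?thesis .
qed

text \<open>Coordinates of an actual path satisfy all structural conditions by themselves; the only
  possible violation is to end after \<open>n\<close> edges at a regular vertex, which is a null
  event at stage \<open>n + 1\<close>.\<close>

lemma exceptional_\<Psi>: "a \<in> PP \<Longrightarrow> (\<Psi> a n, \<Psi> a (Suc n)) \<in> exceptional n \<Longrightarrow> a \<in> regular_end n"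
proof -
  assume a: "a \<in> PP" and exc: "(\<Psi> a n, \<Psi> a (Suc n)) \<in> exceptional n"
  have 1: "\<Psi> a n \<in> insert (\<lambda>_. 0) (\<theta> n ` P n)" using initial_in[OF a] by (auto simp: \<Psi>_def)
  have 2: "\<Psi> a 0 \<noteq> (\<lambda>_. 0)" using \<Psi>_zero_iff[OF a, of 0] by (simp add: zero_enat_def[symmetric])
  have 3: "\<Psi> a n = trunc n (\<Psi> a (Suc n))" if im: "\<Psi> a (Suc n) \<in> \<theta> (Suc n) ` P (Suc n)"
  proof -
    obtain b where b: "b \<in> P (Suc n)" "\<Psi> a (Suc n) = \<theta> (Suc n) b" using im by auto
    then have l: "enat (Suc n) \<le> path_length a" "initial E a (Suc n) = b"
      using \<Psi>_eq[OF a b(1)] by auto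
    then have "enat n \<le> path_length a" by (auto intro: order_trans[of _ "enat (Suc n)"])
    then show ?thesis
      using b trunc_\<theta>[OF b(1)] initial_initial[OF a l(1), of n] l(2) by (simp add: \<Psi>_def)
  qed
  from exc 1 2 3 have "\<Psi> a n \<in> \<theta> n ` {b \<in> P n. path_source E b \<in> regular_vertices E}"
    "\<Psi> a (Suc n) = (\<lambda>_. 0)" unfolding exceptional_def by auto
  then obtain b where b: "b \<in> P n" "path_source E b \<in> regular_vertices E" "\<Psi> a n = \<theta> n b"
    "\<not> enat (Suc n) \<le> path_length a"
    using \<Psi>_zero_iff[OF a, of "Suc n"] by auto
  then have l: "enat n \<le> path_length a" "initial E a n = b" using \<Psi>_eq[OF a b(1)] by auto
  then have len: "path_length a = enat n" using b(4) by (cases "path_length a") auto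
  from a have "a \<in> P n" by (cases rule: all_paths_cases) (use len in auto)
  then show "a \<in> regular_end n" using b(2) l(2) initial_self by (simp add: regular_end_def)
qed

lemma exceptional_null: "emeasure M {x. (x n, x (Suc n)) \<in> exceptional n} = 0"
proof -
  have "emeasure (\<Lambda> (Suc n)) {a \<in> PP. (\<Psi> a n, \<Psi> a (Suc n)) \<in> exceptional n} \<le> emeasure (\<Lambda> (Suc n)) (regular_end n)"
    using exceptional_\<Psi> regular_end_sets sets_\<Lambda> by (intro emeasure_mono) auto
  then show ?thesis using M_pair(2)[OF exceptional_sets] regular_end_null[of n "Suc n"] by simp
qed

lemma Q_superset: "x \<in> Q" if "\<And>n. (x n, x (Suc n)) \<notin> exceptional n"
  unfolding Q_def
proof (rule path_of_initials)
  fix n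
  show "x n \<in> insert (\<lambda>_. 0) (\<theta> n ` P n)" using that[of n] unfolding exceptional_def by blast
  show "x 0 \<noteq> (\<lambda>_. 0)" using that[of 0] unfolding exceptional_def by blast
  show "x n = \<theta> n (initial E b n)" if "b \<in> P (Suc n)" "x (Suc n) = \<theta> (Suc n) b" for b
    using \<open>\<And>n. (x n, x (Suc n)) \<notin> exceptional n\<close>[of n] that trunc_\<theta>[OF that(1)] unfolding exceptional_def by auto
  show "x (Suc n) \<noteq> (\<lambda>_. 0)" if "b \<in> P n" "x n = \<theta> n b" "path_source E b \<in> regular_vertices E" for b
    using \<open>\<And>n. (x n, x (Suc n)) \<notin> exceptional n\<close>[of n] that unfolding exceptional_def by blast
qed

text \<open>Outside a countable union of null events \<open>path_of_initials\<close> produces a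
  boundary path.\<close>

lemma Q_null: "emeasure M (- Q) = 0"
proof -
  have "emeasure M (\<Union>n. {x. (x n, x (Suc n)) \<in> exceptional n}) = 0"
    using exceptional_null M_pair(1)[OF exceptional_sets] by (intro emeasure_UN_eq_0) auto
  moreover have "- Q \<subseteq> (\<Union>n. {x. (x n, x (Suc n)) \<in> exceptional n})" using Q_superset by blast
  ultimately show ?thesis
    using emeasure_mono[of "- Q" "\<Union>n. {x. (x n, x (Suc n)) \<in> exceptional n}" M] M_pair(1)[OF exceptional_sets]
    by (simp add: sets.countable_UN image_subset_iff)
qed

text \<open>The limit measure brought back to the boundary along the injective
  \<open>\<Psi>\<close>; no mass is lost because the limit is carried by the image.\<close>

definition \<nu> :: "('v, 'e) path measure" where
  "\<nu> = measure_of BP (sets BB) (\<lambda>B. emeasure M (\<Psi> ` (B \<inter> BP)))"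

lemma sets_\<nu>: "sets \<nu> = sets BB"
  unfolding \<nu>_def using sets.sigma_sets_eq[of BB] sets.space_closed[of BB] by (simp add: sets_measure_of)

lemma emeasure_\<nu>: "B \<in> sets BB \<Longrightarrow> emeasure \<nu> B = emeasure M (\<Psi> ` B)"
proof -
  assume B: "B \<in> sets BB"
  have "emeasure \<nu> B = emeasure M (\<Psi> ` (B \<inter> BP))"
    unfolding \<nu>_def
  proof (rule emeasure_measure_of_sigma)
    show "sigma_algebra BP (sets BB)"
      using sets.sigma_algebra_axioms[of BB] by simp
    have "\<Psi> ` (C \<inter> BP) \<in> sets M" if "C \<in> sets BB" for C
    proof -
      have "C \<inter> BP = C" using that boundary_sets by blast
      then show ?thesis using that std_embedding_sets[OF std_embedding_boundary] sets_M by simp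
    qed
    then show "countably_additive (sets BB) (\<lambda>B. emeasure M (\<Psi> ` (B \<inter> BP)))"
      using std_embedding_inj[OF std_embedding_boundary] by (intro countably_additive_image) auto
  qed (use B in \<open>auto simp: positive_def\<close>)
  moreover have "B \<inter> BP = B" using B boundary_sets by blast
  ultimately show ?thesis by simp
qed

text \<open>Stage \<open>Suc n\<close> appears because the limit is read on the pair of coordinates
  \<open>n\<close> and \<open>n + 1\<close>. By consistency it agrees with stage \<open>n\<close>
  here, and the shifted index fits one application of \<open>G\<close> below.\<close>

lemma incl_\<nu>_cylinder:
  assumes B: "B \<in> sets (BF n)"
  shows "emeasure (incl \<nu>) (path_cylinder n B) = emeasure (\<Lambda> (Suc n)) (path_cylinder n B)"
proof -
  have S: "path_cylinder n B \<inter> BP \<in> sets BB"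
    using path_cylinder_sets[OF B] boundary_path_algebra boundary_sets by auto
  have R: "\<theta> n ` B \<times> UNIV \<in> sets (borel \<Otimes>\<^sub>M borel)"
    using \<theta>_image_sets[OF B] by auto
  have Y: "{x. x n \<in> \<theta> n ` B} = {x. (x n, x (Suc n)) \<in> \<theta> n ` B \<times> UNIV}" by auto
  have "emeasure (incl \<nu>) (path_cylinder n B) = emeasure M (\<Psi> ` (path_cylinder n B \<inter> BP))"
    using incl(2)[OF sets_\<nu> path_cylinder_sets[OF B]] emeasure_\<nu>[OF S] by simp
  also have "\<Psi> ` (path_cylinder n B \<inter> BP) = {x. x n \<in> \<theta> n ` B} - (- Q)"
    unfolding path_cylinder_\<Psi>[OF B] Q_def using boundary_in_all by auto
  also have "emeasure M \<dots> = emeasure M {x. x n \<in> \<theta> n ` B}"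
    using M_pair(1)[OF R] Q_null Q_sets sets_M unfolding Y
    by (intro emeasure_Diff_null_set) (auto simp: null_sets_def borel_comp)
  also have "\<dots> = emeasure (\<Lambda> (Suc n)) {a \<in> PP. \<Psi> a n \<in> \<theta> n ` B}"
    unfolding Y M_pair(2)[OF R] by simp
  finally show ?thesis by (simp add: path_cylinder_\<Psi>[OF B])
qed

lemma incl_\<nu>_range:
  assumes B: "B \<in> sets BV"
  shows "emeasure (incl \<nu>) {a \<in> PP. path_range E a \<in> B} = emeasure \<mu> B"
  using incl_\<nu>_cylinder[OF Vertex_image_sets[OF B]] \<Lambda>_range[OF B] by (simp add: path_cylinder_0)

lemma push_\<nu>: "push \<nu> = \<mu>"
proof (rule measure_eqI)
  fix B assume "B \<in> sets (push \<nu>)"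
  then have B: "B \<in> sets BV" by simp
  have "{a \<in> PP. path_range E a \<in> B} \<inter> BP = {a \<in> BP. path_range E a \<in> B}" using boundary_in_all by auto
  then show "emeasure (push \<nu>) B = emeasure \<mu> B"
    using push_emeasure[OF sets_\<nu> B] incl(2)[OF sets_\<nu> range_sets[OF B]] incl_\<nu>_range[OF B] by simp
qed (simp add: sets_\<mu>)

text \<open>On level \<open>k + 1\<close> the left side is given by the stage
  \<open>G (\<Lambda> (Suc k))\<close>, while on the right \<open>G\<close> reads its argument on
  level \<open>k\<close>, where it agrees with \<open>\<Lambda> (Suc k)\<close>. Level 0 is
  invariance of the range distribution.\<close>

lemma incl_\<nu>_fixed: "incl \<nu> = G (incl \<nu>)"
proof (rule measure_eq_path_algebra)
  show "sets (incl \<nu>) = sets path_algebra" "sets (G (incl \<nu>)) = sets path_algebra"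
    using incl(1)[OF sets_\<nu>] by auto
  note s = incl(1)[OF sets_\<nu>]
  fix n B assume B: "B \<in> sets (BF n)"
  show "emeasure (incl \<nu>) (path_cylinder n B) = emeasure (G (incl \<nu>)) (path_cylinder n B)"
  proof (cases n)
    case 0
    then obtain C where C: "C \<in> sets BV" "B = Vertex ` C" using Borel_T0 B by metis
    show ?thesis
      unfolding 0 C(2) path_cylinder_0 using incl_\<nu>_range[OF C(1)] G_range[OF s C(1) incl_\<nu>_range] by simp
  next
    case (Suc k)
    have B': "B \<in> sets (BF (Suc k))" using B Suc by simp
    show ?thesis
      unfolding Suc incl_\<nu>_cylinder[OF B'] \<Lambda>_Suc[of "Suc k"] G_cylinder_Suc[OF s B']
        G_cylinder_Suc[OF sets_\<Lambda> B'] incl_\<nu>_cylinder[OF pre_sets[OF B']] by simp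
  qed
next
  fix K assume K: "compactin V0 K"
  show "emeasure (incl \<nu>) {a \<in> PP. path_range E a \<in> K} < \<infinity>"
    using incl_\<nu>_range[OF compact_V0_sets[OF K]] regular_measures_finite[OF \<mu>_regular K] by simp
qed

lemma \<nu>_regular: "\<nu> \<in> regular_measures TB"
proof (rule regular_measuresI[OF std_embedding_boundary relatively_compact_cover_boundary])
  show "\<nu> \<in> borel_measures TB" by (simp add: borel_measures_def sets_\<nu>)
  fix K assume K: "compactin TB K"
  have C: "compactin V0 (path_range E ` K)" using image_compactin[OF K continuous_boundary_range] .
  have Cs: "path_range E ` K \<in> sets BV" using compact_V0_sets[OF C] .
  have "emeasure \<nu> K \<le> emeasure \<nu> {a \<in> BP. path_range E a \<in> path_range E ` K}"
    using range_boundary_sets[OF Cs] sets_\<nu> compactin_subset_topspace[OF K] by (intro emeasure_mono) auto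
  also have "\<dots> = emeasure \<mu> (path_range E ` K)"
    using push_emeasure[OF sets_\<nu> Cs] push_\<nu> by simp
  also have "\<dots> < \<infinity>" using regular_measures_finite[OF \<mu>_regular C] .
  finally show "emeasure \<nu> K < \<infinity>" .
qed

text \<open>Sets of paths of positive length contain no vertices, so the defect drops out of the
  fixed-point equation; multiplying by exp \<beta> leaves the working form of
  quasi-invariance.\<close>

lemma \<nu>_quasi_invariant: "\<nu> \<in> quasi_invariant_measures E \<beta>"
  unfolding quasi_invariant_iff
proof (intro conjI \<nu>_regular ballI impI)
  fix B assume B: "B \<in> sets path_algebra" "B \<subseteq> pos"
  have e: "{v \<in> topspace V0. Vertex v \<in> B} = {}"
    using B(2) by (auto simp: positive_boundary_paths_def)
  have "emeasure (incl \<nu>) B = \<kappa> * (\<Sum>i. emeasure (incl \<nu>) {a \<in> dom i. ext i a \<in> B})"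
    using emeasure_G[OF incl(1)[OF sets_\<nu>] B(1), folded incl_\<nu>_fixed, unfolded e] by simp
  moreover have "{a \<in> dom i. ext i a \<in> B} \<inter> BP = {a \<in> dom i. ext i a \<in> B}" for i
    using ext_props(2) B(2) pos_subset by blast
  moreover have "B \<inter> BP = B" using B(2) pos_subset by blast
  ultimately have "emeasure \<nu> B = \<kappa> * (\<Sum>i. emeasure \<nu> {a \<in> dom i. ext i a \<in> B})"
    using incl(2)[OF sets_\<nu> B(1)] incl(2)[OF sets_\<nu> ext_sets[OF B(1)]] by simp
  then show "(\<Sum>i. emeasure \<nu> {a \<in> dom i. ext i a \<in> B}) = ennreal (exp \<beta>) * emeasure \<nu> B"
    by (simp add: mult.assoc[symmetric] exp_\<kappa>)
qed

end

section \<open>Surjectivity and affinity of the pushforward\<close>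

context charted_graph
begin

lemma push_surj: "push ` quasi_invariant_measures E \<beta> = sub_invariant_measures E \<beta>"
proof (intro subset_antisym subsetI)
  fix \<mu> assume "\<mu> \<in> sub_invariant_measures E \<beta>"
  then interpret sub_invariant E \<theta> Ch \<beta> \<mu> by unfold_locales
  show "\<mu> \<in> push ` quasi_invariant_measures E \<beta>"
    using \<nu>_quasi_invariant push_\<nu> by (metis imageI)
qed (use push_sub_invariant in auto)

text \<open>The branch sums in \<open>quasi_invariant_iff\<close> are linear in the measure, and
  regularity reduces to finiteness on compact sets, so both pass to convex combinations.\<close>

lemma convex_quasi_invariant: "convex_measures (quasi_invariant_measures E \<beta>)"
  unfolding convex_measures_def
proof (intro ballI)
  fix \<mu> \<nu> and t :: real
  assume \<mu>: "\<mu> \<in> quasi_invariant_measures E \<beta>" and \<nu>: "\<nu> \<in> quasi_invariant_measures E \<beta>"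
  note regs = quasi_invariant_iff[THEN iffD1, OF \<mu>, THEN conjunct1] quasi_invariant_iff[THEN iffD1, OF \<nu>, THEN conjunct1]
  note q = quasi_invariant_iff[THEN iffD1, OF \<mu>, THEN conjunct2] quasi_invariant_iff[THEN iffD1, OF \<nu>, THEN conjunct2]
  have s: "sets \<mu> = sets BB" "sets \<nu> = sets BB" using regular_measures_sets regs by auto
  have em: "emeasure (convex_comb t \<mu> \<nu>) B = ennreal t * emeasure \<mu> B + ennreal (1 - t) * emeasure \<nu> B"
    if "B \<in> sets path_algebra" "B \<subseteq> BP" for B
    using that s boundary_sets by (intro emeasure_convex_comb) auto
  show "convex_comb t \<mu> \<nu> \<in> quasi_invariant_measures E \<beta>"
    unfolding quasi_invariant_iff
  proof (intro conjI ballI impI)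
    show "convex_comb t \<mu> \<nu> \<in> regular_measures TB"
      by (rule convex_comb_regular[OF std_embedding_boundary relatively_compact_cover_boundary regs])
    fix B assume B: "B \<in> sets path_algebra" "B \<subseteq> pos"
    have "{a \<in> dom i. ext i a \<in> B} \<subseteq> BP" for i using ext_props(2) B(2) pos_subset by blast
    then have "(\<Sum>i. emeasure (convex_comb t \<mu> \<nu>) {a \<in> dom i. ext i a \<in> B}) =
        ennreal t * (\<Sum>i. emeasure \<mu> {a \<in> dom i. ext i a \<in> B}) +
        ennreal (1 - t) * (\<Sum>i. emeasure \<nu> {a \<in> dom i. ext i a \<in> B})"
      using em[OF ext_sets[OF B(1)]] by (simp add: suminf_convex_comb)
    also have "\<dots> = ennreal (exp \<beta>) * emeasure (convex_comb t \<mu> \<nu>) B"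
      using q[rule_format, OF B] em[OF B(1)] B(2) pos_subset
      by (simp add: distrib_left mult.left_commute)
    finally show "(\<Sum>i. emeasure (convex_comb t \<mu> \<nu>) {a \<in> dom i. ext i a \<in> B}) =
        ennreal (exp \<beta>) * emeasure (convex_comb t \<mu> \<nu>) B" .
  qed
qed

lemma convex_sub_invariant: "convex_measures (sub_invariant_measures E \<beta>)"
  unfolding convex_measures_def
proof (intro ballI)
  fix \<mu> \<nu> and t :: real
  assume \<mu>: "\<mu> \<in> sub_invariant_measures E \<beta>" and \<nu>: "\<nu> \<in> sub_invariant_measures E \<beta>"
  obtain \<theta>V :: "'v \<Rightarrow> nat \<Rightarrow> real" where \<theta>V: "std_embedding V0 \<theta>V" using std_embedding_V0 by blast
  have regs: "\<mu> \<in> regular_measures V0" "\<nu> \<in> regular_measures V0"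
    using \<mu> \<nu> by (auto simp: sub_invariant_measures_def)
  have s: "sets \<mu> = sets (BV)" "sets \<nu> = sets (BV)"
    using regular_measures_sets regs by auto
  have reg: "convex_comb t \<mu> \<nu> \<in> regular_measures V0"
    by (rule convex_comb_regular[OF \<theta>V relatively_compact_cover_V0 regs])
  have em: "emeasure (convex_comb t \<mu> \<nu>) B = ennreal t * emeasure \<mu> B + ennreal (1 - t) * emeasure \<nu> B"
    if "B \<in> sets (BV)" for B
    using that s by (intro emeasure_convex_comb) auto
  have tr: "emeasure (transfer E (convex_comb t \<mu> \<nu>)) B =
      ennreal t * emeasure (transfer E \<mu>) B + ennreal (1 - t) * emeasure (transfer E \<nu>) B"
    if B: "B \<in> sets (BV)" for B
    using transfer_formula(2)[OF reg B] transfer_formula(2)[OF regs(1) B] transfer_formula(2)[OF regs(2) B]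
      em[OF pre0_sets[OF B]] by (simp add: suminf_convex_comb)
  show "convex_comb t \<mu> \<nu> \<in> sub_invariant_measures E \<beta>"
    unfolding sub_invariant_measures_def mem_Collect_eq
  proof (intro conjI reg ballI impI)
    fix B assume B: "B \<in> sets (BV)"
    have le: "emeasure (transfer E \<mu>) B \<le> ennreal (exp \<beta>) * emeasure \<mu> B"
      "emeasure (transfer E \<nu>) B \<le> ennreal (exp \<beta>) * emeasure \<nu> B"
      using \<mu> \<nu> B by (auto simp: sub_invariant_measures_def)
    have "emeasure (transfer E (convex_comb t \<mu> \<nu>)) B \<le>
        ennreal t * (ennreal (exp \<beta>) * emeasure \<mu> B) + ennreal (1 - t) * (ennreal (exp \<beta>) * emeasure \<nu> B)"
      unfolding tr[OF B] by (intro add_mono mult_left_mono le) auto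
    then show "emeasure (transfer E (convex_comb t \<mu> \<nu>)) B \<le>
        ennreal (exp \<beta>) * emeasure (convex_comb t \<mu> \<nu>) B"
      by (simp add: em[OF B] distrib_left mult.left_commute)
    assume R: "B \<subseteq> regular_vertices E"
    have "emeasure (transfer E \<mu>) B = ennreal (exp \<beta>) * emeasure \<mu> B"
      "emeasure (transfer E \<nu>) B = ennreal (exp \<beta>) * emeasure \<nu> B"
      using \<mu> \<nu> B R by (auto simp: sub_invariant_measures_def)
    then show "emeasure (transfer E (convex_comb t \<mu> \<nu>)) B =
        ennreal (exp \<beta>) * emeasure (convex_comb t \<mu> \<nu>) B"
      by (simp add: tr[OF B] em[OF B] distrib_left mult.left_commute)
  qed
qed

lemma push_convex_comb:
  assumes \<mu>: "\<mu> \<in> quasi_invariant_measures E \<beta>" and \<nu>: "\<nu> \<in> quasi_invariant_measures E \<beta>"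
  shows "push (convex_comb t \<mu> \<nu>) = convex_comb t (push \<mu>) (push \<nu>)"
proof (rule measure_eqI)
  have s: "sets \<mu> = sets BB" "sets \<nu> = sets BB"
    using \<mu> \<nu> quasi_invariant_iff regular_measures_sets by blast+
  fix B assume "B \<in> sets (push (convex_comb t \<mu> \<nu>))"
  then have B: "B \<in> sets (BV)" by simp
  have "emeasure (push (convex_comb t \<mu> \<nu>)) B =
      ennreal t * emeasure \<mu> {a \<in> BP. path_range E a \<in> B} + ennreal (1 - t) * emeasure \<nu> {a \<in> BP. path_range E a \<in> B}"
    using push_emeasure[OF _ B, of "convex_comb t \<mu> \<nu>"] emeasure_convex_comb[of \<nu> \<mu>] s range_boundary_sets[OF B]
    by simp
  also have "\<dots> = emeasure (convex_comb t (push \<mu>) (push \<nu>)) B"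
    using push_emeasure[OF s(1) B] push_emeasure[OF s(2) B] emeasure_convex_comb[of "push \<nu>" "push \<mu>"] B by simp
  finally show "emeasure (push (convex_comb t \<mu> \<nu>)) B = emeasure (convex_comb t (push \<mu>) (push \<nu>)) B" .
qed simp

end

theorem proposition5p7:
  fixes E :: "('v, 'e) graph" and \<beta> :: real
  assumes "topological_graph E" and "second_countable_graph E"
  shows "bij_betw (pushforward (vertex_space E) (path_range E))
           (quasi_invariant_measures E \<beta>) (sub_invariant_measures E \<beta>) \<and>
         affine_map (quasi_invariant_measures E \<beta>) (sub_invariant_measures E \<beta>)
           (pushforward (vertex_space E) (path_range E))"
proof -
  interpret sc_graph E using assms by unfold_locales
  obtain \<theta> where \<theta>: "\<forall>n. compactification (T n) (\<theta> n)" using compactification_T by blast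
  obtain Ch :: "nat \<Rightarrow> 'e set" where Ch: "\<forall>i. chart (Ch i)" "(\<Union>i. Ch i) = topspace E1"
    using charts_exist by blast
  interpret charted_graph E \<theta> Ch using \<theta> Ch by unfold_locales auto
  have "push \<in> quasi_invariant_measures E \<beta> \<rightarrow> sub_invariant_measures E \<beta>"
    using push_sub_invariant by blast
  then show ?thesis
    unfolding bij_betw_def affine_map_def
    using push_inj push_surj convex_quasi_invariant convex_sub_invariant push_convex_comb by blast
qed

end
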